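(* Let $(k_0,\mathbf{k})\in\mathbb{N}^{d+1}$ and suppose that the mixed multiplicity $e(J^{[k_0+1]},\mathbf{I}^{[\mathbf{k}]};N)$ is defined. Let $\mathbf{x}$ be a weak-$(FC)$-sequence of $N$ with respect to $J,\mathbf{I}$ of the type $(k_0,\mathbf{k})$. Then $$e\big(J^{[k_0+1]},\mathbf{I}^{[\mathbf{k}]};N\big)=e\Big(J;\frac{N}{\mathbf{x}N:I^\infty}\Big).$$ Moreover, $e(J^{[k_0+1]},\mathbf{I}^{[\mathbf{k}]};N)\ne0$ if and only if $\dim\dfrac{N}{\mathbf{x}N:I^\infty}=1$.
   Context: $\mathbb{N}$ denotes the nonnegative integers, $d\ge1$. $(R,\mathfrak{n})$ is a Noetherian local ring with infinite residue field, $N$ is a finitely generated $R$-module, $J,I_1,\ldots,I_d$ are ideals of $R$ with $J$ being $\mathfrak{n}$-primary. Put $\mathbf{I}=I_1,\ldots,I_d$, $I_0=J$, $I=JI_1\cdots I_d$, and $\mathbb{I}^{\mathbf{n}}=I_1^{n_1}\cdots I_d^{n_d}$. For a submodule $L$ of a module $N$, $L:x=\{m\in N:xm\in L\}$ and $L:I^\infty=\bigcup_{t\ge0}\{m\in N: I^tm\subseteq L\}$. "For all large $\mathbf{n}$" (or $\mathbf{n}\gg\mathbf{0}$) means every component is sufficiently large. $\dim 0=-\infty$. $e(J;Q)$ is the Hilbert–Samuel multiplicity of a finitely generated $R$-module $Q$ with respect to $J$ (in dimension $\dim Q$), with $e(J;0)=0$. Mixed multiplicities of ideals: let $T=\bigoplus_{n\ge0,\,\mathbf{n}\ge\mathbf{0}}J^n\mathbb{I}^{\mathbf{n}}/J^{n+1}\mathbb{I}^{\mathbf{n}}$,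 a standard $\mathbb{N}^{d+1}$-graded algebra over the Artinian local ring $R/J$, and $\mathcal{N}=\bigoplus_{n\ge0,\,\mathbf{n}\ge\mathbf{0}}J^n\mathbb{I}^{\mathbf{n}}N/J^{n+1}\mathbb{I}^{\mathbf{n}}N$, a finitely generated $\mathbb{N}^{d+1}$-graded $T$-module. For all large $(n_0,\mathbf{n})$ the length of $\mathcal{N}_{(n_0,\mathbf{n})}$ is given by a polynomial, written uniquely as $\sum_{(k_0,\mathbf{k})\in\mathbb{N}^{d+1}}e(\mathcal{N};k_0,\mathbf{k})\prod_{i=0}^d\binom{n_i+k_i}{k_i}$ with integer coefficients. The mixed multiplicity $e(J^{[k_0+1]},\mathbf{I}^{[\mathbf{k}]};N)$ is defined if $e(\mathcal{N};h_0,\mathbf{h})=0$ for all $(h_0,\mathbf{h})\ne(k_0,\mathbf{k})$ with $(h_0,\mathbf{h})\ge(k_0,\mathbf{k})$ componentwise; then $e(J^{[k_0+1]},\mathbf{I}^{[\mathbf{k}]};N):=e(\mathcal{N};k_0,\mathbf{k})$. Weak-$(FC)$-sequences: an element $a\in R$ is a weak-$(FC)$-element of $N$ with respect to $J,\mathbf{I}$ if for some $i\in\{0,\ldots,d\}$, $a\in I_i$, $aN\cap J^{n_0}\mathbb{I}^{\mathbf{n}}I_iN=aJ^{n_0}\mathbb{I}^{\mathbf{n}}N$ for all $(n_0,\mathbf{n})\gg\mathbf{0}$, and $0_N:a\subseteq0_N:I^\infty$; it is then counted as an element of $I_i$. A sequence $x_1,\ldots,x_t$ is a weak-$(FC)$-sequence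 of $N$ with respect to $J,\mathbf{I}$ if each $x_{j+1}$ is a weak-$(FC)$-element of $N/(x_1,\ldots,x_j)N$ with respect to $J,\mathbf{I}$ ($0\le j<t$); it is of the type $(k_0,\mathbf{k})$ if it consists of $k_0$ elements of $J$, $k_1$ elements of $I_1$, ..., $k_d$ elements of $I_d$ (in any order). *)

theory Defs
  imports
    "HOL-Computational_Algebra.Polynomial"
    "HOL-Library.Extended_Nat"
    "HOL-Library.Extended_Real"
    "HOL-Algebra.Ring_Divisibility"
    "HOL-Algebra.Ideal_Product"
    "HOL-Algebra.Module"
begin

section \<open>Rings and ideals\<close>

definition local_ring :: "('a, 'r) ring_scheme \<Rightarrow> 'a set \<Rightarrow> bool" where
  "local_ring R \<nn> \<longleftrightarrow>
     cring R \<and> maximalideal \<nn> R \<and> (\<forall>\<mm>. maximalideal \<mm> R \<longrightarrow> \<mm> = \<nn>)"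

definition ideal_radical :: "('a, 'r) ring_scheme \<Rightarrow> 'a set \<Rightarrow> 'a set" where
  "ideal_radical R Q = {a \<in> carrier R. \<exists>n::nat. a [^]\<^bsub>R\<^esub> n \<in> Q}"

definition primary_ideal :: "'a set \<Rightarrow> ('a, 'r) ring_scheme \<Rightarrow> bool" where
  "primary_ideal Q R \<longleftrightarrow> ideal Q R \<and> Q \<noteq> carrier R \<and>
     (\<forall>a\<in>carrier R. \<forall>b\<in>carrier R.
        a \<otimes>\<^bsub>R\<^esub> b \<in> Q \<longrightarrow> a \<in> Q \<or> (\<exists>n::nat. b [^]\<^bsub>R\<^esub> n \<in> Q))"

text \<open>In the monoid \<^term>\<open>ideals_set R\<close> multiplication is the product of ideals and the unit
  is the unit ideal. A tuple of ideals \<open>I\<^sub>0, \<dots>, I\<^sub>d\<close> is a function on \<^typ>\<open>nat\<close> of which only the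
  values at \<open>0, \<dots>, d\<close> matter; \<open>I\<^sub>0\<close> is the ideal called \<open>J\<close> in the theory of mixed
  multiplicities.\<close>

definition ideal_power :: "('a, 'r) ring_scheme \<Rightarrow> 'a set \<Rightarrow> nat \<Rightarrow> 'a set" where
  "ideal_power R I n = I [^]\<^bsub>ideals_set R\<^esub> n"

definition multi_power ::
  "('a, 'r) ring_scheme \<Rightarrow> nat \<Rightarrow> (nat \<Rightarrow> 'a set) \<Rightarrow> (nat \<Rightarrow> nat) \<Rightarrow> 'a set" where
  "multi_power R d I n = (\<Otimes>\<^bsub>ideals_set R\<^esub> i \<in> {..d}. ideal_power R (I i) (n i))"

definition ideals_product ::
  "('a, 'r) ring_scheme \<Rightarrow> nat \<Rightarrow> (nat \<Rightarrow> 'a set) \<Rightarrow> 'a set" where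
  "ideals_product R d I = (\<Otimes>\<^bsub>ideals_set R\<^esub> i \<in> {..d}. I i)"


section \<open>Modules\<close>

definition fin_gen_module ::
  "('a, 'r) ring_scheme \<Rightarrow> ('a, 'b, 'm) module_scheme \<Rightarrow> bool" where
  "fin_gen_module R M \<longleftrightarrow> Module.module R M \<and>
     (\<exists>A. finite A \<and> A \<subseteq> carrier M \<and> \<Inter>{H. submodule H R M \<and> A \<subseteq> H} = carrier M)"

text \<open>The product \<open>I H\<close> of an ideal \<open>I\<close> and a submodule \<open>H\<close> of \<open>M\<close>, in analogy to
  \<^const>\<open>ideal_prod\<close>.\<close>

inductive_set ideal_smult ::
  "('a, 'b, 'm) module_scheme \<Rightarrow> 'a set \<Rightarrow> 'b set \<Rightarrow> 'b set"
  for M and I and H where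
    prod: "\<lbrakk> a \<in> I; x \<in> H \<rbrakk> \<Longrightarrow> a \<odot>\<^bsub>M\<^esub> x \<in> ideal_smult M I H"
  | sum: "\<lbrakk> x \<in> ideal_smult M I H; y \<in> ideal_smult M I H \<rbrakk> \<Longrightarrow> x \<oplus>\<^bsub>M\<^esub> y \<in> ideal_smult M I H"

text \<open>The quotient module \<open>M/H\<close>. The fields \<open>mult\<close> and \<open>one\<close> are inherited from the ring record;
  they play no role for modules.\<close>

definition quot_module ::
  "('a, 'b, 'm) module_scheme \<Rightarrow> 'b set \<Rightarrow> ('a, 'b set) module" where
  "quot_module M H =
     \<lparr>carrier = a_rcosets\<^bsub>M\<^esub> H, mult = rcoset_mult M H, one = H +>\<^bsub>M\<^esub> \<one>\<^bsub>M\<^esub>,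
      zero = H, add = set_add M, smult = (\<lambda>a X. \<Union>x\<in>X. H +>\<^bsub>M\<^esub> (a \<odot>\<^bsub>M\<^esub> x))\<rparr>"

definition colon_elem :: "('a, 'b, 'm) module_scheme \<Rightarrow> 'b set \<Rightarrow> 'a \<Rightarrow> 'b set" where
  "colon_elem M L x = {m \<in> carrier M. x \<odot>\<^bsub>M\<^esub> m \<in> L}"

definition colon_infinity ::
  "('a, 'r) ring_scheme \<Rightarrow> ('a, 'b, 'm) module_scheme \<Rightarrow> 'b set \<Rightarrow> 'a set \<Rightarrow> 'b set" where
  "colon_infinity R M L I =
     (\<Union>t. {m \<in> carrier M. \<forall>a \<in> ideal_power R I t. a \<odot>\<^bsub>M\<^esub> m \<in> L})"

definition module_length ::
  "('a, 'r) ring_scheme \<Rightarrow> ('a, 'b, 'm) module_scheme \<Rightarrow> enat" where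
  "module_length R M = Sup {enat n | n. \<exists>S :: nat \<Rightarrow> 'b set.
     (\<forall>i\<le>n. submodule (S i) R M) \<and> (\<forall>i<n. S i \<subset> S (Suc i))}"

definition module_annihilator ::
  "('a, 'r) ring_scheme \<Rightarrow> ('a, 'b, 'm) module_scheme \<Rightarrow> 'a set" where
  "module_annihilator R M = {a \<in> carrier R. \<forall>m\<in>carrier M. a \<odot>\<^bsub>M\<^esub> m = \<zero>\<^bsub>M\<^esub>}"

text \<open>The Krull dimension of \<open>R / Ann M\<close>. For \<open>M = 0\<close> no prime ideal contains the annihilator,
  and the supremum of the empty set in \<^typ>\<open>ereal\<close> is \<open>- \<infinity>\<close>.\<close>

definition module_dim ::
  "('a, 'r) ring_scheme \<Rightarrow> ('a, 'b, 'm) module_scheme \<Rightarrow> ereal" where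
  "module_dim R M = Sup {ereal (real n) | n. \<exists>P :: nat \<Rightarrow> 'a set.
     (\<forall>i\<le>n. primeideal (P i) R \<and> module_annihilator R M \<subseteq> P i) \<and>
     (\<forall>i<n. P i \<subset> P (Suc i))}"


section \<open>Hilbert-Samuel multiplicity\<close>

definition hilbert_samuel_poly ::
  "('a, 'r) ring_scheme \<Rightarrow> 'a set \<Rightarrow> ('a, 'b, 'm) module_scheme \<Rightarrow> rat poly" where
  "hilbert_samuel_poly R J M = (THE p. \<exists>n\<^sub>0. \<forall>n\<ge>n\<^sub>0. \<exists>l.
     module_length R (quot_module M (ideal_smult M (ideal_power R J (Suc n)) (carrier M))) = enat l \<and>
     of_nat l = Polynomial.poly p (of_nat n))"

text \<open>For \<open>s = dim M\<close>, the multiplicity is \<open>s!\<close> times the coefficient of \<open>n\<^sup>s\<close> in the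
  Hilbert-Samuel polynomial.\<close>

definition hs_multiplicity ::
  "('a, 'r) ring_scheme \<Rightarrow> 'a set \<Rightarrow> ('a, 'b, 'm) module_scheme \<Rightarrow> rat" where
  "hs_multiplicity R J M =
     (if carrier M = {\<zero>\<^bsub>M\<^esub>} then 0
      else let s = (THE s::nat. module_dim R M = ereal (real s))
           in fact s * Polynomial.coeff (hilbert_samuel_poly R J M) s)"


section \<open>Mixed multiplicities\<close>

text \<open>\<open>\<nat>\<^sup>d\<^sup>+\<^sup>1\<close>, with coordinates numbered from \<open>0\<close> to \<open>d\<close>.\<close>

definition multi_index :: "nat \<Rightarrow> (nat \<Rightarrow> nat) set" where
  "multi_index d = {k. \<forall>i>d. k i = 0}"

text \<open>\<open>J\<^bsup>n\<^sub>0\<^esup> I\<^sub>1\<^bsup>n\<^sub>1\<^esup> \<dots> I\<^sub>d\<^bsup>n\<^sub>d\<^esup> M / J\<^bsup>n\<^sub>0+1\<^esup> I\<^sub>1\<^bsup>n\<^sub>1\<^esup> \<dots> I\<^sub>d\<^bsup>n\<^sub>d\<^esup> M\<close>, the component of degree \<open>n\<close> of the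
  multigraded module whose Hilbert polynomial defines the mixed multiplicities. It is annihilated
  by \<open>J\<close>, so its length over \<open>R/J\<close> is its length over \<open>R\<close>.\<close>

definition graded_component ::
  "('a, 'r) ring_scheme \<Rightarrow> nat \<Rightarrow> (nat \<Rightarrow> 'a set) \<Rightarrow> ('a, 'b, 'm) module_scheme \<Rightarrow>
   (nat \<Rightarrow> nat) \<Rightarrow> ('a, 'b set) module" where
  "graded_component R d I M n =
     quot_module (M\<lparr>carrier := ideal_smult M (multi_power R d I n) (carrier M)\<rparr>)
       (ideal_smult M (multi_power R d I (n(0 := Suc (n 0)))) (carrier M))"

definition hilbert_coeffs ::
  "('a, 'r) ring_scheme \<Rightarrow> nat \<Rightarrow> (nat \<Rightarrow> 'a set) \<Rightarrow> ('a, 'b, 'm) module_scheme \<Rightarrow>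
   (nat \<Rightarrow> nat) \<Rightarrow> int" where
  "hilbert_coeffs R d I M = (THE c.
     finite {k. c k \<noteq> 0} \<and> {k. c k \<noteq> 0} \<subseteq> multi_index d \<and>
     (\<exists>n\<^sub>0. \<forall>n \<in> multi_index d. (\<forall>i\<le>d. n\<^sub>0 \<le> n i) \<longrightarrow>
        (\<exists>l. module_length R (graded_component R d I M n) = enat l \<and>
             int l = (\<Sum>k | c k \<noteq> 0. c k * (\<Prod>i\<le>d. int ((n i + k i) choose (k i)))))))"

text \<open>For \<open>k = (k\<^sub>0, k\<^sub>1, \<dots>, k\<^sub>d)\<close>, the number \<^term>\<open>mixed_multiplicity R d I M k\<close> stands for
  \<open>e(J\<^bsup>[k\<^sub>0+1]\<^esup>, I\<^sub>1\<^bsup>[k\<^sub>1]\<^esup>, \<dots>, I\<^sub>d\<^bsup>[k\<^sub>d]\<^esup>; M)\<close>. It is meaningful only if it is defined in the sense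
  of the following predicate.\<close>

definition mixed_multiplicity_defined ::
  "('a, 'r) ring_scheme \<Rightarrow> nat \<Rightarrow> (nat \<Rightarrow> 'a set) \<Rightarrow> ('a, 'b, 'm) module_scheme \<Rightarrow>
   (nat \<Rightarrow> nat) \<Rightarrow> bool" where
  "mixed_multiplicity_defined R d I M k \<longleftrightarrow>
     (\<forall>h \<in> multi_index d. h \<noteq> k \<and> (\<forall>i\<le>d. k i \<le> h i) \<longrightarrow> hilbert_coeffs R d I M h = 0)"

definition mixed_multiplicity ::
  "('a, 'r) ring_scheme \<Rightarrow> nat \<Rightarrow> (nat \<Rightarrow> 'a set) \<Rightarrow> ('a, 'b, 'm) module_scheme \<Rightarrow>
   (nat \<Rightarrow> nat) \<Rightarrow> int" where
  "mixed_multiplicity R d I M k = hilbert_coeffs R d I M k"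


section \<open>Weak-(FC)-sequences\<close>

definition weak_FC_element ::
  "('a, 'r) ring_scheme \<Rightarrow> nat \<Rightarrow> (nat \<Rightarrow> 'a set) \<Rightarrow> ('a, 'b, 'm) module_scheme \<Rightarrow>
   nat \<Rightarrow> 'a \<Rightarrow> bool" where
  "weak_FC_element R d I M i a \<longleftrightarrow> i \<le> d \<and> a \<in> I i \<and>
     (\<exists>n\<^sub>0. \<forall>n \<in> multi_index d. (\<forall>j\<le>d. n\<^sub>0 \<le> n j) \<longrightarrow>
        (\<lambda>m. a \<odot>\<^bsub>M\<^esub> m) ` carrier M \<inter>
          ideal_smult M (ideal_prod R (multi_power R d I n) (I i)) (carrier M) =
        (\<lambda>m. a \<odot>\<^bsub>M\<^esub> m) ` ideal_smult M (multi_power R d I n) (carrier M)) \<and>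
     colon_elem M {\<zero>\<^bsub>M\<^esub>} a \<subseteq> colon_infinity R M {\<zero>\<^bsub>M\<^esub>} (ideals_product R d I)"

text \<open>The submodule \<open>(x\<^sub>1, \<dots>, x\<^sub>t) M\<close>.\<close>

definition seq_smult ::
  "('a, 'r) ring_scheme \<Rightarrow> ('a, 'b, 'm) module_scheme \<Rightarrow> 'a list \<Rightarrow> 'b set" where
  "seq_smult R M xs = ideal_smult M (Idl\<^bsub>R\<^esub> (set xs)) (carrier M)"

text \<open>An element may lie in several of the ideals; the list \<open>is\<close> records as an element of which
  ideal each \<open>x\<^sub>j\<close> is counted.\<close>

definition weak_FC_sequence_of_type ::
  "('a, 'r) ring_scheme \<Rightarrow> nat \<Rightarrow> (nat \<Rightarrow> 'a set) \<Rightarrow> ('a, 'b, 'm) module_scheme \<Rightarrow>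
   (nat \<Rightarrow> nat) \<Rightarrow> 'a list \<Rightarrow> bool" where
  "weak_FC_sequence_of_type R d I M k xs \<longleftrightarrow>
     (\<exists>is. length is = length xs \<and>
        (\<forall>j < length xs.
           weak_FC_element R d I (quot_module M (seq_smult R M (take j xs))) (is ! j) (xs ! j)) \<and>
        (\<forall>i\<le>d. count_list is i = k i))"

end

theory Submission
  imports Defs "HOL-Library.FuncSet" "HOL-Library.List_Lexorder"
begin

text \<open>
  Write \<open>I\<^sub>0 = J\<close>, \<open>\<I> = I\<^sub>0 \<cdots> I\<^sub>d\<close> and \<open>X\<^sub>N(n) = I\<^sub>0^n\<^sub>0 \<cdots> I\<^sub>d^n\<^sub>d N\<close>, and let \<open>\<epsilon>\<^sub>i\<close> be the \<open>i\<close>-th unit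
  vector. The mixed multiplicity is a coefficient of the polynomial \<open>P\<close> that gives the length of
  \<open>X\<^sub>N(n) / X\<^sub>N(n + \<epsilon>\<^sub>0)\<close> for large \<open>n\<close>. Its behaviour under two operations on the module is needed.

  Dividing by a weak-(FC)-element \<open>a \<in> I\<^sub>i\<close> replaces \<open>P(n)\<close> by \<open>P(n) - P(n - \<epsilon>\<^sub>i)\<close> (\<open>weak_FC_hilb\<close>):
  the condition on intersections says that \<open>aN\<close> meets \<open>X\<^sub>N(n)\<close> in \<open>a X\<^sub>N(n - \<epsilon>\<^sub>i)\<close>, and the
  condition on \<open>0 : a\<close> makes multiplication by \<open>a\<close> injective on \<open>X\<^sub>N(n)\<close> for large \<open>n\<close>. In the basis
  of products of binomial coefficients \<open>(n\<^sub>i + k\<^sub>i) choose k\<^sub>i\<close> this difference only shifts the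
  indices of the coefficients (\<open>binom_eval_shift_coeff\<close>). After a sequence of type \<open>k\<close> the
  multiplicity has therefore become the constant coefficient, and all other coefficients vanish
  because the multiplicity is defined. Dividing by \<open>0 : \<I>^\<infinity>\<close> does not change \<open>P\<close>
  (\<open>hilbert_coeffs_quot_torsion\<close>), since by the Artin-Rees lemma that submodule meets \<open>X\<^sub>N(n)\<close> in
  \<open>0\<close> for large \<open>n\<close>.

  What remains is a module \<open>Q\<close> without \<open>\<I>\<close>-torsion whose Hilbert function is eventually a constant
  \<open>e\<close>. If \<open>Q = 0\<close>, both sides vanish. If \<open>Q \<noteq> 0\<close>, fix large \<open>n\<^sub>1, \<dots>, n\<^sub>d\<close> and let
  \<open>B = I\<^sub>1^n\<^sub>1 \<cdots> I\<^sub>d^n\<^sub>d Q\<close>, so that the length of \<open>B / J^n B\<close> grows like \<open>e n\<close>. Nakayama's lemma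
  gives \<open>e \<noteq> 0\<close>. Linear growth excludes a chain of three primes above the annihilator
  (\<open>no_long_prime_chain\<close>), while absence of torsion provides a prime that is not maximal; so \<open>Q\<close>
  has dimension \<open>1\<close>. It follows that every prime above \<open>{r. r Q \<subseteq> B}\<close> is maximal, hence
  \<open>J^m Q \<subseteq> B\<close> for some \<open>m\<close>, and the length of \<open>Q / J^n Q\<close> stays within bounded distance of \<open>e n\<close>.
  Its leading coefficient is therefore \<open>e\<close>.

  Existence of the Hilbert polynomial and the Artin-Rees lemma both come from leading coefficients.
  For generators \<open>a\<^sub>1, \<dots>, a\<^sub>r\<close> of the ideals, order the monomials \<open>a^\<alpha>\<close> of a fixed multidegree
  lexicographically. The elements \<open>m\<close> for which \<open>a^\<alpha> m\<close> lies in a submodule \<open>L\<close> up to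
  smaller monomials form a submodule that grows with \<open>\<alpha>\<close>. Dickson's lemma turns this monotonicity
  into finiteness: the Hilbert function is a sum of an antitone function over exponent vectors,
  which is eventually polynomial (\<open>antitone_sum_is_mvpoly\<close>), and finitely many leading
  coefficient submodules determine all of them, which is the Artin-Rees lemma.
\<close>

section \<open>Eventually polynomial functions of one variable\<close>

text \<open>
  The value \<open>g (-1) = 0\<close> is built in, so that \<open>bdiff\<close> inverts summation exactly.
\<close>

definition bdiff :: "(nat \<Rightarrow> int) \<Rightarrow> nat \<Rightarrow> int" where
  "bdiff g n = g n - (if n = 0 then 0 else g (n - 1))"

text \<open>
  Eventually polynomial functions, described by iterated differences that end in a function with
  finite support. This form makes closure under shifts and partial sums immediate, and
  partial sums are what the count of monomials produces.
\<close>

inductive evpoly :: "(nat \<Rightarrow> int) \<Rightarrow> bool" where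
  eventually_zero: "(\<And>n. n \<ge> n\<^sub>0 \<Longrightarrow> g n = 0) \<Longrightarrow> evpoly g"
| antidifference: "evpoly (bdiff g) \<Longrightarrow> evpoly g"

lemma evpoly_shift:
  "evpoly g \<Longrightarrow> evpoly (\<lambda>n. if n = 0 then 0 else g (n - 1))"
proof (induction rule: evpoly.induct)
  case (eventually_zero n\<^sub>0 g)
  then show ?case
    by (intro evpoly.eventually_zero[of "Suc n\<^sub>0"]) auto
next
  case (antidifference g)
  have "bdiff (\<lambda>n. if n = 0 then 0 else g (n - 1)) =
    (\<lambda>n. if n = 0 then 0 else bdiff g (n - 1))"
    by (auto simp: bdiff_def fun_eq_iff)
  with antidifference.IH show ?case
    by (metis evpoly.antidifference)
qed

lemma evpoly_cumulative: 
  assumes "evpoly g"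
  shows "evpoly (\<lambda>n. \<Sum>m\<le>n. g m)"
proof -
  have "bdiff (\<lambda>n. \<Sum>m\<le>n. g m) = g"
  proof
    fix n show "bdiff (\<lambda>n. \<Sum>m\<le>n. g m) n = g n"
      by (cases n) (auto simp: bdiff_def)
  qed
  with assms show ?thesis
    by (metis evpoly.antidifference)
qed

lemma evpoly_bdiff: "evpoly g \<Longrightarrow> evpoly (bdiff g)"
proof (induction rule: evpoly.induct)
  case (eventually_zero n\<^sub>0 g)
  then show ?case
    by (intro evpoly.eventually_zero[of "Suc n\<^sub>0"]) (auto simp: bdiff_def)
qed (auto intro: evpoly.antidifference)

text \<open>
  Changing finitely many values changes the difference at finitely many places only.
\<close>

lemma evpoly_cong:
  "evpoly g \<Longrightarrow> (\<And>n. n \<ge> m \<Longrightarrow> f n = g n) \<Longrightarrow> evpoly f"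
proof (induction arbitrary: f m rule: evpoly.induct)
  case (eventually_zero n\<^sub>0 g)
  then show ?case
    by (intro evpoly.eventually_zero[of "max m n\<^sub>0"]) auto
next
  case (antidifference g)
  have eq: "bdiff f n = bdiff g n" if "n \<ge> Suc m" for n
    using antidifference.prems[of n] antidifference.prems[of "n - 1"] that
    by (auto simp: bdiff_def)
  show ?case
    by (rule evpoly.antidifference, rule antidifference.IH, rule eq)
qed

lemma evpoly_add:
  "evpoly f \<Longrightarrow> evpoly g \<Longrightarrow> evpoly (\<lambda>n. f n + g n)"
proof (induction arbitrary: g rule: evpoly.induct)
  case (eventually_zero n\<^sub>0 f)
  then show ?case
    by (elim evpoly_cong[of g n\<^sub>0]) auto
next
  case (antidifference f)
  have "bdiff (\<lambda>n. f n + g n) = (\<lambda>n. bdiff f n + bdiff g n)"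
    by (auto simp: bdiff_def fun_eq_iff)
  then show ?case
    using antidifference.IH[OF evpoly_bdiff[OF antidifference.prems]]
    by (metis evpoly.antidifference)
qed

lemma evpoly_linear: "evpoly (\<lambda>n. a * int n)"
proof -
  have "bdiff (bdiff (\<lambda>n. a * int n)) n = 0" if "n \<ge> 2" for n
    using that by (auto simp: bdiff_def algebra_simps of_nat_diff)
  then show ?thesis
    by (metis evpoly.intros)
qed

text \<open>
  By Pascal's rule, \<open>(n + k + 1) choose (k + 1)\<close> has the difference \<open>(n + k) choose k\<close>; an
  antidifference is thus obtained by raising all indices and adjusting the constant.
\<close>

lemma evpoly_binomial_expansion:
  "evpoly g \<Longrightarrow> \<exists>K c n\<^sub>0. \<forall>n\<ge>n\<^sub>0. g n = (\<Sum>k\<le>K. c k * int ((n + k) choose k))"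
proof (induction rule: evpoly.induct)
  case (eventually_zero n\<^sub>0 g)
  then show ?case
    by (intro exI[of _ 0] exI[of _ "\<lambda>_. 0"] exI[of _ n\<^sub>0]) auto
next
  case (antidifference g)
  then obtain K c n\<^sub>0 where *: "\<And>n. n \<ge> n\<^sub>0 \<Longrightarrow>
      bdiff g n = (\<Sum>k\<le>K. c k * int ((n + k) choose k))"
    by blast
  define A where "A n = (\<Sum>k\<le>K. c k * int ((n + Suc k) choose Suc k))" for n
  have A_Suc: "A (Suc n) = A n + (\<Sum>k\<le>K. c k * int ((Suc n + k) choose k))" for n
    unfolding A_def sum.distrib[symmetric]
    by (intro sum.cong) (auto simp: algebra_simps)
  have "g n = A n + (g n\<^sub>0 - A n\<^sub>0)" if "n \<ge> n\<^sub>0" for n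
    using that
  proof (induction n rule: dec_induct)
    case (step n)
    then show ?case
      using *[of "Suc n"] A_Suc[of n] by (simp add: bdiff_def)
  qed simp
  moreover define c' where "c' = case_nat (g n\<^sub>0 - A n\<^sub>0) c"
  have "(\<Sum>k\<le>Suc K. c' k * int ((n + k) choose k)) = A n + (g n\<^sub>0 - A n\<^sub>0)" for n
    unfolding sum.atMost_Suc_shift by (simp add: A_def c'_def)
  ultimately have "\<forall>n\<ge>n\<^sub>0. g n = (\<Sum>k\<le>Suc K. c' k * int ((n + k) choose k))"
    by metis
  then show ?case by blast
qed

text \<open>
  The difference of a bounded function is bounded, hence by induction a constant, and this
  constant must be \<open>0\<close>.
\<close>

lemma evpoly_bounded_imp_constant:
  "evpoly g \<Longrightarrow> (\<And>n. n \<ge> m \<Longrightarrow> \<bar>g n\<bar> \<le> B) \<Longrightarrow> \<exists>C n\<^sub>0. \<forall>n\<ge>n\<^sub>0. g n = C"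
proof (induction arbitrary: B m rule: evpoly.induct)
  case (eventually_zero n\<^sub>0 g)
  then show ?case by blast
next
  case (antidifference g)
  have "\<bar>bdiff g n\<bar> \<le> 2 * B" if "n \<ge> Suc m" for n
  proof -
    have "\<bar>g n\<bar> \<le> B" "\<bar>g (n - 1)\<bar> \<le> B"
      using that by (auto intro!: antidifference.prems)
    then show ?thesis
      using that by (auto simp: bdiff_def)
  qed
  then obtain D n\<^sub>1 where D: "\<And>n. n \<ge> n\<^sub>1 \<Longrightarrow> bdiff g n = D"
    using antidifference.IH by blast
  define n\<^sub>0 where "n\<^sub>0 = max m n\<^sub>1"
  have g: "g (n\<^sub>0 + j) = g n\<^sub>0 + D * int j" for j
  proof (induction j)
    case (Suc j)
    then show ?case
      using D[of "n\<^sub>0 + Suc j"] by (simp add: n\<^sub>0_def bdiff_def algebra_simps)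
  qed simp
  have "D = 0"
  proof (rule ccontr)
    assume "D \<noteq> 0"
    let ?j = "nat (2 * B + 1)"
    have B: "\<bar>g n\<^sub>0\<bar> \<le> B" "\<bar>g (n\<^sub>0 + ?j)\<bar> \<le> B"
      by (rule antidifference.prems; simp add: n\<^sub>0_def)+
    then have "\<bar>D * int ?j\<bar> \<le> 2 * B"
      using g[of ?j] by linarith
    moreover have "1 * int ?j \<le> \<bar>D\<bar> * int ?j"
      using \<open>D \<noteq> 0\<close> by (intro mult_right_mono) auto
    ultimately have "int ?j \<le> 2 * B"
      by (simp only: abs_mult)
    moreover have "B \<ge> 0"
      using B(1) by simp
    ultimately show False
      by simp
  qed
  then have "\<forall>n\<ge>n\<^sub>0. g n = g n\<^sub>0"
    using g by (metis le_iff_add mult_zero_left add.right_neutral)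
  then show ?case by blast
qed


section \<open>Dickson's lemma\<close>

lemma nat_seq_mono_subseq:
  fixes s :: "nat \<Rightarrow> nat"
  obtains g :: "nat \<Rightarrow> nat" where "strict_mono g" "\<And>i j. i \<le> j \<Longrightarrow> s (g i) \<le> s (g j)"
proof -
  obtain g :: "nat \<Rightarrow> nat" where g: "strict_mono g" "monoseq (\<lambda>n. s (g n))"
    using seq_monosub by blast
  show thesis
  proof (cases "\<forall>m. \<forall>n\<ge>m. s (g m) \<le> s (g n)")
    case True
    show ?thesis
      by (rule that[OF g(1)]) (use True in blast)
  next
    case False
    with g(2) have dec: "\<And>m n. n \<ge> m \<Longrightarrow> s (g n) \<le> s (g m)"
      unfolding monoseq_def by blast
    define v where "v = (LEAST v. \<exists>n. s (g n) = v)"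
    obtain N where N: "s (g N) = v"
      using LeastI_ex[of "\<lambda>v. \<exists>n. s (g n) = v"] v_def by auto
    have "v \<le> s (g n)" for n
      unfolding v_def by (rule Least_le) blast
    then have const: "s (g (n + N)) = v" for n
      using dec[of N "n + N"] N by (metis le_add2 le_antisym)
    have "strict_mono (\<lambda>n. g (n + N))"
      using g(1) by (auto simp: strict_mono_def)
    then show ?thesis
      by (rule that) (simp add: const)
  qed
qed

text \<open>
  Coordinates are treated one after the other, each time passing to a subsequence.
\<close>

lemma dickson:
  assumes "\<And>i::nat. length (\<alpha> i) = r"
  shows "\<exists>g::nat \<Rightarrow> nat. strict_mono g \<and>
    (\<forall>i j. i \<le> j \<longrightarrow> list_all2 (\<le>) (\<alpha> (g i)) (\<alpha> (g j) :: nat list))"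
  using assms
proof (induction r arbitrary: \<alpha>)
  case 0
  then show ?case
    by (intro exI[of _ id]) (auto simp: strict_mono_def)
next
  case (Suc r)
  obtain h :: "nat \<Rightarrow> nat" where h: "strict_mono h" "\<And>i j. i \<le> j \<Longrightarrow> hd (\<alpha> (h i)) \<le> hd (\<alpha> (h j))"
    using nat_seq_mono_subseq[of "\<lambda>i. hd (\<alpha> i)"] by blast
  obtain g :: "nat \<Rightarrow> nat" where g: "strict_mono g"
      "\<And>i j. i \<le> j \<Longrightarrow> list_all2 (\<le>) (tl (\<alpha> (h (g i)))) (tl (\<alpha> (h (g j))))"
    using Suc.IH[of "\<lambda>i. tl (\<alpha> (h i))"] Suc.prems by auto
  have cons: "\<alpha> i = hd (\<alpha> i) # tl (\<alpha> i)" for i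
    using Suc.prems[of i] by (cases "\<alpha> i") auto
  have "list_all2 (\<le>) (\<alpha> (h (g i))) (\<alpha> (h (g j)))" if "i \<le> j" for i j
  proof -
    have "g i \<le> g j" using g(1) that by (simp add: strict_mono_less_eq)
    then show ?thesis
      using h(2)[of "g i" "g j"] g(2)[OF that]
      by (subst cons, subst (2) cons) (simp only: list_all2_Cons)
  qed
  moreover have "strict_mono (\<lambda>i. h (g i))"
    using h(1) g(1) by (auto simp: strict_mono_def)
  ultimately show ?case by blast
qed

text \<open>
  Otherwise \<open>f\<close> drops at infinitely many places \<open>m # \<beta>\<close>. By Dickson's lemma these places can be
  chosen increasing in the product order, and then the values of \<open>f\<close> descend for ever.
\<close>

lemma antitone_eventually_constant_in_first_variable:
  fixes f :: "nat list \<Rightarrow> nat"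
  assumes anti: "\<And>\<alpha> \<beta>. length \<beta> = Suc r \<Longrightarrow> list_all2 (\<le>) \<alpha> \<beta> \<Longrightarrow> f \<beta> \<le> f \<alpha>"
  shows "\<exists>m\<^sub>0. \<forall>m\<ge>m\<^sub>0. \<forall>\<beta>. length \<beta> = r \<longrightarrow> f (m # \<beta>) = f (m\<^sub>0 # \<beta>)"
proof (rule ccontr)
  have refl: "list_all2 (\<le>) \<beta> \<beta>" for \<beta> :: "nat list"
    by (simp add: list_all2_refl)
  assume contra: "\<not> ?thesis"
  have "\<exists>m\<ge>N. \<exists>\<beta>. length \<beta> = r \<and> f (Suc m # \<beta>) < f (m # \<beta>)" for N
  proof (rule ccontr)
    assume no: "\<not> ?thesis"
    have "f (m # \<beta>) = f (N # \<beta>)" if "m \<ge> N" "length \<beta> = r" for m \<beta>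
      using that(1)
    proof (induction m rule: dec_induct)
      case (step m)
      have "f (Suc m # \<beta>) \<le> f (m # \<beta>)"
        using that(2) refl by (intro anti) auto
      moreover have "\<not> f (Suc m # \<beta>) < f (m # \<beta>)"
        using no step.hyps that(2) by auto
      ultimately show ?case using step.IH by simp
    qed simp
    then show False using contra by blast
  qed
  then obtain m \<beta> where m: "\<And>N. m N \<ge> N" and \<beta>: "\<And>N. length (\<beta> N) = r"
    and desc: "\<And>N. f (Suc (m N) # \<beta> N) < f (m N # \<beta> N)"
    by metis
  \<comment> \<open>The drops at \<open>m (N i)\<close> lie at increasing first coordinates, each beyond the previous one.\<close>
  define N where "N = rec_nat 0 (\<lambda>_ x. Suc (m x))"
  have N_Suc: "N (Suc i) = Suc (m (N i))" for i
    by (simp add: N_def)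
  have "Suc (m (N i)) \<le> N j" if "i < j" for i j
    using that
  proof (induction j)
    case (Suc j)
    then show ?case using m[of "N j"] N_Suc[of j] by (cases "i = j") auto
  qed simp
  then have gap: "Suc (m (N i)) \<le> m (N j)" if "i < j" for i j
    using that m order_trans by blast
  obtain g :: "nat \<Rightarrow> nat" where g: "strict_mono g"
      "\<And>i j. i \<le> j \<Longrightarrow> list_all2 (\<le>) (\<beta> (N (g i))) (\<beta> (N (g j)))"
    using dickson[of "\<lambda>i. \<beta> (N i)" r] \<beta> by blast
  have "f (m (N (g (Suc i))) # \<beta> (N (g (Suc i)))) < f (m (N (g i)) # \<beta> (N (g i)))" for i
  proof -
    have "f (m (N (g (Suc i))) # \<beta> (N (g (Suc i)))) \<le> f (Suc (m (N (g i))) # \<beta> (N (g i)))"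
      using g(2)[of i "Suc i"] gap[of "g i" "g (Suc i)"] g(1) \<beta>
      by (intro anti) (auto simp: strict_mono_def)
    with desc show ?thesis using le_less_trans by blast
  qed
  then show False
    using wf_no_infinite_down_chainE[OF wf_less, of "\<lambda>i. f (m (N (g i)) # \<beta> (N (g i)))"] by blast
qed


section \<open>Eventually polynomial functions of several variables\<close>

text \<open>
  The span of products of functions of one variable. Eventual agreement with a polynomial in
  several variables would not be enough here: partial sums along one coordinate also see small
  values of that coordinate, and the product form controls them.
\<close>

inductive mvpoly :: "nat \<Rightarrow> ((nat \<Rightarrow> nat) \<Rightarrow> int) \<Rightarrow> bool" for d where
  prod: "(\<And>i. i \<le> d \<Longrightarrow> evpoly (g i)) \<Longrightarrow> mvpoly d (\<lambda>n. \<Prod>i\<le>d. g i (n i))"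
| add: "mvpoly d F \<Longrightarrow> mvpoly d G \<Longrightarrow> mvpoly d (\<lambda>n. F n + G n)"

lemma prod_fun_upd:
  fixes g :: "nat \<Rightarrow> nat \<Rightarrow> int"
  assumes "c \<le> d"
  shows "(\<Prod>i\<le>d. g i ((n(c := m)) i)) = g c m * (\<Prod>i\<in>{..d}-{c}. g i (n i))"
  using assms by (subst prod.remove[of _ c]) (auto intro!: prod.cong)

lemma prod_fun_upd':
  fixes g :: "nat \<Rightarrow> nat \<Rightarrow> int"
  assumes "c \<le> d"
  shows "(\<Prod>i\<le>d. (g(c := h)) i (n i)) = h (n c) * (\<Prod>i\<in>{..d}-{c}. g i (n i))"
  using assms by (subst prod.remove[of _ c]) (auto intro!: prod.cong)

lemma mvpoly_shift:
  assumes "mvpoly d F" and c: "c \<le> d"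
  shows "mvpoly d (\<lambda>n. if n c = 0 then 0 else F (n(c := n c - 1)))"
  using assms(1)
proof induction
  case (prod g)
  have "(\<lambda>n. if n c = 0 then 0 else \<Prod>i\<le>d. g i ((n(c := n c - 1)) i)) =
    (\<lambda>n. \<Prod>i\<le>d. (g(c := (\<lambda>m. if m = 0 then 0 else g c (m - 1)))) i (n i))"
    using c by (auto simp: fun_eq_iff prod_fun_upd prod_fun_upd' simp del: fun_upd_apply)
  moreover have "mvpoly d \<dots>"
    using prod c by (intro mvpoly.prod) (auto intro: evpoly_shift)
  ultimately show ?case by (simp only:)
next
  case (add F G)
  have "(\<lambda>n. if n c = 0 then 0 else F (n(c := n c - 1)) + G (n(c := n c - 1))) =
     (\<lambda>n. (if n c = 0 then 0 else F (n(c := n c - 1))) + (if n c = 0 then 0 else G (n(c := n c - 1))))"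
    by auto
  then show ?case using mvpoly.add[OF add.IH] by (simp only:)
qed

lemma mvpoly_cumulative:
  assumes "mvpoly d F" and c: "c \<le> d"
  shows "mvpoly d (\<lambda>n. \<Sum>m\<le>n c. F (n(c := m)))"
  using assms(1)
proof induction
  case (prod g)
  have "(\<lambda>n. \<Sum>m\<le>n c. \<Prod>i\<le>d. g i ((n(c := m)) i)) =
    (\<lambda>n. \<Prod>i\<le>d. (g(c := (\<lambda>k. \<Sum>m\<le>k. g c m))) i (n i))"
    using c
    by (auto simp: fun_eq_iff prod_fun_upd prod_fun_upd' sum_distrib_right simp del: fun_upd_apply)
  moreover have "mvpoly d \<dots>"
    using prod c by (intro mvpoly.prod) (auto intro: evpoly_cumulative)
  ultimately show ?case by (simp only:)
next
  case (add F G)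
  then show ?case using mvpoly.add[OF add.IH] by (simp add: sum.distrib)
qed

text \<open>
  If all \<open>G m\<close> agree, this is a partial sum along the coordinate \<open>c\<close>. In general one splits
  off \<open>G 0\<close> and shifts the rest.
\<close>

lemma mvpoly_convolution:
  assumes "\<And>m. mvpoly d (G m)" and "c \<le> d" and "\<And>m. m \<ge> m\<^sub>0 \<Longrightarrow> G m = G m\<^sub>0"
  shows "mvpoly d (\<lambda>n. \<Sum>m\<le>n c. G m (n(c := n c - m)))"
  using assms(1,3)
proof (induction m\<^sub>0 arbitrary: G)
  case 0
  then have const: "G m k = G 0 k" for m k by (metis le0)
  then have "(\<lambda>n. \<Sum>m\<le>n c. G m (n(c := n c - m))) = (\<lambda>n. \<Sum>m\<le>n c. G 0 (n(c := m)))"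
    by (intro ext, subst sum.atLeastAtMost_rev[of _ 0, simplified atMost_atLeast0[symmetric]])
      (rule sum.cong[OF refl], rule trans[OF const], simp)
  then show ?case
    using mvpoly_cumulative[OF 0(1)[of 0] \<open>c \<le> d\<close>] by (simp only:)
next
  case (Suc m\<^sub>0)
  let ?T = "\<lambda>n. \<Sum>m\<le>n c. G (Suc m) (n(c := n c - m))"
  have "mvpoly d ?T"
    by (rule Suc.IH) (rule Suc.prems(1), rule Suc.prems(2), simp)
  then have "mvpoly d (\<lambda>n. G 0 n + (if n c = 0 then 0 else ?T (n(c := n c - 1))))"
    by (intro mvpoly.add mvpoly_shift Suc.prems(1) \<open>c \<le> d\<close>)
  moreover have "(\<Sum>m\<le>n c. G m (n(c := n c - m))) = 
     G 0 n + (if n c = 0 then 0 else ?T (n(c := n c - 1)))" for n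
    by (cases "n c") (auto simp: sum.atMost_Suc_shift simp del: sum.atMost_Suc 
        intro!: sum.cong arg_cong2[of _ _ _ _ "\<lambda>x y. x + y"] arg_cong[of _ _ "G _"])
  ultimately show ?case by (simp only:)
qed


section \<open>Exponent vectors of a given multidegree\<close>

text \<open>
  The multidegree of an exponent vector when the \<open>j\<close>-th variable has the colour \<open>cs ! j\<close>, that
  is, when it stands for a generator of the ideal with that number.
\<close>

fun cdeg :: "nat list \<Rightarrow> nat list \<Rightarrow> nat \<Rightarrow> nat" where
  "cdeg (c # cs) (m # \<alpha>) = (cdeg cs \<alpha>)(c := m + cdeg cs \<alpha> c)"
| "cdeg _ _ = (\<lambda>_. 0)"

definition exps :: "nat list \<Rightarrow> (nat \<Rightarrow> nat) \<Rightarrow> nat list set" where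
  "exps cs n = {\<alpha>. length \<alpha> = length cs \<and> cdeg cs \<alpha> = n}"

lemma exps_Nil: "exps [] n = (if n = (\<lambda>_. 0) then {[]} else {})"
  by (auto simp: exps_def)

lemma exps_Cons:
  "exps (c # cs) n = (\<Union>m\<le>n c. (#) m ` exps cs (n(c := n c - m)))" (is "_ = ?R")
proof (intro equalityI subsetI)
  fix \<alpha> assume "\<alpha> \<in> exps (c # cs) n"
  then obtain m \<beta> where \<alpha>: "\<alpha> = m # \<beta>" "length \<beta> = length cs"
      "(cdeg cs \<beta>)(c := m + cdeg cs \<beta> c) = n"
    by (cases \<alpha>) (auto simp: exps_def)
  have "n c = m + cdeg cs \<beta> c" using \<alpha>(3) by auto
  moreover have "cdeg cs \<beta> = n(c := n c - m)"
    using \<alpha>(3)[symmetric] by (auto simp: fun_eq_iff)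
  ultimately show "\<alpha> \<in> ?R" using \<alpha> by (auto simp: exps_def)
qed (auto simp: exps_def fun_eq_iff)

lemma finite_exps [simp, intro]: "finite (exps cs n)"
  by (induction cs arbitrary: n) (auto simp: exps_Nil exps_Cons)

lemma sum_exps_Cons:
  "(\<Sum>\<alpha>\<in>exps (c # cs) n. f \<alpha>) = (\<Sum>m\<le>n c. \<Sum>\<beta>\<in>exps cs (n(c := n c - m)). f (m # \<beta>))"
proof -
  have "(\<Sum>\<alpha>\<in>exps (c # cs) n. f \<alpha>) = (\<Sum>m\<le>n c. \<Sum>\<alpha>\<in>(#) m ` exps cs (n(c := n c - m)). f \<alpha>)"
    unfolding exps_Cons by (subst sum.UNION_disjoint) auto
  also have "\<dots> = (\<Sum>m\<le>n c. \<Sum>\<beta>\<in>exps cs (n(c := n c - m)). f (m # \<beta>))"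
    by (rule sum.cong[OF refl], subst sum.reindex) (auto simp: inj_on_def)
  finally show ?thesis .
qed

lemma multi_index_upd: "n \<in> multi_index d \<Longrightarrow> c \<le> d \<Longrightarrow> n(c := m) \<in> multi_index d"
  by (auto simp: multi_index_def)

text \<open>
  Induction on the number of variables. Splitting off the exponent \<open>m\<close> of the first variable
  expresses the sum as a convolution of sums in fewer variables, and these depend on \<open>m\<close> only
  through \<open>min m m\<^sub>0\<close>.
\<close>

theorem antitone_sum_is_mvpoly:
  fixes f :: "nat list \<Rightarrow> nat"
  assumes "set cs \<subseteq> {..d}"
    and "\<And>\<alpha> \<beta>. length \<beta> = length cs \<Longrightarrow> list_all2 (\<le>) \<alpha> \<beta> \<Longrightarrow> f \<beta> \<le> f \<alpha>"
  shows "\<exists>F. mvpoly d F \<and> (\<forall>n\<in>multi_index d. int (\<Sum>\<alpha>\<in>exps cs n. f \<alpha>) = F n)"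
  using assms
proof (induction cs arbitrary: f)
  case Nil
  have "mvpoly d (\<lambda>n. \<Prod>i\<le>d. (\<lambda>i m. if i = 0 \<and> m = 0 then int (f []) else if m = 0 then 1 else 0) i (n i))"
    by (intro mvpoly.prod evpoly.eventually_zero[of 1]) simp
  moreover have "int (\<Sum>\<alpha>\<in>exps [] n. f \<alpha>) = 
     (\<Prod>i\<le>d. (if i = 0 \<and> n i = 0 then int (f []) else if n i = 0 then 1 else 0))"
    if "n \<in> multi_index d" for n
  proof (cases "n = (\<lambda>_. 0)")
    case True
    show ?thesis unfolding True by (simp add: exps_Nil prod.delta)
  next
    case False
    then obtain i where i: "n i \<noteq> 0" by (auto simp: fun_eq_iff)
    with that have "i \<le> d" by (auto simp: multi_index_def not_less[symmetric])
    with i have "(\<Prod>i\<le>d. (if i = 0 \<and> n i = 0 then int (f []) else if n i = 0 then 1 else 0)) = 0"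
      by (intro prod_zero bexI[of _ i]) simp_all
    then show ?thesis using False by (simp add: exps_Nil)
  qed
  ultimately show ?case by blast
next
  case (Cons c cs)
  then have c: "c \<le> d" by simp
  have "\<exists>F. mvpoly d F \<and> (\<forall>n\<in>multi_index d. int (\<Sum>\<alpha>\<in>exps cs n. f (m # \<alpha>)) = F n)" for m
    using Cons.prems by (intro Cons.IH) (auto intro!: Cons.prems)
  then obtain F where F: "\<And>m. mvpoly d (F m)"
      "\<And>m n. n \<in> multi_index d \<Longrightarrow> int (\<Sum>\<alpha>\<in>exps cs n. f (m # \<alpha>)) = F m n"
    by metis
  have "\<exists>m\<^sub>0. \<forall>m\<ge>m\<^sub>0. \<forall>\<beta>. length \<beta> = length cs \<longrightarrow> f (m # \<beta>) = f (m\<^sub>0 # \<beta>)"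
    by (rule antitone_eventually_constant_in_first_variable) (rule Cons.prems(2), simp_all)
  then obtain m\<^sub>0 where
      "\<forall>m\<ge>m\<^sub>0. \<forall>\<beta>. length \<beta> = length cs \<longrightarrow> f (m # \<beta>) = f (m\<^sub>0 # \<beta>)"
    by (elim exE)
  then have m\<^sub>0: "f (m # \<beta>) = f (m\<^sub>0 # \<beta>)" if "m \<ge> m\<^sub>0" "length \<beta> = length cs" for m \<beta>
    using that by blast
  have stable: "int (\<Sum>\<alpha>\<in>exps cs n. f (m # \<alpha>)) = F (min m m\<^sub>0) n" if "n \<in> multi_index d" for m n
  proof (cases "m \<ge> m\<^sub>0")
    case True
    then have "(\<Sum>\<alpha>\<in>exps cs n. f (m # \<alpha>)) = (\<Sum>\<alpha>\<in>exps cs n. f (m\<^sub>0 # \<alpha>))"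
      by (intro sum.cong refl m\<^sub>0) (auto simp: exps_def)
    then show ?thesis using F(2)[OF that, of m\<^sub>0] True by (simp add: min_absorb2)
  qed (use F(2)[OF that, of m] in \<open>simp add: min_absorb1\<close>)
  have "mvpoly d (\<lambda>n. \<Sum>m\<le>n c. F (min m m\<^sub>0) (n(c := n c - m)))"
    by (rule mvpoly_convolution[where m\<^sub>0 = m\<^sub>0]) (auto simp: F c min_absorb2)
  moreover have "int (\<Sum>\<alpha>\<in>exps (c # cs) n. f \<alpha>) = (\<Sum>m\<le>n c. F (min m m\<^sub>0) (n(c := n c - m)))"
    if "n \<in> multi_index d" for n
    unfolding sum_exps_Cons of_nat_sum[of _ "{..n c}"]
    by (intro sum.cong refl stable multi_index_upd that c)
  ultimately show ?case by blast
qed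


section \<open>The binomial basis\<close>

definition binom_eval :: "nat \<Rightarrow> ((nat \<Rightarrow> nat) \<Rightarrow> int) \<Rightarrow> (nat \<Rightarrow> nat) \<Rightarrow> int" where
  "binom_eval d c n = (\<Sum>k | c k \<noteq> 0. c k * (\<Prod>i\<le>d. int ((n i + k i) choose (k i))))"

definition coeff_fun :: "nat \<Rightarrow> ((nat \<Rightarrow> nat) \<Rightarrow> int) \<Rightarrow> bool" where
  "coeff_fun d c \<longleftrightarrow> finite {k. c k \<noteq> 0} \<and> {k. c k \<noteq> 0} \<subseteq> multi_index d"

lemma binom_eval_superset:
  assumes "finite S" "{k. c k \<noteq> 0} \<subseteq> S"
  shows "binom_eval d c n = (\<Sum>k\<in>S. c k * (\<Prod>i\<le>d. int ((n i + k i) choose (k i))))"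
  unfolding binom_eval_def using assms by (intro sum.mono_neutral_left) auto

lemma binom_eval_linear:
  assumes "coeff_fun d b" "coeff_fun d c"
  shows "coeff_fun d (\<lambda>k. b k + a * c k)"
    and "binom_eval d (\<lambda>k. b k + a * c k) n = binom_eval d b n + a * binom_eval d c n"
proof -
  let ?S = "{k. b k \<noteq> 0} \<union> {k. c k \<noteq> 0}"
  have S: "finite ?S" "?S \<subseteq> multi_index d"
    using assms by (auto simp: coeff_fun_def)
  have sub: "{k. b k + a * c k \<noteq> 0} \<subseteq> ?S" by auto
  show "coeff_fun d (\<lambda>k. b k + a * c k)"
    unfolding coeff_fun_def using sub S by (meson finite_subset order_trans)
  have "binom_eval d b n = (\<Sum>k\<in>?S. b k * (\<Prod>i\<le>d. int ((n i + k i) choose (k i))))"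
    "binom_eval d c n = (\<Sum>k\<in>?S. c k * (\<Prod>i\<le>d. int ((n i + k i) choose (k i))))"
    using S(1) by (intro binom_eval_superset; blast)+
  then show "binom_eval d (\<lambda>k. b k + a * c k) n = binom_eval d b n + a * binom_eval d c n"
    unfolding binom_eval_superset[OF S(1) sub]
    by (simp add: algebra_simps sum.distrib sum_distrib_left)
qed

lemma mvpoly_imp_binom_eval:
  "mvpoly d F \<Longrightarrow> \<exists>c. coeff_fun d c \<and> (\<exists>n\<^sub>0. \<forall>n. (\<forall>i\<le>d. n\<^sub>0 \<le> n i) \<longrightarrow> F n = binom_eval d c n)"
proof (induction rule: mvpoly.induct)
  case (prod g)
  have "\<exists>K c n\<^sub>0. i \<le> d \<longrightarrow> (\<forall>n\<ge>n\<^sub>0. g i n = (\<Sum>k\<le>K. c k * int ((n + k) choose k)))" for i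
    using evpoly_binomial_expansion[OF prod, of i] by (cases "i \<le> d") auto
  then obtain K a n\<^sub>0 where g: "\<And>i n. i \<le> d \<Longrightarrow> n \<ge> n\<^sub>0 i \<Longrightarrow>
      g i n = (\<Sum>k\<le>K i. a i k * int ((n + k) choose k))"
    by metis
  define S where "S = {k \<in> multi_index d. \<forall>i\<le>d. k i \<le> K i}"
  define c where "c k = (if k \<in> S then \<Prod>i\<le>d. a i (k i) else 0)" for k
  let ?P = "Pi\<^sub>E {..d} (\<lambda>i. {..K i})"
  have bij: "bij_betw (\<lambda>k. restrict k {..d}) S ?P"
    by (rule bij_betw_byWitness[where f' = "\<lambda>k i. if i \<le> d then k i else 0"])
      (auto simp: S_def multi_index_def restrict_def PiE_iff extensional_def fun_eq_iff split: if_splits)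
  then have "finite S"
    using bij_betw_finite[OF bij] by (simp add: finite_PiE)
  have "coeff_fun d c"
    unfolding coeff_fun_def
    using \<open>finite S\<close> by (auto simp: c_def S_def intro: finite_subset[of _ S])
  moreover have "(\<Prod>i\<le>d. g i (n i)) = binom_eval d c n" if n: "\<forall>i\<le>d. (\<Sum>i\<le>d. n\<^sub>0 i) \<le> n i" for n
  proof -
    have "n\<^sub>0 i \<le> n i" if "i \<le> d" for i
      using n that member_le_sum[of i "{..d}" n\<^sub>0] by (meson atMost_iff finite_atMost le_trans zero_le)
    then have "(\<Prod>i\<le>d. g i (n i)) = (\<Prod>i\<le>d. \<Sum>k\<le>K i. a i k * int ((n i + k) choose k))"
      by (intro prod.cong) (auto simp: g)
    also have "\<dots> = (\<Sum>k\<in>?P. \<Prod>i\<le>d. a i (k i) * int ((n i + k i) choose (k i)))"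
      by (rule prod_sum_PiE) auto
    also have "\<dots> = (\<Sum>k\<in>S. \<Prod>i\<le>d. a i (k i) * int ((n i + k i) choose (k i)))"
      by (subst sum.reindex_bij_betw[OF bij, symmetric]) (auto intro!: sum.cong prod.cong)
    also have "\<dots> = (\<Sum>k\<in>S. c k * (\<Prod>i\<le>d. int ((n i + k i) choose (k i))))"
      by (intro sum.cong) (auto simp: c_def prod.distrib)
    also have "\<dots> = binom_eval d c n"
      using \<open>finite S\<close> by (intro binom_eval_superset[symmetric]) (auto simp: c_def)
    finally show ?thesis .
  qed
  ultimately show ?case by blast
next
  case (add F G)
  then obtain b c m\<^sub>0 n\<^sub>0 where *: "coeff_fun d b" "coeff_fun d c"
      "\<And>n. (\<forall>i\<le>d. m\<^sub>0 \<le> n i) \<Longrightarrow> F n = binom_eval d b n"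
      "\<And>n. (\<forall>i\<le>d. n\<^sub>0 \<le> n i) \<Longrightarrow> G n = binom_eval d c n"
    by metis
  have "\<forall>n. (\<forall>i\<le>d. max m\<^sub>0 n\<^sub>0 \<le> n i) \<longrightarrow> F n + G n = binom_eval d (\<lambda>k. b k + 1 * c k) n"
    using * by (simp add: binom_eval_linear[of d b c 1, simplified])
  with binom_eval_linear(1)[OF *(1,2), of 1] show ?case by blast
qed

text \<open>
  The effect on coefficients of the difference in direction \<open>i\<close>.
\<close>

definition shift_coeff :: "nat \<Rightarrow> ((nat \<Rightarrow> nat) \<Rightarrow> int) \<Rightarrow> (nat \<Rightarrow> nat) \<Rightarrow> int" where
  "shift_coeff i c h = c (h(i := Suc (h i)))"

lemma inj_shift: "inj (\<lambda>h::nat \<Rightarrow> nat. h(i := Suc (h i)))"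
  by (rule injI) (metis fun_upd_same fun_upd_triv fun_upd_upd old.nat.inject)

lemma coeff_fun_shift_coeff:
  assumes "coeff_fun d c" "i \<le> d"
  shows "coeff_fun d (shift_coeff i c)"
proof -
  let ?f = "\<lambda>h::nat \<Rightarrow> nat. h(i := Suc (h i))"
  have "{h. shift_coeff i c h \<noteq> 0} = ?f -` {k. c k \<noteq> 0}"
    by (auto simp: shift_coeff_def)
  moreover have "finite (?f -` {k. c k \<noteq> 0})"
    using assms(1) inj_shift by (intro finite_vimageI) (auto simp: coeff_fun_def)
  moreover have "h \<in> multi_index d" if "shift_coeff i c h \<noteq> 0" for h
  proof -
    have "?f h \<in> multi_index d"
      using assms(1) that by (auto simp: shift_coeff_def coeff_fun_def)
    with \<open>i \<le> d\<close> show ?thesis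
      by (auto simp: multi_index_def split: if_splits)
  qed
  ultimately show ?thesis
    by (auto simp: coeff_fun_def)
qed

text \<open>
  Only the factor for \<open>i\<close> changes, and Pascal's rule lowers its index by one; terms with
  \<open>k i = 0\<close> cancel.
\<close>

lemma binom_eval_shift_coeff:
  assumes c: "coeff_fun d c" and i: "i \<le> d" "n i > 0"
  shows "binom_eval d (shift_coeff i c) n = binom_eval d c n - binom_eval d c (n(i := n i - 1))"
proof -
  let ?f = "\<lambda>h::nat \<Rightarrow> nat. h(i := Suc (h i))"
  let ?b = "\<lambda>n k::nat \<Rightarrow> nat. \<Prod>j\<le>d. int ((n j + k j) choose (k j))"
  let ?S = "{k. c k \<noteq> 0}"
  let ?n' = "n(i := n i - 1)"
  have fin: "finite ?S" using c by (simp add: coeff_fun_def)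
  have fact: "?b m k = int ((m i + k i) choose (k i)) *
      (\<Prod>j\<in>{..d}-{i}. int ((m j + k j) choose (k j)))" for m k
    using i by (intro prod.remove) auto
  have rest: "(\<Prod>j\<in>{..d}-{i}. int ((?n' j + k j) choose (k j))) =
      (\<Prod>j\<in>{..d}-{i}. int ((n j + k j) choose (k j)))"
    "(\<Prod>j\<in>{..d}-{i}. int ((n j + ?f k j) choose (?f k j))) =
      (\<Prod>j\<in>{..d}-{i}. int ((n j + k j) choose (k j)))" for k
    by (intro prod.cong; auto)+
  obtain m where m: "n i = Suc m" using i(2) by (cases "n i") auto
  have zero: "?b n k - ?b ?n' k = 0" if "k i = 0" for k
    unfolding fact rest using that by simp
  have suc: "?b n (?f k) - ?b ?n' (?f k) = ?b n k" for k
    unfolding fact[of _ "?f k"] fact[of n k] rest(1) unfolding rest(2)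
    by (simp add: m algebra_simps)
  have "binom_eval d c n - binom_eval d c ?n' = (\<Sum>k\<in>?S. c k * (?b n k - ?b ?n' k))"
    by (simp add: binom_eval_def sum_subtractf right_diff_distrib)
  also have "\<dots> = (\<Sum>k\<in>?f ` {h. shift_coeff i c h \<noteq> 0}. c k * (?b n k - ?b ?n' k))"
  proof (rule sum.mono_neutral_right[OF fin], safe)
    fix k assume k: "c k \<noteq> 0" "k \<notin> ?f ` {h. shift_coeff i c h \<noteq> 0}"
    have "k i = 0"
    proof (rule ccontr)
      assume "k i \<noteq> 0"
      then have "k = ?f (k(i := k i - 1))" by (auto simp: fun_eq_iff)
      with k show False by (metis (mono_tags, lifting) image_eqI mem_Collect_eq shift_coeff_def)
    qed
    then show "c k * (?b n k - ?b ?n' k) = 0" using zero[of k] by simp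
  qed (auto simp: shift_coeff_def)
  also have "\<dots> = (\<Sum>h | shift_coeff i c h \<noteq> 0. shift_coeff i c h * ?b n h)"
    by (subst sum.reindex[OF inj_on_subset[OF inj_shift subset_UNIV]])
      (rule sum.cong[OF refl], simp only: o_def suc shift_coeff_def)
  finally show ?thesis by (simp add: binom_eval_def)
qed

lemma binom_eval_constant_zero:
  assumes "{k. c k \<noteq> 0} \<subseteq> {\<lambda>_. 0}" and "binom_eval d c n = 0"
  shows "c = (\<lambda>_. 0)"
proof -
  have "c (\<lambda>_. 0) = 0"
    using assms by (simp add: binom_eval_superset[of "{\<lambda>_. 0}"])
  with assms(1) show ?thesis by blast
qed

text \<open>
  Induction on the total degree: all differences vanish by induction, hence only the constant
  coefficient can be nonzero, and it is a value of the function.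
\<close>

lemma binom_eval_zero_imp_zero:
  assumes "coeff_fun d c"
    and "\<And>n. n \<in> multi_index d \<Longrightarrow> (\<forall>i\<le>d. n\<^sub>0 \<le> n i) \<Longrightarrow> binom_eval d c n = 0"
  shows "c = (\<lambda>_. 0)"
proof -
  have "bdd_above ((\<lambda>k. \<Sum>i\<le>d. k i) ` {k. c k \<noteq> 0})"
    using assms(1) by (simp add: coeff_fun_def)
  then obtain D where "\<And>k. c k \<noteq> 0 \<Longrightarrow> (\<Sum>i\<le>d. k i) \<le> D"
    by (auto simp: bdd_above_def)
  with assms show ?thesis
  proof (induction D arbitrary: c n\<^sub>0)
    case 0
    have "{k. c k \<noteq> 0} \<subseteq> {\<lambda>_. 0}"
    proof (safe, rule ext)
      fix k i assume k: "c k \<noteq> 0"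
      then have "k \<in> multi_index d" using 0(1) by (auto simp: coeff_fun_def)
      with 0(3)[OF k] show "k i = 0"
        by (cases "i \<le> d") (auto simp: multi_index_def)
    qed
    then show ?case
      using 0(2)[of "\<lambda>i. if i \<le> d then n\<^sub>0 else 0"]
      by (intro binom_eval_constant_zero) (auto simp: multi_index_def)
  next
    case (Suc D)
    have shift: "shift_coeff i c = (\<lambda>_. 0)" if "i \<le> d" for i
    proof (rule Suc.IH)
      show "coeff_fun d (shift_coeff i c)"
        using Suc.prems(1) that by (rule coeff_fun_shift_coeff)
      show "binom_eval d (shift_coeff i c) n = 0"
        if "n \<in> multi_index d" "\<forall>i\<le>d. Suc n\<^sub>0 \<le> n i" for n
      proof -
        have "binom_eval d c n = 0" using that by (intro Suc.prems(2)) auto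
        moreover have "binom_eval d c (n(i := n i - 1)) = 0"
          using that \<open>i \<le> d\<close> by (intro Suc.prems(2) multi_index_upd) auto
        moreover have "n i > 0" using that(2) \<open>i \<le> d\<close> by auto
        ultimately show ?thesis
          using Suc.prems(1) \<open>i \<le> d\<close> by (simp add: binom_eval_shift_coeff)
      qed
      show "(\<Sum>j\<le>d. h j) \<le> D" if "shift_coeff i c h \<noteq> 0" for h
      proof -
        have "(\<Sum>j\<le>d. (h(i := Suc (h i))) j) \<le> Suc D"
          using that unfolding shift_coeff_def by (rule Suc.prems(3))
        moreover have "(\<Sum>j\<le>d. (h(i := Suc (h i))) j) = Suc (\<Sum>j\<le>d. h j)"
          using \<open>i \<le> d\<close> by (simp add: sum.remove[of "{..d}" i])
        ultimately show ?thesis by simp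
      qed
    qed
    have "{k. c k \<noteq> 0} \<subseteq> {\<lambda>_. 0}"
    proof (safe, rule ext, rule ccontr)
      fix k i assume k: "c k \<noteq> 0" and i: "k i \<noteq> 0"
      have "k \<in> multi_index d" using k Suc.prems(1) by (auto simp: coeff_fun_def)
      with i have "i \<le> d" by (auto simp: multi_index_def not_less[symmetric])
      have "shift_coeff i c (k(i := k i - 1)) = c k"
        using i by (simp add: shift_coeff_def)
      with shift[OF \<open>i \<le> d\<close>] k show False by simp
    qed
    then show ?case
      using Suc.prems(2)[of "\<lambda>i. if i \<le> d then n\<^sub>0 else 0"]
      by (intro binom_eval_constant_zero) (auto simp: multi_index_def)
  qed
qed

lemma binom_eval_eq_imp_eq:
  assumes "coeff_fun d b" "coeff_fun d c"
    and "\<And>n. n \<in> multi_index d \<Longrightarrow> (\<forall>i\<le>d. n\<^sub>0 \<le> n i) \<Longrightarrow> binom_eval d b n = binom_eval d c n"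
  shows "b = c"
proof -
  have "(\<lambda>k. b k + (-1) * c k) = (\<lambda>_. 0)"
    by (rule binom_eval_zero_imp_zero[OF binom_eval_linear(1)[OF assms(1,2)], of n\<^sub>0])
      (subst binom_eval_linear(2)[OF assms(1,2)], simp add: assms(3))
  then show ?thesis by (auto simp: fun_eq_iff)
qed


section \<open>Submodules\<close>

context module
begin

lemma submodule_carrierD: "submodule A R M \<Longrightarrow> x \<in> A \<Longrightarrow> x \<in> carrier M"
  using submoduleE(1) by blast

lemma submodule_zero: "submodule A R M \<Longrightarrow> \<zero>\<^bsub>M\<^esub> \<in> A"
  using submoduleE(2,4)[of A] submodule_carrierD[of A] smult_l_null
  by (metis R.zero_closed ex_in_conv)

lemma submodule_minus: 
  "submodule A R M \<Longrightarrow> x \<in> A \<Longrightarrow> y \<in> A \<Longrightarrow> x \<ominus>\<^bsub>M\<^esub> y \<in> A"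
  using submoduleE(3,5) by (simp add: a_minus_def)

lemmas submodule_closed = submoduleE(3,4,5) submodule_zero submodule_minus

lemma zero_submodule: "submodule {\<zero>\<^bsub>M\<^esub>} R M"
  by (rule submoduleI) auto

lemma submodule_Int: "submodule A R M \<Longrightarrow> submodule B R M \<Longrightarrow> submodule (A \<inter> B) R M"
  by (rule submoduleI) (auto simp: submodule_closed dest: submodule_carrierD)

lemma set_add_iff: "x \<in> A <+>\<^bsub>M\<^esub> B \<longleftrightarrow> (\<exists>a\<in>A. \<exists>b\<in>B. x = a \<oplus>\<^bsub>M\<^esub> b)"
  by (auto simp: set_add_def')

lemma submodule_set_add:
  assumes A: "submodule A R M" and B: "submodule B R M"
  shows "submodule (A <+>\<^bsub>M\<^esub> B) R M"
proof (rule submoduleI)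
  note carr = submodule_carrierD[OF A] submodule_carrierD[OF B]
  show "A <+>\<^bsub>M\<^esub> B \<subseteq> carrier M"
    by (auto simp: set_add_iff carr)
  show "\<zero>\<^bsub>M\<^esub> \<in> A <+>\<^bsub>M\<^esub> B"
    unfolding set_add_iff using submodule_zero[OF A] submodule_zero[OF B] by force
  show "\<ominus>\<^bsub>M\<^esub> x \<in> A <+>\<^bsub>M\<^esub> B" if x: "x \<in> A <+>\<^bsub>M\<^esub> B" for x
  proof -
    obtain a b where "a \<in> A" "b \<in> B" "x = a \<oplus>\<^bsub>M\<^esub> b" using x by (auto simp: set_add_iff)
    then have "\<ominus>\<^bsub>M\<^esub> x = \<ominus>\<^bsub>M\<^esub> a \<oplus>\<^bsub>M\<^esub> \<ominus>\<^bsub>M\<^esub> b"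
      by (simp add: M.minus_add carr)
    then show ?thesis
      unfolding set_add_iff using \<open>a \<in> A\<close> \<open>b \<in> B\<close> A B submodule_closed(1) by blast
  qed
  show "x \<oplus>\<^bsub>M\<^esub> y \<in> A <+>\<^bsub>M\<^esub> B" if xy: "x \<in> A <+>\<^bsub>M\<^esub> B" "y \<in> A <+>\<^bsub>M\<^esub> B" for x y
  proof -
    obtain a b where *: "a \<in> A" "b \<in> B" "x = a \<oplus>\<^bsub>M\<^esub> b" using xy(1) by (auto simp: set_add_iff)
    obtain a' b' where **: "a' \<in> A" "b' \<in> B" "y = a' \<oplus>\<^bsub>M\<^esub> b'" using xy(2) by (auto simp: set_add_iff)
    have "x \<oplus>\<^bsub>M\<^esub> y = (a \<oplus>\<^bsub>M\<^esub> a') \<oplus>\<^bsub>M\<^esub> (b \<oplus>\<^bsub>M\<^esub> b')"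
      using * ** by (simp add: M.a_ac carr)
    moreover have "a \<oplus>\<^bsub>M\<^esub> a' \<in> A" "b \<oplus>\<^bsub>M\<^esub> b' \<in> B"
      using * ** A B submodule_closed(3) by auto
    ultimately show ?thesis unfolding set_add_iff by blast
  qed
  show "r \<odot>\<^bsub>M\<^esub> x \<in> A <+>\<^bsub>M\<^esub> B" if rx: "r \<in> carrier R" "x \<in> A <+>\<^bsub>M\<^esub> B" for r x
  proof -
    obtain a b where *: "a \<in> A" "b \<in> B" "x = a \<oplus>\<^bsub>M\<^esub> b" using rx(2) by (auto simp: set_add_iff)
    then have "r \<odot>\<^bsub>M\<^esub> x = r \<odot>\<^bsub>M\<^esub> a \<oplus>\<^bsub>M\<^esub> r \<odot>\<^bsub>M\<^esub> b"
      using that(1) by (simp add: smult_r_distr carr)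
    moreover have "r \<odot>\<^bsub>M\<^esub> a \<in> A" "r \<odot>\<^bsub>M\<^esub> b \<in> B"
      using * that(1) A B submodule_closed(2) by auto
    ultimately show ?thesis unfolding set_add_iff by blast
  qed
qed

lemma set_add_upper1:
  assumes "submodule A R M" "submodule B R M" shows "A \<subseteq> A <+>\<^bsub>M\<^esub> B"
proof
  fix x assume "x \<in> A"
  then have "x = x \<oplus>\<^bsub>M\<^esub> \<zero>\<^bsub>M\<^esub>" using assms submodule_carrierD by simp
  then show "x \<in> A <+>\<^bsub>M\<^esub> B" unfolding set_add_iff using assms \<open>x \<in> A\<close> submodule_zero by blast
qed

lemma set_add_commute:
  assumes "submodule A R M" "submodule B R M" shows "A <+>\<^bsub>M\<^esub> B = B <+>\<^bsub>M\<^esub> A"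
proof -
  have "a \<oplus>\<^bsub>M\<^esub> b = b \<oplus>\<^bsub>M\<^esub> a" if "a \<in> A" "b \<in> B" for a b
    using that assms by (meson M.a_comm submodule_carrierD)
  then show ?thesis unfolding set_eq_iff set_add_iff by metis
qed

lemma set_add_upper2:
  assumes "submodule A R M" "submodule B R M" shows "B \<subseteq> A <+>\<^bsub>M\<^esub> B"
  using set_add_upper1[OF assms(2,1)] set_add_commute[OF assms] by simp

lemma set_add_least:
  assumes "submodule C R M" "A \<subseteq> C" "B \<subseteq> C" shows "A <+>\<^bsub>M\<^esub> B \<subseteq> C"
proof
  fix x assume "x \<in> A <+>\<^bsub>M\<^esub> B"
  then obtain a b where "a \<in> A" "b \<in> B" "x = a \<oplus>\<^bsub>M\<^esub> b" by (auto simp: set_add_iff)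
  with assms show "x \<in> C" using submodule_closed(3)[OF assms(1), of a b] by blast
qed

lemma set_add_mono: "A \<subseteq> A' \<Longrightarrow> B \<subseteq> B' \<Longrightarrow> A <+>\<^bsub>M\<^esub> B \<subseteq> A' <+>\<^bsub>M\<^esub> B'"
  unfolding subset_iff[of "A <+>\<^bsub>M\<^esub> B"] set_add_iff by blast

lemma set_add_absorb:
  assumes "submodule A R M" "submodule B R M" "B \<subseteq> A" shows "A <+>\<^bsub>M\<^esub> B = A"
  using assms set_add_least[of A A B] set_add_upper1[of A B] by auto

lemma set_add_absorb2:
  assumes "submodule A R M" "submodule B R M" "B \<subseteq> A" shows "B <+>\<^bsub>M\<^esub> A = A"
  using assms set_add_least[of A B A] set_add_upper2[of B A] by auto

lemma set_add_assoc:
  assumes "submodule A R M" "submodule B R M" "submodule C R M"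
  shows "(A <+>\<^bsub>M\<^esub> B) <+>\<^bsub>M\<^esub> C = A <+>\<^bsub>M\<^esub> (B <+>\<^bsub>M\<^esub> C)"
proof (rule equalityI)
  note A = assms(1) and B = assms(2) and C = assms(3)
  note AB = submodule_set_add[OF A B] and BC = submodule_set_add[OF B C]
  show "(A <+>\<^bsub>M\<^esub> B) <+>\<^bsub>M\<^esub> C \<subseteq> A <+>\<^bsub>M\<^esub> (B <+>\<^bsub>M\<^esub> C)"
    using set_add_upper1[OF A BC] set_add_upper2[OF A BC] set_add_upper1[OF B C] set_add_upper2[OF B C]
    by (intro set_add_least[OF submodule_set_add[OF A BC]]) auto
  show "A <+>\<^bsub>M\<^esub> (B <+>\<^bsub>M\<^esub> C) \<subseteq> (A <+>\<^bsub>M\<^esub> B) <+>\<^bsub>M\<^esub> C"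
    using set_add_upper1[OF AB C] set_add_upper2[OF AB C] set_add_upper1[OF A B] set_add_upper2[OF A B]
    by (intro set_add_least[OF submodule_set_add[OF AB C]]) auto
qed

text \<open>
  The lattice of submodules is modular. Additivity of length and the second isomorphism theorem
  for lengths rest on this law.
\<close>

lemma modular_law:
  assumes "submodule A R M" "submodule B R M" "submodule C R M" "A \<subseteq> C"
  shows "(A <+>\<^bsub>M\<^esub> B) \<inter> C = A <+>\<^bsub>M\<^esub> (B \<inter> C)"
proof (intro equalityI subsetI)
  fix x assume x: "x \<in> (A <+>\<^bsub>M\<^esub> B) \<inter> C"
  then obtain a b where ab: "a \<in> A" "b \<in> B" "x = a \<oplus>\<^bsub>M\<^esub> b" by (auto simp: set_add_iff)
  then have "b = x \<ominus>\<^bsub>M\<^esub> a"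
    using submodule_carrierD[OF assms(1) ab(1)] submodule_carrierD[OF assms(2) ab(2)]
    by (metis M.a_comm M.add.inv_solve_right M.add.m_closed a_minus_def)
  then have "b \<in> C" using x ab assms submodule_closed(5)[of C] by blast
  then show "x \<in> A <+>\<^bsub>M\<^esub> (B \<inter> C)" using ab by (auto simp: set_add_iff)
next
  fix x assume "x \<in> A <+>\<^bsub>M\<^esub> (B \<inter> C)"
  then show "x \<in> (A <+>\<^bsub>M\<^esub> B) \<inter> C"
    using set_add_mono[of A A "B \<inter> C" B] set_add_least[OF assms(3,4), of "B \<inter> C"] by blast
qed

end


section \<open>Lengths of intervals of submodules\<close>

definition submodule_chain where
  "submodule_chain R M B A n S \<longleftrightarrow>
     (\<forall>i\<le>n. submodule (S i) R M \<and> B \<subseteq> S i \<and> S i \<subseteq> A) \<and> (\<forall>i<n. S i \<subset> S (Suc i))" for n :: nat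

text \<open>
  The length of \<open>A / B\<close>, measured inside the ambient module. Lengths of quotients of
  different modules can then be compared without changing the type of elements.
\<close>

definition sub_len where
  "sub_len R M B A = Sup {enat n | n. \<exists>S. submodule_chain R M B A n S}"

lemma submodule_chain_truncate:
  "submodule_chain R M B A n S \<Longrightarrow> m \<le> n \<Longrightarrow> submodule_chain R M B A m S"
  by (auto simp: submodule_chain_def)

lemma enat_le_Sup_iff:
  assumes "enat n \<le> Sup X" "X \<noteq> {}"
  shows "\<exists>x\<in>X. enat n \<le> x"
proof (rule ccontr)
  assume *: "\<not> ?thesis"
  then have "n \<noteq> 0" using assms(2) by (auto simp: enat_0)
  have "x \<le> enat (n - 1)" if "x \<in> X" for x
    using * that \<open>n \<noteq> 0\<close> by (cases x) (auto simp: not_le)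
  then have "Sup X \<le> enat (n - 1)" by (rule Sup_least)
  with assms(1) \<open>n \<noteq> 0\<close> have "enat n \<le> enat (n - 1)" by (meson order_trans)
  with \<open>n \<noteq> 0\<close> show False by simp
qed

text \<open>
  A bound from below on a supremum of natural numbers is attained, also when the length is
  infinite; this reduces inequalities between lengths to statements about chains.
\<close>

lemma enat_le_sub_len_iff:
  assumes "submodule B R M" "B \<subseteq> A"
  shows "enat n \<le> sub_len R M B A \<longleftrightarrow> (\<exists>S. submodule_chain R M B A n S)"
proof
  assume *: "enat n \<le> sub_len R M B A"
  have "submodule_chain R M B A 0 (\<lambda>_. B)"
    using assms by (simp add: submodule_chain_def)
  then have "{enat n | n. \<exists>S. submodule_chain R M B A n S} \<noteq> {}" by blast
  from enat_le_Sup_iff[OF *[unfolded sub_len_def] this]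
  show "\<exists>S. submodule_chain R M B A n S"
    using submodule_chain_truncate by fastforce
next
  assume "\<exists>S. submodule_chain R M B A n S"
  then show "enat n \<le> sub_len R M B A"
    unfolding sub_len_def by (intro Sup_upper) blast
qed

lemma enat_le_all: "(\<And>n. enat n \<le> x \<Longrightarrow> enat n \<le> y) \<Longrightarrow> x \<le> y"
  by (cases x; cases y) (auto, metis Suc_n_not_le_n)

lemma enat_add_le_all:
  assumes "\<And>m n. enat m \<le> x \<Longrightarrow> enat n \<le> y \<Longrightarrow> enat (m + n) \<le> z"
  shows "x + y \<le> z"
proof -
  consider m n where "x = enat m" "y = enat n" | "y = \<infinity>" | "x = \<infinity>"
    by (cases x; cases y) auto
  then show ?thesis
  proof cases
    case 1
    then show ?thesis using assms by simp
  next
    case 2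
    have "enat n \<le> z" for n using assms[of 0 n] 2 by (simp add: zero_enat_def[symmetric])
    then have "z = \<infinity>" by (cases z) (auto, metis Suc_n_not_le_n)
    then show ?thesis by simp
  next
    case 3
    have "enat n \<le> z" for n using assms[of n 0] 3 by (simp add: zero_enat_def[symmetric])
    then have "z = \<infinity>" by (cases z) (auto, metis Suc_n_not_le_n)
    then show ?thesis by simp
  qed
qed

text \<open>
  Strictly monotone maps between intervals of submodules carry chains to chains.
\<close>

lemma sub_len_le_map:
  assumes "\<And>S. submodule S R M \<Longrightarrow> B \<subseteq> S \<Longrightarrow> S \<subseteq> A \<Longrightarrow>
      submodule (f S) R' M' \<and> B' \<subseteq> f S \<and> f S \<subseteq> A'"
    and "\<And>S T. submodule S R M \<Longrightarrow> submodule T R M \<Longrightarrow> B \<subseteq> S \<Longrightarrow> S \<subset> T \<Longrightarrow> T \<subseteq> A \<Longrightarrow> f S \<subset> f T"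
  shows "sub_len R M B A \<le> sub_len R' M' B' A'"
  unfolding sub_len_def
proof (rule Sup_subset_mono, safe)
  fix n S assume S: "submodule_chain R M B A n S"
  have "submodule_chain R' M' B' A' n (\<lambda>i. f (S i))"
    unfolding submodule_chain_def
  proof (intro conjI allI impI)
    fix i assume "i < n"
    with S show "f (S i) \<subset> f (S (Suc i))"
      by (intro assms(2)) (auto simp: submodule_chain_def)
  qed (use S assms(1) in \<open>auto simp: submodule_chain_def\<close>)
  then show "\<exists>m. enat n = enat m \<and> (\<exists>S. submodule_chain R' M' B' A' m S)" by blast
qed

lemma sub_len_mono: "B' \<subseteq> B \<Longrightarrow> A \<subseteq> A' \<Longrightarrow> sub_len R M B A \<le> sub_len R M B' A'"
  by (rule sub_len_le_map[where f = id]) auto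

lemma sub_len_superadd:
  assumes "submodule C R M" "C \<subseteq> B" "submodule B R M" "B \<subseteq> A"
  shows "sub_len R M C B + sub_len R M B A \<le> sub_len R M C A"
proof (rule enat_add_le_all)
  fix m n assume "enat m \<le> sub_len R M C B" "enat n \<le> sub_len R M B A"
  then obtain S T where S: "submodule_chain R M C B m S" and T: "submodule_chain R M B A n T"
    using enat_le_sub_len_iff assms by metis
  define U where "U i = (if i \<le> m then S i else T (i - m))" for i
  have "submodule_chain R M C A (m + n) U"
    unfolding submodule_chain_def
  proof (intro conjI allI impI)
    fix i assume "i < m + n"
    consider "i < m" | "i = m" "n > 0" | "i > m" using \<open>i < m + n\<close> by linarith
    then show "U i \<subset> U (Suc i)"
    proof cases
      case 1 then show ?thesis using S by (simp add: U_def submodule_chain_def)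
    next
      case 2
      have "S m \<subseteq> B" "B \<subseteq> T 0" "T 0 \<subset> T (Suc 0)"
        using S T \<open>n > 0\<close> by (simp_all add: submodule_chain_def)
      then show ?thesis using 2 by (simp add: U_def)
    next
      case 3
      then show ?thesis using T \<open>i < m + n\<close> by (simp add: U_def submodule_chain_def Suc_diff_le)
    qed
  next
    fix i assume "i \<le> m + n"
    have "submodule (S i) R M \<and> C \<subseteq> S i \<and> S i \<subseteq> B" if "i \<le> m"
      using S that by (simp add: submodule_chain_def)
    moreover have "submodule (T (i - m)) R M \<and> B \<subseteq> T (i - m) \<and> T (i - m) \<subseteq> A" if "\<not> i \<le> m"
      using T that \<open>i \<le> m + n\<close> by (simp add: submodule_chain_def)
    ultimately show "submodule (U i) R M" "C \<subseteq> U i" "U i \<subseteq> A"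
      using assms(2,4) by (auto simp: U_def)
  qed
  then show "enat (m + n) \<le> sub_len R M C A"
    using enat_le_sub_len_iff assms by (metis order_trans)
qed

lemma one_le_sub_len:
  assumes "submodule X R M" "submodule Y R M" "X \<subset> Y"
  shows "1 \<le> sub_len R M X Y"
proof -
  have "submodule_chain R M X Y 1 (\<lambda>i. if i = 0 then X else Y)"
    using assms by (auto simp: submodule_chain_def)
  then have "enat 1 \<le> sub_len R M X Y" using enat_le_sub_len_iff assms by (metis psubset_imp_subset)
  then show ?thesis by (simp add: one_enat_def)
qed

lemma sub_len_strict:
  assumes "submodule C R M" "submodule X R M" "submodule Y R M" "C \<subseteq> X" "X \<subset> Y"
  shows "sub_len R M C X + 1 \<le> sub_len R M C Y"
  using add_left_mono[OF one_le_sub_len[OF assms(2,3,5)], of "sub_len R M C X"]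
    sub_len_superadd[OF assms(1,4,2), of Y] assms(5) by (meson order_trans psubset_imp_subset)

lemma sub_len_eq_0_iff:
  assumes "submodule X R M" "submodule Y R M" "X \<subseteq> Y"
  shows "sub_len R M X Y = 0 \<longleftrightarrow> X = Y"
proof
  show "X = Y" if "sub_len R M X Y = 0"
    using one_le_sub_len[OF assms(1,2)] assms(3) that by (auto simp: psubset_eq)
  show "sub_len R M X Y = 0" if "X = Y"
  proof -
    have "\<not> enat 1 \<le> sub_len R M X Y"
    proof
      assume "enat 1 \<le> sub_len R M X Y"
      then obtain S where "submodule_chain R M X Y 1 S" using enat_le_sub_len_iff[OF assms(1,3)] by blast
      then have "X \<subseteq> S 0" "S 0 \<subset> S 1" "S 1 \<subseteq> Y" by (auto simp: submodule_chain_def)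
      with that show False by blast
    qed
    then show ?thesis by (cases "sub_len R M X Y") (auto simp: zero_enat_def)
  qed
qed

context module
begin

text \<open>
  For a chain \<open>S\<close> from \<open>C\<close> to \<open>A\<close>, each strict step is strict after intersection with \<open>B\<close> or
  after adding \<open>B\<close>, by the modular law.
\<close>

theorem sub_len_add:
  assumes C: "submodule C R M" and B: "submodule B R M" and A: "submodule A R M"
    and sub: "C \<subseteq> B" "B \<subseteq> A"
  shows "sub_len R M C A = sub_len R M C B + sub_len R M B A"
proof (rule antisym)
  show "sub_len R M C B + sub_len R M B A \<le> sub_len R M C A"
    by (rule sub_len_superadd[OF C sub(1) B sub(2)])
  show "sub_len R M C A \<le> sub_len R M C B + sub_len R M B A"
  proof (rule enat_le_all)
    fix n assume "enat n \<le> sub_len R M C A"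
    then obtain S where S: "submodule_chain R M C A n S"
      using enat_le_sub_len_iff[OF C] sub by blast
    then have sm: "submodule (S j) R M" "C \<subseteq> S j" "S j \<subseteq> A" if "j \<le> n" for j
      using that by (auto simp: submodule_chain_def)
    note smI = submodule_Int[OF sm(1) B] and smA = submodule_set_add[OF sm(1) B]
    have "enat j \<le> sub_len R M C (S j \<inter> B) + sub_len R M B (S j <+>\<^bsub>M\<^esub> B)" if "j \<le> n" for j
      using that
    proof (induction j)
      case 0
      then show ?case by (simp add: enat_0)
    next
      case (Suc j)
      then have j: "j \<le> n" "Suc j \<le> n" and less: "S j \<subset> S (Suc j)"
        using S by (auto simp: submodule_chain_def)
      have I: "S j \<inter> B \<subseteq> S (Suc j) \<inter> B" and P: "S j <+>\<^bsub>M\<^esub> B \<subseteq> S (Suc j) <+>\<^bsub>M\<^esub> B"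
        using less by (auto intro: set_add_mono[THEN subsetD])
      have "\<not> (S j \<inter> B = S (Suc j) \<inter> B \<and> S j <+>\<^bsub>M\<^esub> B = S (Suc j) <+>\<^bsub>M\<^esub> B)"
      proof safe
        assume eq: "S j \<inter> B = S (Suc j) \<inter> B" "S j <+>\<^bsub>M\<^esub> B = S (Suc j) <+>\<^bsub>M\<^esub> B"
        have "S (Suc j) = (S (Suc j) <+>\<^bsub>M\<^esub> B) \<inter> S (Suc j)"
          using set_add_upper1[OF sm(1)[OF j(2)] B] by blast
        also have "\<dots> = S j <+>\<^bsub>M\<^esub> (B \<inter> S (Suc j))"
          using eq(2) modular_law[OF sm(1)[OF j(1)] B sm(1)[OF j(2)]] less by auto
        also have "\<dots> = S j"
          using eq(1) by (intro set_add_absorb sm(1) j submodule_Int B) auto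
        finally show False using less by blast
      qed
      then consider "S j \<inter> B \<subset> S (Suc j) \<inter> B" | "S j <+>\<^bsub>M\<^esub> B \<subset> S (Suc j) <+>\<^bsub>M\<^esub> B"
        using I P by blast
      then have "sub_len R M C (S j \<inter> B) + sub_len R M B (S j <+>\<^bsub>M\<^esub> B) + 1 \<le>
          sub_len R M C (S (Suc j) \<inter> B) + sub_len R M B (S (Suc j) <+>\<^bsub>M\<^esub> B)"
      proof cases
        case 1
        then have "sub_len R M C (S j \<inter> B) + 1 \<le> sub_len R M C (S (Suc j) \<inter> B)"
          using j sm(2) sub by (intro sub_len_strict C smI) auto
        moreover have "sub_len R M B (S j <+>\<^bsub>M\<^esub> B) \<le> sub_len R M B (S (Suc j) <+>\<^bsub>M\<^esub> B)"
          using P by (intro sub_len_mono) auto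
        ultimately show ?thesis
          using add_mono by (metis add.assoc add.commute)
      next
        case 2
        then have "sub_len R M B (S j <+>\<^bsub>M\<^esub> B) + 1 \<le> sub_len R M B (S (Suc j) <+>\<^bsub>M\<^esub> B)"
          using j set_add_upper2[OF sm(1) B] by (intro sub_len_strict B smA) auto
        moreover have "sub_len R M C (S j \<inter> B) \<le> sub_len R M C (S (Suc j) \<inter> B)"
          using I by (intro sub_len_mono) auto
        ultimately show ?thesis
          using add_mono by (metis add.assoc)
      qed
      moreover have "enat (Suc j) \<le> sub_len R M C (S j \<inter> B) + sub_len R M B (S j <+>\<^bsub>M\<^esub> B) + 1"
        using add_right_mono[OF Suc.IH[OF j(1)], of 1] by (simp add: one_enat_def)
      ultimately show ?case by (rule order_trans[rotated])
    qed
    from this[of n] have "enat n \<le> sub_len R M C (S n \<inter> B) + sub_len R M B (S n <+>\<^bsub>M\<^esub> B)" by simp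
    also have "\<dots> \<le> sub_len R M C B + sub_len R M B A"
      using sm[of n] set_add_least[OF A, of "S n" B] sub
      by (intro add_mono sub_len_mono) auto
    finally show "enat n \<le> sub_len R M C B + sub_len R M B A" .
  qed
qed

text \<open>
  Intersecting with \<open>A\<close> and adding \<open>B\<close> are mutually inverse between the two intervals.
\<close>

theorem sub_len_second_iso:
  assumes A: "submodule A R M" and B: "submodule B R M"
  shows "sub_len R M B (A <+>\<^bsub>M\<^esub> B) = sub_len R M (A \<inter> B) A"
proof (rule antisym)
  show "sub_len R M B (A <+>\<^bsub>M\<^esub> B) \<le> sub_len R M (A \<inter> B) A"
  proof (rule sub_len_le_map[where f = "\<lambda>S. S \<inter> A"])
    fix S T assume *: "submodule S R M" "submodule T R M" "B \<subseteq> S" "S \<subset> T" "T \<subseteq> A <+>\<^bsub>M\<^esub> B"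
    have rec: "U = B <+>\<^bsub>M\<^esub> (U \<inter> A)" if "submodule U R M" "B \<subseteq> U" "U \<subseteq> A <+>\<^bsub>M\<^esub> B" for U
      using modular_law[OF B A that(1,2)] that(3) set_add_commute[OF A B] by (auto simp: Int_commute)
    have "S \<inter> A \<noteq> T \<inter> A" using rec[of S] rec[of T] *
      by (metis order_trans psubset_imp_subset psubset_eq)
    then show "S \<inter> A \<subset> T \<inter> A" using *(4) by blast
  qed (use A in \<open>auto intro: submodule_Int\<close>)
  show "sub_len R M (A \<inter> B) A \<le> sub_len R M B (A <+>\<^bsub>M\<^esub> B)"
  proof (rule sub_len_le_map[where f = "\<lambda>S. S <+>\<^bsub>M\<^esub> B"])
    fix S T assume *: "submodule S R M" "submodule T R M" "A \<inter> B \<subseteq> S" "S \<subset> T" "T \<subseteq> A"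
    have rec: "U = (U <+>\<^bsub>M\<^esub> B) \<inter> A" if "submodule U R M" "A \<inter> B \<subseteq> U" "U \<subseteq> A" for U
      using modular_law[OF that(1) B A that(3)] set_add_absorb[OF that(1) submodule_Int[OF B A]] that(2)
      by (auto simp: Int_commute)
    have "S <+>\<^bsub>M\<^esub> B \<noteq> T <+>\<^bsub>M\<^esub> B" using rec[of S] rec[of T] *
      by (metis order_trans psubset_imp_subset psubset_eq)
    then show "S <+>\<^bsub>M\<^esub> B \<subset> T <+>\<^bsub>M\<^esub> B" using *(4) set_add_mono[of S T B B] by blast
  next
    fix S assume "submodule S R M" "A \<inter> B \<subseteq> S" "S \<subseteq> A"
    then show "submodule (S <+>\<^bsub>M\<^esub> B) R M \<and> B \<subseteq> S <+>\<^bsub>M\<^esub> B \<and> S <+>\<^bsub>M\<^esub> B \<subseteq> A <+>\<^bsub>M\<^esub> B"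
      using submodule_set_add[of S B] set_add_upper2[of S B] B set_add_mono[of S A B B] by simp
  qed
qed

lemma sub_len_quotient_le:
  assumes A: "submodule A R M" and B: "submodule B R M" and K: "submodule K R M" and sub: "B \<subseteq> A"
  shows "sub_len R M (B <+>\<^bsub>M\<^esub> K) (A <+>\<^bsub>M\<^esub> K) = sub_len R M (B <+>\<^bsub>M\<^esub> (K \<inter> A)) A"
    and "sub_len R M (B <+>\<^bsub>M\<^esub> K) (A <+>\<^bsub>M\<^esub> K) \<le> sub_len R M B A"
proof -
  have "A <+>\<^bsub>M\<^esub> (B <+>\<^bsub>M\<^esub> K) = A <+>\<^bsub>M\<^esub> K"
    using set_add_assoc[OF A B K] set_add_absorb[OF A B sub] by simp
  then show *: "sub_len R M (B <+>\<^bsub>M\<^esub> K) (A <+>\<^bsub>M\<^esub> K) = sub_len R M (B <+>\<^bsub>M\<^esub> (K \<inter> A)) A"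
    using sub_len_second_iso[OF A submodule_set_add[OF B K]] modular_law[OF B K A sub]
    by (simp add: Int_commute)
  show "sub_len R M (B <+>\<^bsub>M\<^esub> K) (A <+>\<^bsub>M\<^esub> K) \<le> sub_len R M B A"
    unfolding * using set_add_upper1[OF B submodule_Int[OF K A]] by (intro sub_len_mono) auto
qed

end


section \<open>Products of ideals and submodules\<close>

text \<open>
  The colon ideal \<open>K : H\<close>.
\<close>

definition residual :: "('a, 'r) ring_scheme \<Rightarrow> ('a, 'b, 'm) module_scheme \<Rightarrow> 'b set \<Rightarrow> 'b set \<Rightarrow> 'a set" where
  "residual R M K H = {r \<in> carrier R. \<forall>x\<in>H. r \<odot>\<^bsub>M\<^esub> x \<in> K}"

context module
begin

lemma residual_ideal:
  assumes K: "submodule K R M" and H: "H \<subseteq> carrier M"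
  shows "ideal (residual R M K H) R"
proof (rule idealI)
  show "ring R" by (rule R.ring_axioms)
  have "\<ominus>\<^bsub>R\<^esub> a \<in> residual R M K H" if "a \<in> residual R M K H" for a
    using that H submodule_closed(1)[OF K] by (auto simp: residual_def smult_l_minus subset_iff)
  moreover have "a \<oplus>\<^bsub>R\<^esub> b \<in> residual R M K H" if "a \<in> residual R M K H" "b \<in> residual R M K H" for a b
    using that H submodule_closed(3)[OF K] by (auto simp: residual_def smult_l_distr subset_iff)
  moreover have "\<zero>\<^bsub>R\<^esub> \<in> residual R M K H"
    using H submodule_zero[OF K] by (auto simp: residual_def subset_iff)
  ultimately show "subgroup (residual R M K H) (add_monoid R)"
    by (intro R.add.subgroupI) (auto simp: residual_def a_inv_def[symmetric])
  show l: "x \<otimes>\<^bsub>R\<^esub> a \<in> residual R M K H" if "a \<in> residual R M K H" "x \<in> carrier R" for a x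
    using that H submodule_closed(2)[OF K] by (auto simp: residual_def smult_assoc1 subset_iff)
  show "a \<otimes>\<^bsub>R\<^esub> x \<in> residual R M K H" if "a \<in> residual R M K H" "x \<in> carrier R" for a x
    using l[OF that] R.m_comm[of a x] that by (auto simp: residual_def)
qed

lemma ideal_carrierD: "ideal I R \<Longrightarrow> a \<in> I \<Longrightarrow> a \<in> carrier R"
  by (rule ideal.Icarr)

lemma ideal_smult_subset_iff:
  assumes K: "submodule K R M"
  shows "ideal_smult M I H \<subseteq> K \<longleftrightarrow> (\<forall>a\<in>I. \<forall>x\<in>H. a \<odot>\<^bsub>M\<^esub> x \<in> K)"
proof
  show "\<forall>a\<in>I. \<forall>x\<in>H. a \<odot>\<^bsub>M\<^esub> x \<in> K" if "ideal_smult M I H \<subseteq> K"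
    using that ideal_smult.prod[of _ I _ H M] by blast
next
  assume *: "\<forall>a\<in>I. \<forall>x\<in>H. a \<odot>\<^bsub>M\<^esub> x \<in> K"
  show "ideal_smult M I H \<subseteq> K"
  proof
    fix y assume "y \<in> ideal_smult M I H"
    then show "y \<in> K"
      by induction (use * submodule_closed(3)[OF K] in auto)
  qed
qed

lemma ideal_smult_subset_iff_residual:
  assumes "submodule K R M" "I \<subseteq> carrier R"
  shows "ideal_smult M I H \<subseteq> K \<longleftrightarrow> I \<subseteq> residual R M K H"
  unfolding ideal_smult_subset_iff[OF assms(1)] residual_def using assms(2) by auto

lemma submodule_ideal_smult:
  assumes I: "ideal I R" and H: "submodule H R M"
  shows "submodule (ideal_smult M I H) R M"
proof (rule submoduleI)
  note carr = ideal_carrierD[OF I] submodule_carrierD[OF H]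
  show "ideal_smult M I H \<subseteq> carrier M"
    unfolding ideal_smult_subset_iff[OF carrier_is_submodule] by (auto simp: carr)
  then have IH: "y \<in> carrier M" if "y \<in> ideal_smult M I H" for y using that by blast
  have "\<zero>\<^bsub>R\<^esub> \<odot>\<^bsub>M\<^esub> \<zero>\<^bsub>M\<^esub> \<in> ideal_smult M I H"
    using submodule_zero[OF H] additive_subgroup.zero_closed[OF ideal.axioms(1)[OF I]]
    by (rule ideal_smult.prod[rotated])
  then show "\<zero>\<^bsub>M\<^esub> \<in> ideal_smult M I H" by simp
  show "x \<oplus>\<^bsub>M\<^esub> y \<in> ideal_smult M I H" if "x \<in> ideal_smult M I H" "y \<in> ideal_smult M I H" for x y
    using that by (rule ideal_smult.sum)
  show smult: "r \<odot>\<^bsub>M\<^esub> y \<in> ideal_smult M I H" if r: "r \<in> carrier R" and y: "y \<in> ideal_smult M I H" for r y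
    using y
  proof induction
    case (prod a x)
    then have "r \<odot>\<^bsub>M\<^esub> (a \<odot>\<^bsub>M\<^esub> x) = (r \<otimes>\<^bsub>R\<^esub> a) \<odot>\<^bsub>M\<^esub> x"
      using r by (simp add: smult_assoc1 carr)
    moreover have "r \<otimes>\<^bsub>R\<^esub> a \<in> I" using ideal.I_l_closed[OF I] prod r by blast
    ultimately show ?case using prod(2) by (auto intro: ideal_smult.prod)
  next
    case (sum x y)
    then show ?case using r IH by (simp add: smult_r_distr ideal_smult.sum)
  qed
  show "\<ominus>\<^bsub>M\<^esub> y \<in> ideal_smult M I H" if y: "y \<in> ideal_smult M I H" for y
    using smult[OF _ y, of "\<ominus>\<^bsub>R\<^esub> \<one>\<^bsub>R\<^esub>"] IH[OF y] by (simp add: smult_l_minus)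
qed

lemma ideal_smult_mono:
  "I \<subseteq> I' \<Longrightarrow> H \<subseteq> H' \<Longrightarrow> ideal_smult M I H \<subseteq> ideal_smult M I' H'"
proof
  fix y assume *: "I \<subseteq> I'" "H \<subseteq> H'" and "y \<in> ideal_smult M I H"
  from this(3) show "y \<in> ideal_smult M I' H'"
    by induction (use * in \<open>auto intro: ideal_smult.intros\<close>)
qed

lemma ideal_smult_subset:
  assumes "ideal I R" "submodule H R M"
  shows "ideal_smult M I H \<subseteq> H"
  unfolding ideal_smult_subset_iff[OF assms(2)]
  using submodule_closed(2)[OF assms(2)] ideal_carrierD[OF assms(1)] by blast

lemma ideal_smult_one:
  assumes H: "submodule H R M"
  shows "ideal_smult M (carrier R) H = H"
proof
  show "ideal_smult M (carrier R) H \<subseteq> H" by (rule ideal_smult_subset[OF R.oneideal H])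
  show "H \<subseteq> ideal_smult M (carrier R) H"
  proof
    fix x assume "x \<in> H"
    then have "\<one>\<^bsub>R\<^esub> \<odot>\<^bsub>M\<^esub> x \<in> ideal_smult M (carrier R) H" by (intro ideal_smult.prod) auto
    then show "x \<in> ideal_smult M (carrier R) H" using submodule_carrierD[OF H \<open>x \<in> H\<close>] by simp
  qed
qed

lemma ideal_smult_ideal_prod:
  assumes I: "ideal I R" and J: "ideal J R" and H: "submodule H R M"
  shows "ideal_smult M (ideal_prod R I J) H = ideal_smult M I (ideal_smult M J H)"
proof
  note carr = ideal_carrierD[OF I] ideal_carrierD[OF J] submodule_carrierD[OF H]
  note JH = submodule_ideal_smult[OF J H]
  note IJH = submodule_ideal_smult[OF I JH]
  have IJ: "ideal (ideal_prod R I J) R" by (rule R.ideal_prod_is_ideal[OF I J])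
  have "ideal_prod R I J \<subseteq> residual R M (ideal_smult M I (ideal_smult M J H)) H"
  proof
    fix c assume "c \<in> ideal_prod R I J"
    then show "c \<in> residual R M (ideal_smult M I (ideal_smult M J H)) H"
    proof induction
      case (prod i j)
      have "(i \<otimes>\<^bsub>R\<^esub> j) \<odot>\<^bsub>M\<^esub> x \<in> ideal_smult M I (ideal_smult M J H)" if "x \<in> H" for x
        using prod that by (auto simp: smult_assoc1 carr intro: ideal_smult.prod)
      then show ?case using prod by (auto simp: residual_def carr)
    next
      case (sum a b)
      then show ?case
        using residual_ideal[OF IJH, of H] submoduleE(1)[OF H]
        by (simp add: additive_subgroup.a_closed ideal_def)
    qed
  qed
  then show "ideal_smult M (ideal_prod R I J) H \<subseteq> ideal_smult M I (ideal_smult M J H)"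
    using ideal_smult_subset_iff_residual[OF IJH] ideal_carrierD[OF IJ] by blast
  show "ideal_smult M I (ideal_smult M J H) \<subseteq> ideal_smult M (ideal_prod R I J) H"
    unfolding ideal_smult_subset_iff[OF submodule_ideal_smult[OF IJ H]]
  proof (intro ballI)
    fix i y assume i: "i \<in> I" and "y \<in> ideal_smult M J H"
    from this(2) show "i \<odot>\<^bsub>M\<^esub> y \<in> ideal_smult M (ideal_prod R I J) H"
    proof induction
      case (prod j x)
      then have "i \<odot>\<^bsub>M\<^esub> (j \<odot>\<^bsub>M\<^esub> x) = (i \<otimes>\<^bsub>R\<^esub> j) \<odot>\<^bsub>M\<^esub> x" using i by (simp add: smult_assoc1 carr)
      then show ?case using i prod by (auto intro!: ideal_smult.prod ideal_prod.prod)
    next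
      case (sum x y)
      then show ?case
        using i submodule_carrierD[OF JH] by (simp add: smult_r_distr carr ideal_smult.sum)
    qed
  qed
qed

lemma ideal_smult_Idl_subset:
  assumes S: "S \<subseteq> carrier R" and K: "submodule K R M" and H: "H \<subseteq> carrier M"
    and "\<And>s x. s \<in> S \<Longrightarrow> x \<in> H \<Longrightarrow> s \<odot>\<^bsub>M\<^esub> x \<in> K"
  shows "ideal_smult M (Idl\<^bsub>R\<^esub> S) H \<subseteq> K"
proof -
  have "S \<subseteq> residual R M K H" using assms by (auto simp: residual_def)
  then have "Idl\<^bsub>R\<^esub> S \<subseteq> residual R M K H" by (rule R.genideal_minimal[OF residual_ideal[OF K H]])
  then show ?thesis
    using ideal_smult_subset_iff_residual[OF K] ideal_carrierD[OF R.genideal_ideal[OF S]] by blast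
qed

end


section \<open>Linear maps\<close>

locale linear_map = M: module R M + M': module R M' for R M M' +
  fixes \<phi>
  assumes map_closed: "x \<in> carrier M \<Longrightarrow> \<phi> x \<in> carrier M'"
    and map_add: "x \<in> carrier M \<Longrightarrow> y \<in> carrier M \<Longrightarrow> \<phi> (x \<oplus>\<^bsub>M\<^esub> y) = \<phi> x \<oplus>\<^bsub>M'\<^esub> \<phi> y"
    and map_smult: "a \<in> carrier R \<Longrightarrow> x \<in> carrier M \<Longrightarrow> \<phi> (a \<odot>\<^bsub>M\<^esub> x) = a \<odot>\<^bsub>M'\<^esub> \<phi> x"
begin

definition "ker = {x \<in> carrier M. \<phi> x = \<zero>\<^bsub>M'\<^esub>}"

lemma map_zero: "\<phi> \<zero>\<^bsub>M\<^esub> = \<zero>\<^bsub>M'\<^esub>"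
  using map_smult[of "\<zero>\<^bsub>R\<^esub>" "\<zero>\<^bsub>M\<^esub>"] map_closed[of "\<zero>\<^bsub>M\<^esub>"] by simp

lemma map_minus: "x \<in> carrier M \<Longrightarrow> \<phi> (\<ominus>\<^bsub>M\<^esub> x) = \<ominus>\<^bsub>M'\<^esub> \<phi> x"
  using map_smult[of "\<ominus>\<^bsub>R\<^esub> \<one>\<^bsub>R\<^esub>" x] map_closed[of x] by (simp add: M.smult_l_minus M'.smult_l_minus)

lemma submodule_image:
  assumes A: "submodule A R M" shows "submodule (\<phi> ` A) R M'"
proof (rule M'.submoduleI)
  note carr = M.submodule_carrierD[OF A]
  show "\<phi> ` A \<subseteq> carrier M'" using carr map_closed by blast
  show "\<zero>\<^bsub>M'\<^esub> \<in> \<phi> ` A" using M.submodule_zero[OF A] map_zero by force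
  show "\<ominus>\<^bsub>M'\<^esub> y \<in> \<phi> ` A" if "y \<in> \<phi> ` A" for y
    using that map_minus carr M.submodule_closed(1)[OF A] by (auto simp flip: map_minus)
  show "y \<oplus>\<^bsub>M'\<^esub> z \<in> \<phi> ` A" if "y \<in> \<phi> ` A" "z \<in> \<phi> ` A" for y z
    using that carr M.submodule_closed(3)[OF A] by (auto simp flip: map_add)
  show "a \<odot>\<^bsub>M'\<^esub> y \<in> \<phi> ` A" if "a \<in> carrier R" "y \<in> \<phi> ` A" for a y
    using that carr M.submodule_closed(2)[OF A] by (auto simp flip: map_smult)
qed

lemma submodule_vimage:
  assumes S: "submodule S R M'" shows "submodule {x \<in> carrier M. \<phi> x \<in> S} R M"
  by (rule M.submoduleI)
    (use M'.submodule_closed[OF S] in \<open>auto simp: map_zero map_minus map_add map_smult\<close>)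

lemma submodule_ker: "submodule ker R M"
  using submodule_vimage[OF M'.zero_submodule] by (simp add: ker_def)

lemma image_set_add:
  assumes "submodule A R M" "submodule B R M"
  shows "\<phi> ` (A <+>\<^bsub>M\<^esub> B) = \<phi> ` A <+>\<^bsub>M'\<^esub> \<phi> ` B"
proof -
  have "\<phi> (a \<oplus>\<^bsub>M\<^esub> b) = \<phi> a \<oplus>\<^bsub>M'\<^esub> \<phi> b" if "a \<in> A" "b \<in> B" for a b
    using that assms by (intro map_add) (auto dest: M.submodule_carrierD)
  note map = this
  show ?thesis
  proof (intro equalityI subsetI)
    fix y assume "y \<in> \<phi> ` (A <+>\<^bsub>M\<^esub> B)"
    then obtain a b where "a \<in> A" "b \<in> B" "y = \<phi> (a \<oplus>\<^bsub>M\<^esub> b)"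
      by (auto simp: M.set_add_iff)
    then show "y \<in> \<phi> ` A <+>\<^bsub>M'\<^esub> \<phi> ` B"
      unfolding M'.set_add_iff using map by blast
  next
    fix y assume "y \<in> \<phi> ` A <+>\<^bsub>M'\<^esub> \<phi> ` B"
    then obtain a b where "a \<in> A" "b \<in> B" "y = \<phi> a \<oplus>\<^bsub>M'\<^esub> \<phi> b"
      by (auto simp: M'.set_add_iff)
    then have "a \<oplus>\<^bsub>M\<^esub> b \<in> A <+>\<^bsub>M\<^esub> B" "y = \<phi> (a \<oplus>\<^bsub>M\<^esub> b)"
      unfolding M.set_add_iff using map[of a b] by auto
    then show "y \<in> \<phi> ` (A <+>\<^bsub>M\<^esub> B)" by (rule rev_image_eqI)
  qed
qed

lemma vimage_image:
  assumes A: "submodule A R M"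
  shows "{x \<in> carrier M. \<phi> x \<in> \<phi> ` A} = A <+>\<^bsub>M\<^esub> ker"
proof (intro equalityI subsetI)
  note carr = M.submodule_carrierD[OF A]
  fix x assume "x \<in> {x \<in> carrier M. \<phi> x \<in> \<phi> ` A}"
  then obtain a where a: "a \<in> A" "x \<in> carrier M" "\<phi> x = \<phi> a" by auto
  have "\<phi> (x \<ominus>\<^bsub>M\<^esub> a) = \<zero>\<^bsub>M'\<^esub>"
    using a carr[OF a(1)] by (simp add: a_minus_def map_add map_minus map_closed M'.r_neg)
  then have "x \<ominus>\<^bsub>M\<^esub> a \<in> ker" using a carr[OF a(1)] by (simp add: ker_def)
  moreover have "x = a \<oplus>\<^bsub>M\<^esub> (x \<ominus>\<^bsub>M\<^esub> a)"
    using a(2) carr[OF a(1)] by (simp add: a_minus_def M.a_lcomm[of a x] M.r_neg)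
  ultimately show "x \<in> A <+>\<^bsub>M\<^esub> ker" unfolding M.set_add_iff using a(1) by blast
next
  note carr = M.submodule_carrierD[OF A]
  fix x assume "x \<in> A <+>\<^bsub>M\<^esub> ker"
  then obtain a k where "a \<in> A" "k \<in> ker" "x = a \<oplus>\<^bsub>M\<^esub> k" by (auto simp: M.set_add_iff)
  then show "x \<in> {x \<in> carrier M. \<phi> x \<in> \<phi> ` A}"
    using carr by (auto simp: ker_def map_add map_closed)
qed

lemma image_add_ker:
  assumes A: "submodule A R M" shows "\<phi> ` (A <+>\<^bsub>M\<^esub> ker) = \<phi> ` A"
  unfolding vimage_image[OF A, symmetric] using M.submodule_carrierD[OF A] by auto

lemma image_vimage:
  assumes "S \<subseteq> \<phi> ` carrier M" shows "\<phi> ` {x \<in> carrier M. \<phi> x \<in> S} = S"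
  using assms by auto

lemma image_ideal_smult:
  assumes I: "ideal I R" and H: "submodule H R M"
  shows "\<phi> ` ideal_smult M I H = ideal_smult M' I (\<phi> ` H)"
proof
  note carr = M.submodule_carrierD[OF H] M.ideal_carrierD[OF I]
  note IH = M.submodule_carrierD[OF M.submodule_ideal_smult[OF I H]]
  show "\<phi> ` ideal_smult M I H \<subseteq> ideal_smult M' I (\<phi> ` H)"
  proof safe
    fix y assume "y \<in> ideal_smult M I H"
    then show "\<phi> y \<in> ideal_smult M' I (\<phi> ` H)"
      by induction (auto simp: map_smult map_add carr IH intro: ideal_smult.intros)
  qed
  show "ideal_smult M' I (\<phi> ` H) \<subseteq> \<phi> ` ideal_smult M I H"
    unfolding M'.ideal_smult_subset_iff[OF submodule_image[OF M.submodule_ideal_smult[OF I H]]]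
    by (auto simp: carr simp flip: map_smult intro!: imageI ideal_smult.prod)
qed

text \<open>
  Images and preimages are mutually inverse between submodules of the image and submodules that
  contain the kernel.
\<close>

theorem sub_len_image:
  assumes A: "submodule A R M" and B: "submodule B R M" and sub: "B \<subseteq> A"
  shows "sub_len R M' (\<phi> ` B) (\<phi> ` A) = sub_len R M (B <+>\<^bsub>M\<^esub> ker) (A <+>\<^bsub>M\<^esub> ker)"
proof (rule antisym)
  show "sub_len R M' (\<phi> ` B) (\<phi> ` A) \<le> sub_len R M (B <+>\<^bsub>M\<^esub> ker) (A <+>\<^bsub>M\<^esub> ker)"
  proof (rule sub_len_le_map[where f = "\<lambda>S. {x \<in> carrier M. \<phi> x \<in> S}"])
    fix S assume "submodule S R M'" "\<phi> ` B \<subseteq> S" "S \<subseteq> \<phi> ` A"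
    then show "submodule {x \<in> carrier M. \<phi> x \<in> S} R M \<and>
        B <+>\<^bsub>M\<^esub> ker \<subseteq> {x \<in> carrier M. \<phi> x \<in> S} \<and> {x \<in> carrier M. \<phi> x \<in> S} \<subseteq> A <+>\<^bsub>M\<^esub> ker"
      unfolding vimage_image[OF A, symmetric] vimage_image[OF B, symmetric]
      using submodule_vimage by auto
  next
    fix S T assume *: "S \<subset> T" "T \<subseteq> \<phi> ` A"
    have "S \<subseteq> \<phi> ` carrier M" "T \<subseteq> \<phi> ` carrier M"
      using * M.submoduleE(1)[OF A] by auto
    then have "{x \<in> carrier M. \<phi> x \<in> S} \<noteq> {x \<in> carrier M. \<phi> x \<in> T}"
      using image_vimage *(1) by (metis order_less_irrefl)
    with *(1) show "{x \<in> carrier M. \<phi> x \<in> S} \<subset> {x \<in> carrier M. \<phi> x \<in> T}" by blast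
  qed
  show "sub_len R M (B <+>\<^bsub>M\<^esub> ker) (A <+>\<^bsub>M\<^esub> ker) \<le> sub_len R M' (\<phi> ` B) (\<phi> ` A)"
  proof (rule sub_len_le_map[where f = "\<lambda>S. \<phi> ` S"])
    fix S assume *: "submodule S R M" "B <+>\<^bsub>M\<^esub> ker \<subseteq> S" "S \<subseteq> A <+>\<^bsub>M\<^esub> ker"
    then have "\<phi> ` (B <+>\<^bsub>M\<^esub> ker) \<subseteq> \<phi> ` S" "\<phi> ` S \<subseteq> \<phi> ` (A <+>\<^bsub>M\<^esub> ker)"
      by (simp_all add: image_mono)
    with *(1) show "submodule (\<phi> ` S) R M' \<and> \<phi> ` B \<subseteq> \<phi> ` S \<and> \<phi> ` S \<subseteq> \<phi> ` A"
      by (simp add: image_add_ker A B submodule_image)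
  next
    fix S T assume *: "submodule S R M" "submodule T R M" "B <+>\<^bsub>M\<^esub> ker \<subseteq> S" "S \<subset> T"
    have "ker \<subseteq> S" using M.set_add_upper2[OF B submodule_ker] *(3) by blast
    then have pre: "{x \<in> carrier M. \<phi> x \<in> \<phi> ` S} = S" "{x \<in> carrier M. \<phi> x \<in> \<phi> ` T} = T"
      using vimage_image[OF *(1)] M.set_add_absorb[OF *(1) submodule_ker]
        vimage_image[OF *(2)] M.set_add_absorb[OF *(2) submodule_ker] *(4) by simp_all
    have "\<phi> ` S \<noteq> \<phi> ` T"
    proof
      assume eq: "\<phi> ` S = \<phi> ` T"
      have "S = {x \<in> carrier M. \<phi> x \<in> \<phi> ` S}" by (rule pre(1)[symmetric])
      also have "\<dots> = T" unfolding eq by (rule pre(2))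
      finally have "S = T" .
      with *(4) show False by blast
    qed
    moreover have "\<phi> ` S \<subseteq> \<phi> ` T" using *(4) by (intro image_mono) auto
    ultimately show "\<phi> ` S \<subset> \<phi> ` T" by (simp add: psubset_eq)
  qed
qed

lemma sub_len_image_Int:
  assumes A: "submodule A R M" and B: "submodule B R M" and sub: "B \<subseteq> A"
  shows "sub_len R M' (\<phi> ` B) (\<phi> ` A) = sub_len R M (B <+>\<^bsub>M\<^esub> (ker \<inter> A)) A"
  using sub_len_image[OF assms] M.sub_len_quotient_le(1)[OF A B submodule_ker sub] by simp

end


section \<open>Quotient modules\<close>

context module
begin

lemma submodule_abelian_subgroup: "submodule H R M \<Longrightarrow> abelian_subgroup H M"
  by (intro abelian_subgroupI3 additive_subgroup.intro submodule.axioms(1) M.abelian_group_axioms)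

text \<open>
  The union over representatives that defines scalar multiplication consists of a single coset.
\<close>

lemma quot_smult:
  assumes H: "submodule H R M" and a: "a \<in> carrier R" and x: "x \<in> carrier M"
  shows "a \<odot>\<^bsub>quot_module M H\<^esub> (H +>\<^bsub>M\<^esub> x) = H +>\<^bsub>M\<^esub> (a \<odot>\<^bsub>M\<^esub> x)"
proof -
  interpret H: abelian_subgroup H M by (rule submodule_abelian_subgroup[OF H])
  have const: "H +>\<^bsub>M\<^esub> (a \<odot>\<^bsub>M\<^esub> y) = H +>\<^bsub>M\<^esub> (a \<odot>\<^bsub>M\<^esub> x)" if y: "y \<in> H +>\<^bsub>M\<^esub> x" for y
  proof -
    obtain h where h: "h \<in> H" "y = h \<oplus>\<^bsub>M\<^esub> x" using y by (auto simp: a_r_coset_def')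
    then have "a \<odot>\<^bsub>M\<^esub> y = a \<odot>\<^bsub>M\<^esub> h \<oplus>\<^bsub>M\<^esub> a \<odot>\<^bsub>M\<^esub> x"
      using a x submodule_carrierD[OF H] by (simp add: smult_r_distr)
    then have "a \<odot>\<^bsub>M\<^esub> y \<in> H +>\<^bsub>M\<^esub> (a \<odot>\<^bsub>M\<^esub> x)"
      using submodule_closed(2)[OF H a h(1)] by (auto simp: a_r_coset_def')
    then show ?thesis
      using H.a_repr_independence'[of "a \<odot>\<^bsub>M\<^esub> y" "a \<odot>\<^bsub>M\<^esub> x"] smult_closed[OF a x] by simp
  qed
  have "(\<Union>y\<in>H +>\<^bsub>M\<^esub> x. H +>\<^bsub>M\<^esub> (a \<odot>\<^bsub>M\<^esub> y)) = H +>\<^bsub>M\<^esub> (a \<odot>\<^bsub>M\<^esub> x)"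
    by (rule UN_constant_eq[OF H.a_rcos_self[OF x]]) (intro ballI const)
  then show ?thesis by (simp add: quot_module_def)
qed

lemma quot_carrier: "carrier (quot_module M H) = (\<lambda>x. H +>\<^bsub>M\<^esub> x) ` carrier M"
  by (auto simp: quot_module_def A_RCOSETS_def')

lemma quot_add:
  assumes H: "submodule H R M" and "x \<in> carrier M" "y \<in> carrier M"
  shows "(H +>\<^bsub>M\<^esub> x) \<oplus>\<^bsub>quot_module M H\<^esub> (H +>\<^bsub>M\<^esub> y) = H +>\<^bsub>M\<^esub> (x \<oplus>\<^bsub>M\<^esub> y)"
  using abelian_subgroup.a_rcos_sum[OF submodule_abelian_subgroup[OF H]] assms(2,3)
  by (simp add: quot_module_def)

lemma module_quot:
  assumes H: "submodule H R M"
  shows "module R (quot_module M H)"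
proof (rule moduleI)
  interpret H: abelian_subgroup H M by (rule submodule_abelian_subgroup[OF H])
  show "cring R" by (rule R.is_cring)
  have zero: "\<zero>\<^bsub>quot_module M H\<^esub> = H +>\<^bsub>M\<^esub> \<zero>\<^bsub>M\<^esub>"
    using submoduleE(1)[OF H] by (simp add: quot_module_def)
  show "abelian_group (quot_module M H)"
  proof (rule abelian_groupI)
    fix X assume "X \<in> carrier (quot_module M H)"
    then obtain x where x: "x \<in> carrier M" "X = H +>\<^bsub>M\<^esub> x" by (auto simp: quot_carrier)
    then have "(H +>\<^bsub>M\<^esub> \<ominus>\<^bsub>M\<^esub> x) \<oplus>\<^bsub>quot_module M H\<^esub> X = \<zero>\<^bsub>quot_module M H\<^esub>"
      by (simp add: quot_add[OF H] zero M.l_neg)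
    with x show "\<exists>Y\<in>carrier (quot_module M H). Y \<oplus>\<^bsub>quot_module M H\<^esub> X = \<zero>\<^bsub>quot_module M H\<^esub>"
      by (intro bexI[of _ "H +>\<^bsub>M\<^esub> \<ominus>\<^bsub>M\<^esub> x"]) (auto simp: quot_carrier)
  qed (auto simp: quot_carrier quot_add[OF H] zero M.a_ac)
qed (auto simp: quot_carrier quot_smult[OF H] quot_add[OF H] smult_l_distr smult_r_distr smult_assoc1)

lemma quot_linear_map:
  assumes H: "submodule H R M"
  shows "linear_map R M (quot_module M H) (\<lambda>x. H +>\<^bsub>M\<^esub> x)"
  by (intro linear_map.intro linear_map_axioms.intro module_axioms module_quot[OF H])
    (auto simp: quot_carrier quot_smult[OF H] quot_add[OF H] module_axioms)

lemma quot_zero: "\<zero>\<^bsub>quot_module M H\<^esub> = H"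
  by (simp add: quot_module_def)

lemma quot_ker:
  assumes H: "submodule H R M"
  shows "linear_map.ker M (quot_module M H) (\<lambda>x. H +>\<^bsub>M\<^esub> x) = H"
proof -
  interpret H: abelian_subgroup H M by (rule submodule_abelian_subgroup[OF H])
  have "H +>\<^bsub>M\<^esub> x = H \<longleftrightarrow> x \<in> H" if "x \<in> carrier M" for x
    using that H.a_rcos_const H.a_rcos_self by blast
  then show ?thesis
    unfolding linear_map.ker_def[OF quot_linear_map[OF H]] quot_zero
    using submodule_carrierD[OF H] by blast
qed

lemma module_length_sub_len: "module_length R M = sub_len R M {\<zero>\<^bsub>M\<^esub>} (carrier M)"
proof -
  have "submodule_chain R M {\<zero>\<^bsub>M\<^esub>} (carrier M) n S \<longleftrightarrow>
      (\<forall>i\<le>n. submodule (S i) R M) \<and> (\<forall>i<n. S i \<subset> S (Suc i))" for n S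
    using submodule_zero[of "S _"] submoduleE(1)[of "S _"]
    unfolding submodule_chain_def by auto
  then show ?thesis by (simp add: module_length_def sub_len_def)
qed

lemma module_submodule: "submodule A R M \<Longrightarrow> module R (M\<lparr>carrier := A\<rparr>)"
  by (rule submodule.submodule_is_module) (auto intro: module_axioms)

lemma submodule_restrict:
  assumes A: "submodule A R M"
  shows "submodule S R (M\<lparr>carrier := A\<rparr>) \<longleftrightarrow> submodule S R M \<and> S \<subseteq> A"
proof -
  interpret A: module R "M\<lparr>carrier := A\<rparr>" by (rule module_submodule[OF A])
  have neg: "\<ominus>\<^bsub>M\<lparr>carrier := A\<rparr>\<^esub> x = \<ominus>\<^bsub>M\<^esub> x" if "x \<in> A" for x
  proof -
    have "\<ominus>\<^bsub>M\<lparr>carrier := A\<rparr>\<^esub> x \<in> A" "x \<oplus>\<^bsub>M\<^esub> \<ominus>\<^bsub>M\<lparr>carrier := A\<rparr>\<^esub> x = \<zero>\<^bsub>M\<^esub>"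
      using A.M.a_inv_closed[of x] A.M.r_neg[of x] that by simp_all
    then show ?thesis
      using submodule_carrierD[OF A] that by (metis M.minus_equality M.a_comm)
  qed
  show ?thesis
  proof safe
    assume S: "submodule S R (M\<lparr>carrier := A\<rparr>)"
    have SA: "S \<subseteq> A" using A.submoduleE(1)[OF S] by simp
    then show "x \<in> A" if "x \<in> S" for x using that by blast
    show "submodule S R M"
      using A.submodule_closed[OF S] SA submoduleE(1)[OF A]
      by (intro submoduleI) (auto simp: neg subset_iff)
  next
    assume S: "submodule S R M" "S \<subseteq> A"
    then show "submodule S R (M\<lparr>carrier := A\<rparr>)"
      using submodule_closed[OF S(1)] by (intro A.submoduleI) (auto simp: neg subset_iff)
  qed
qed

theorem module_length_quot:
  assumes H: "submodule H R M"
  shows "module_length R (quot_module M H) = sub_len R M H (carrier M)"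
proof -
  interpret Q: linear_map R M "quot_module M H" "\<lambda>x. H +>\<^bsub>M\<^esub> x" by (rule quot_linear_map[OF H])
  have "(\<lambda>x. H +>\<^bsub>M\<^esub> x) ` {\<zero>\<^bsub>M\<^esub>} = {\<zero>\<^bsub>quot_module M H\<^esub>}"
    using Q.map_zero by auto
  moreover have "{\<zero>\<^bsub>M\<^esub>} <+>\<^bsub>M\<^esub> H = H" "carrier M <+>\<^bsub>M\<^esub> H = carrier M"
    using set_add_absorb2[OF H zero_submodule] set_add_absorb[OF carrier_is_submodule H]
      submodule_zero[OF H] submoduleE(1)[OF H] by simp_all
  ultimately show ?thesis
    using Q.sub_len_image[OF carrier_is_submodule zero_submodule]
    by (simp add: Q.M'.module_length_sub_len quot_ker[OF H] quot_carrier)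
qed

theorem module_length_subquotient:
  assumes A: "submodule A R M" and B: "submodule B R M" and sub: "B \<subseteq> A"
  shows "module_length R (quot_module (M\<lparr>carrier := A\<rparr>) B) = sub_len R M B A"
proof -
  interpret A: module R "M\<lparr>carrier := A\<rparr>" by (rule module_submodule[OF A])
  have "submodule_chain R (M\<lparr>carrier := A\<rparr>) B A n S \<longleftrightarrow> submodule_chain R M B A n S" for n S
    by (auto simp: submodule_chain_def submodule_restrict[OF A])
  then have "sub_len R (M\<lparr>carrier := A\<rparr>) B A = sub_len R M B A"
    by (simp add: sub_len_def)
  then show ?thesis
    using A.module_length_quot[of B] submodule_restrict[OF A] B sub by simp
qed

end


section \<open>Noetherian modules\<close>

text \<open>
  Dependent choice would otherwise produce a strictly ascending sequence.
\<close>

lemma acc_imp_maximal: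
  assumes acc: "\<And>S :: nat \<Rightarrow> 'x set. (\<And>i. P (S i)) \<Longrightarrow> (\<And>i. S i \<subseteq> S (Suc i)) \<Longrightarrow> \<exists>n. \<forall>m\<ge>n. S m = S n"
    and A\<^sub>0: "A\<^sub>0 \<in> \<S>" and P: "\<And>A. A \<in> \<S> \<Longrightarrow> P A"
  obtains A where "A \<in> \<S>" "\<And>B. B \<in> \<S> \<Longrightarrow> A \<subseteq> B \<Longrightarrow> B = A"
proof (rule ccontr)
  assume "\<not> thesis"
  then have "\<forall>A\<in>\<S>. \<exists>B. B \<in> \<S> \<and> A \<subset> B"
    using that by blast
  then obtain f where f: "\<And>A. A \<in> \<S> \<Longrightarrow> f A \<in> \<S> \<and> A \<subset> f A"
    by metis
  define S where "S = rec_nat A\<^sub>0 (\<lambda>_. f)"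
  have S: "S i \<in> \<S>" for i
    by (induction i) (simp_all add: S_def A\<^sub>0 f)
  have step: "S i \<subset> S (Suc i)" for i
    using f[OF S[of i]] by (simp add: S_def)
  obtain n where "\<And>m. m \<ge> n \<Longrightarrow> S m = S n"
    using acc[of S] P[OF S] step by blast
  from this[of "Suc n"] step[of n] show False by simp
qed

lemma (in noetherian_ring) ideal_acc:
  assumes I: "\<And>i::nat. ideal (I i) R" and mono: "\<And>i. I i \<subseteq> I (Suc i)"
  shows "\<exists>n. \<forall>m\<ge>n. I m = I n"
proof -
  have le: "I i \<subseteq> I j" if "i \<le> j" for i j
    using mono that by (rule lift_Suc_mono_le)
  have "subset.chain {J. ideal J R} (range I)"
    unfolding subset_chain_def using I le by (auto, metis linear subsetD)
  then have "\<Union>(range I) \<in> range I"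
    by (intro ideal_chain_is_trivial) auto
  then obtain n where "\<Union>(range I) = I n" by blast
  then have "I m \<subseteq> I n" for m by blast
  with le show ?thesis by blast
qed

locale noetherian_module = module R M + noetherian_ring R for R (structure) and M (structure) +
  assumes acc: "(\<And>i::nat. submodule (S i) R M) \<Longrightarrow> (\<And>i. S i \<subseteq> S (Suc i)) \<Longrightarrow>
    \<exists>n. \<forall>m\<ge>n. S m = S n"

lemma (in noetherian_module) maximal_submodule:
  assumes "A\<^sub>0 \<in> \<S>" "\<And>A. A \<in> \<S> \<Longrightarrow> submodule A R M"
  obtains A where "A \<in> \<S>" "\<And>B. B \<in> \<S> \<Longrightarrow> A \<subseteq> B \<Longrightarrow> B = A"
  using acc_imp_maximal[of "\<lambda>A. submodule A R M", OF acc assms] by blast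

definition cyclic :: "('a, 'r) ring_scheme \<Rightarrow> ('a, 'b, 'm) module_scheme \<Rightarrow> 'b \<Rightarrow> 'b set" where
  "cyclic R M z = (\<lambda>r. r \<odot>\<^bsub>M\<^esub> z) ` carrier R"

context module
begin

lemma submodule_cyclic:
  assumes z: "z \<in> carrier M" shows "submodule (cyclic R M z) R M"
proof (rule submoduleI)
  show "cyclic R M z \<subseteq> carrier M" using z by (auto simp: cyclic_def)
  show "\<zero>\<^bsub>M\<^esub> \<in> cyclic R M z"
    unfolding cyclic_def using z by (intro image_eqI[of _ _ "\<zero>\<^bsub>R\<^esub>"]) auto
  show "\<ominus>\<^bsub>M\<^esub> a \<in> cyclic R M z" if "a \<in> cyclic R M z" for a
    using that z by (auto simp: cyclic_def simp flip: smult_l_minus)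
  show "a \<oplus>\<^bsub>M\<^esub> b \<in> cyclic R M z" if "a \<in> cyclic R M z" "b \<in> cyclic R M z" for a b
    using that z by (auto simp: cyclic_def simp flip: smult_l_distr)
  show "r \<odot>\<^bsub>M\<^esub> a \<in> cyclic R M z" if "r \<in> carrier R" "a \<in> cyclic R M z" for r a
    using that z by (auto simp: cyclic_def simp flip: smult_assoc1)
qed

lemma cyclic_self: "z \<in> carrier M \<Longrightarrow> z \<in> cyclic R M z"
  unfolding cyclic_def by (rule image_eqI[of _ _ "\<one>\<^bsub>R\<^esub>"]) auto

lemma cyclic_subset_iff:
  assumes "submodule K R M" "z \<in> carrier M"
  shows "cyclic R M z \<subseteq> K \<longleftrightarrow> z \<in> K"
  using cyclic_self[OF assms(2)] submodule_closed(2)[OF assms(1)] by (auto simp: cyclic_def)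

definition span_of :: "'c set \<Rightarrow> 'c set" where
  "span_of A = \<Inter>{H. submodule H R M \<and> A \<subseteq> H}"

lemma submodule_span_of:
  assumes "A \<subseteq> carrier M" shows "submodule (span_of A) R M"
proof (rule submoduleI)
  show "span_of A \<subseteq> carrier M"
    unfolding span_of_def using assms carrier_is_submodule by blast
qed (auto simp: span_of_def submodule_closed)

lemma span_of_upper: "A \<subseteq> span_of A"
  by (auto simp: span_of_def)

lemma span_of_least: "submodule H R M \<Longrightarrow> A \<subseteq> H \<Longrightarrow> span_of A \<subseteq> H"
  by (auto simp: span_of_def)

text \<open>
  Induction on the generators. For a new generator \<open>a\<close>, the coefficients of \<open>a\<close> that occur in
  \<open>L i\<close> modulo the span of \<open>A\<close> form an ascending sequence of ideals; once it has stabilised, the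
  multiple of \<open>a\<close> in an element of a later \<open>L m\<close> can be removed within \<open>L n\<close>.
\<close>

lemma span_of_acc:
  assumes R: "noetherian_ring R" and "finite A" "A \<subseteq> carrier M"
    and L: "\<And>i::nat. submodule (L i) R M" and mono: "\<And>i. L i \<subseteq> L (Suc i)"
  shows "\<exists>n. \<forall>m\<ge>n. L m \<inter> span_of A \<subseteq> L n"
  using assms(2,3)
proof (induction A)
  case empty
  have "span_of {} \<subseteq> {\<zero>\<^bsub>M\<^esub>}" by (rule span_of_least[OF zero_submodule]) simp
  then show ?case using submodule_zero[OF L] by blast
next
  case (insert a A)
  then have a: "a \<in> carrier M" and A: "A \<subseteq> carrier M" by auto
  have le: "L i \<subseteq> L j" if "i \<le> j" for i j
    using mono that by (rule lift_Suc_mono_le)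
  note SA = submodule_span_of[OF A] and Ra = submodule_cyclic[OF a]
  note SL = submodule_set_add[OF SA L]
  let ?I = "\<lambda>i. residual R M (span_of A <+>\<^bsub>M\<^esub> L i) {a}"
  have "?I i \<subseteq> ?I (Suc i)" for i
    using set_add_mono[OF order_refl mono[of i], of "span_of A"] by (auto simp: residual_def)
  moreover have "ideal (?I i) R" for i
    using a by (intro residual_ideal SL) auto
  ultimately obtain n\<^sub>1 where n1: "\<And>m. m \<ge> n\<^sub>1 \<Longrightarrow> ?I m = ?I n\<^sub>1"
    using noetherian_ring.ideal_acc[OF R, of ?I] by blast
  obtain n\<^sub>2 where n2: "\<And>m. m \<ge> n\<^sub>2 \<Longrightarrow> L m \<inter> span_of A \<subseteq> L n\<^sub>2"
    using insert.IH[OF A] by blast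
  define n where "n = max n\<^sub>1 n\<^sub>2"
  have "L m \<inter> span_of (insert a A) \<subseteq> L n" if "m \<ge> n" for m
  proof
    fix x assume x: "x \<in> L m \<inter> span_of (insert a A)"
    have "insert a A \<subseteq> cyclic R M a <+>\<^bsub>M\<^esub> span_of A"
      using set_add_upper1[OF Ra SA] set_add_upper2[OF Ra SA] cyclic_self[OF a] span_of_upper[of A]
      by blast
    then have "x \<in> cyclic R M a <+>\<^bsub>M\<^esub> span_of A"
      using span_of_least[OF submodule_set_add[OF Ra SA]] x by blast
    then obtain r w where rw: "r \<in> carrier R" "w \<in> span_of A" "x = r \<odot>\<^bsub>M\<^esub> a \<oplus>\<^bsub>M\<^esub> w"
      by (auto simp: set_add_iff cyclic_def)
    have carr: "w \<in> carrier M" "r \<odot>\<^bsub>M\<^esub> a \<in> carrier M" "x \<in> carrier M"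
      using rw a submodule_carrierD[OF SA] by auto
    then have "r \<odot>\<^bsub>M\<^esub> a = \<ominus>\<^bsub>M\<^esub> w \<oplus>\<^bsub>M\<^esub> x"
      unfolding rw(3) by (simp add: M.a_lcomm[of "\<ominus>\<^bsub>M\<^esub> w"] M.l_neg)
    then have "r \<odot>\<^bsub>M\<^esub> a \<in> span_of A <+>\<^bsub>M\<^esub> L m"
      unfolding set_add_iff using submodule_closed(1)[OF SA rw(2)] x by blast
    then have "r \<in> ?I m" using rw(1) by (simp add: residual_def)
    then have "r \<in> ?I n" using n1[of m] n1[of n] that by (simp add: n_def)
    then obtain w' l where wl: "w' \<in> span_of A" "l \<in> L n" "r \<odot>\<^bsub>M\<^esub> a = w' \<oplus>\<^bsub>M\<^esub> l"
      by (auto simp: residual_def set_add_iff)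
    have carr': "w' \<in> carrier M" "l \<in> carrier M"
      using wl submodule_carrierD[OF SA] submodule_carrierD[OF L] by auto
    have xl: "x \<ominus>\<^bsub>M\<^esub> l = w' \<oplus>\<^bsub>M\<^esub> w"
    proof -
      have "x = (w' \<oplus>\<^bsub>M\<^esub> w) \<oplus>\<^bsub>M\<^esub> l"
        unfolding rw(3) wl(3) using carr(1) carr' by (simp add: M.a_ac)
      then show ?thesis using carr(1) carr' by (simp add: a_minus_def M.a_assoc M.r_neg)
    qed
    have "x \<ominus>\<^bsub>M\<^esub> l \<in> L m"
      using x le[OF that] wl(2) submodule_closed(5)[OF L] by blast
    moreover have "x \<ominus>\<^bsub>M\<^esub> l \<in> span_of A"
      unfolding xl by (rule submodule_closed(3)[OF SA wl(1) rw(2)])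
    ultimately have "x \<ominus>\<^bsub>M\<^esub> l \<in> L n\<^sub>2"
      using n2[of m] that by (auto simp: n_def)
    then have "(x \<ominus>\<^bsub>M\<^esub> l) \<oplus>\<^bsub>M\<^esub> l \<in> L n"
      using le[of n\<^sub>2 n] wl(2) submodule_closed(3)[OF L] by (auto simp: n_def)
    then show "x \<in> L n" using carr carr' by (simp add: a_minus_def M.a_assoc M.l_neg)
  qed
  then show ?case by blast
qed

end

theorem fin_gen_imp_noetherian_module:
  assumes R: "noetherian_ring R" and fg: "fin_gen_module R M"
  shows "noetherian_module R M"
proof -
  interpret module R M using fg by (simp add: fin_gen_module_def)
  obtain A where A: "finite A" "A \<subseteq> carrier M" "span_of A = carrier M"
    using fg by (auto simp: fin_gen_module_def span_of_def)
  show ?thesis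
  proof (intro noetherian_module.intro module_axioms R noetherian_module_axioms.intro)
    fix L :: "nat \<Rightarrow> _" assume L: "\<And>i. submodule (L i) R M" "\<And>i. L i \<subseteq> L (Suc i)"
    obtain n where n: "\<And>m. m \<ge> n \<Longrightarrow> L m \<inter> span_of A \<subseteq> L n"
      using span_of_acc[of A L, OF R A(1,2) L] by blast
    have "L m = L n" if "m \<ge> n" for m
      using n[OF that] submoduleE(1)[OF L(1)] lift_Suc_mono_le[of L, OF L(2) that]
      by (auto simp: A(3))
    then show "\<exists>n. \<forall>m\<ge>n. L m = L n" by blast
  qed
qed

lemma (in noetherian_module) noetherian_module_quot:
  assumes H: "submodule H R M"
  shows "noetherian_module R (quot_module M H)"
proof (intro noetherian_module.intro module_quot[OF H] noetherian_ring_axioms noetherian_module_axioms.intro)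
  interpret Q: linear_map R M "quot_module M H" "\<lambda>x. H +>\<^bsub>M\<^esub> x" by (rule quot_linear_map[OF H])
  fix L :: "nat \<Rightarrow> _" assume L: "\<And>i. submodule (L i) R (quot_module M H)" "\<And>i. L i \<subseteq> L (Suc i)"
  let ?L = "\<lambda>i. {x \<in> carrier M. H +>\<^bsub>M\<^esub> x \<in> L i}"
  have "?L i \<subseteq> ?L (Suc i)" for i using L(2) by blast
  then obtain n where n: "\<And>m. m \<ge> n \<Longrightarrow> ?L m = ?L n"
    using acc[of ?L] Q.submodule_vimage[OF L(1)] by blast
  have img: "(\<lambda>x. H +>\<^bsub>M\<^esub> x) ` ?L i = L i" for i
    using Q.M'.submoduleE(1)[OF L(1)] by (intro Q.image_vimage) (simp add: quot_carrier)
  have "L m = L n" if "m \<ge> n" for m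
    using img[of m] img[of n] n[OF that] by metis
  then show "\<exists>n. \<forall>m\<ge>n. L m = L n" by blast
qed


section \<open>Associated primes\<close>

context noetherian_module
begin

text \<open>
  An ideal that is maximal among the ideals \<open>K : z\<close> contained in \<open>P\<close> is prime. If \<open>a b z \<in> K\<close>,
  compare with \<open>K : a z\<close>. Should this not lie in \<open>P\<close>, it contains some \<open>c \<notin> P\<close>, and \<open>K : c z\<close>,
  which contains \<open>a\<close>, still lies in \<open>P\<close> because \<open>P\<close> is prime.
\<close>

lemma prime_residual_below:
  assumes K: "submodule K R M" and A: "submodule A R M" and P: "primeideal P R"
    and z\<^sub>0: "z\<^sub>0 \<in> A" "residual R M K {z\<^sub>0} \<subseteq> P"
  obtains z where "z \<in> A" "primeideal (residual R M K {z}) R" "residual R M K {z} \<subseteq> P"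
proof -
  interpret P: primeideal P R by (rule P)
  note carr = submodule_carrierD[OF A]
  let ?r = "\<lambda>z. residual R M K {z}"
  have id: "ideal (?r z) R" if "z \<in> A" for z
    using that carr by (intro residual_ideal K) auto
  obtain Q where Q: "Q \<in> {?r z | z. z \<in> A \<and> ?r z \<subseteq> P}"
      and max: "\<And>B. B \<in> {?r z | z. z \<in> A \<and> ?r z \<subseteq> P} \<Longrightarrow> Q \<subseteq> B \<Longrightarrow> B = Q"
  proof (rule acc_imp_maximal[of "\<lambda>I. ideal I R" "?r z\<^sub>0" "{?r z | z. z \<in> A \<and> ?r z \<subseteq> P}"])
    show "\<exists>n. \<forall>m\<ge>n. S m = S n" if "\<And>i. ideal (S i) R" "\<And>i. S i \<subseteq> S (Suc i)" for S :: "nat \<Rightarrow> _"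
      using ideal_acc that by blast
    show "?r z\<^sub>0 \<in> {?r z | z. z \<in> A \<and> ?r z \<subseteq> P}" using z\<^sub>0 by blast
    show "ideal B R" if "B \<in> {?r z | z. z \<in> A \<and> ?r z \<subseteq> P}" for B using that id by blast
  qed blast
  then obtain z where z: "z \<in> A" "Q = ?r z" "?r z \<subseteq> P" by blast
  have "primeideal (?r z) R"
  proof (rule primeidealI[OF id[OF z(1)] R.is_cring])
    show "carrier R \<noteq> ?r z"
      using z(3) P.I_notcarr P.a_subset by blast
    fix a b assume ab: "a \<in> carrier R" "b \<in> carrier R" "a \<otimes> b \<in> ?r z"
    show "a \<in> ?r z \<or> b \<in> ?r z"
    proof (rule ccontr)
      assume neither: "\<not> (a \<in> ?r z \<or> b \<in> ?r z)"
      have az: "a \<odot>\<^bsub>M\<^esub> z \<in> A" using ab(1) z(1) A submodule_closed(2) by blast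
      have sub: "?r z \<subseteq> ?r (a \<odot>\<^bsub>M\<^esub> z)"
      proof
        fix r assume "r \<in> ?r z"
        then have r: "r \<in> carrier R" "r \<odot>\<^bsub>M\<^esub> z \<in> K" by (auto simp: residual_def)
        then have "a \<odot>\<^bsub>M\<^esub> (r \<odot>\<^bsub>M\<^esub> z) \<in> K" using ab(1) K submodule_closed(2) by blast
        then have "r \<odot>\<^bsub>M\<^esub> (a \<odot>\<^bsub>M\<^esub> z) \<in> K"
          using r(1) ab(1) carr[OF z(1)] R.m_comm[of a r] by (simp flip: smult_assoc1)
        then show "r \<in> ?r (a \<odot>\<^bsub>M\<^esub> z)" using r by (simp add: residual_def)
      qed
      have b: "b \<in> ?r (a \<odot>\<^bsub>M\<^esub> z)"
        using ab carr[OF z(1)] R.m_comm[of a b] by (simp add: residual_def smult_assoc1[symmetric])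
      show False
      proof (cases "?r (a \<odot>\<^bsub>M\<^esub> z) \<subseteq> P")
        case True
        then have "?r (a \<odot>\<^bsub>M\<^esub> z) = Q" using az sub z(2) by (intro max) auto
        with b neither z(2) show False by simp
      next
        case False
        then obtain c where c: "c \<in> carrier R" "c \<odot>\<^bsub>M\<^esub> (a \<odot>\<^bsub>M\<^esub> z) \<in> K" "c \<notin> P"
          by (auto simp: residual_def)
        have cz: "c \<odot>\<^bsub>M\<^esub> z \<in> A" using c(1) z(1) A submodule_closed(2) by blast
        have "?r z \<subseteq> ?r (c \<odot>\<^bsub>M\<^esub> z)"
        proof
          fix r assume "r \<in> ?r z"
          then have r: "r \<in> carrier R" "r \<odot>\<^bsub>M\<^esub> z \<in> K" by (auto simp: residual_def)
          then have "c \<odot>\<^bsub>M\<^esub> (r \<odot>\<^bsub>M\<^esub> z) \<in> K" using c(1) K submodule_closed(2) by blast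
          then have "r \<odot>\<^bsub>M\<^esub> (c \<odot>\<^bsub>M\<^esub> z) \<in> K"
            using r(1) c(1) carr[OF z(1)] R.m_comm[of c r] by (simp flip: smult_assoc1)
          then show "r \<in> ?r (c \<odot>\<^bsub>M\<^esub> z)" using r by (simp add: residual_def)
        qed
        moreover have "?r (c \<odot>\<^bsub>M\<^esub> z) \<subseteq> P"
        proof
          fix r assume "r \<in> ?r (c \<odot>\<^bsub>M\<^esub> z)"
          then have r: "r \<in> carrier R" "(r \<otimes> c) \<odot>\<^bsub>M\<^esub> z \<in> K"
            using c(1) carr[OF z(1)] by (auto simp: residual_def smult_assoc1)
          then have "r \<otimes> c \<in> ?r z" using c(1) by (simp add: residual_def)
          with z(3) have "r \<otimes> c \<in> P" by blast
          with c r show "r \<in> P" using P.I_prime by blast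
        qed
        ultimately have "?r (c \<odot>\<^bsub>M\<^esub> z) = Q" using cz z(2) by (intro max) auto
        moreover have "a \<in> ?r (c \<odot>\<^bsub>M\<^esub> z)"
          using c ab(1) carr[OF z(1)] R.m_comm[of a c]
          by (simp add: residual_def smult_assoc1[symmetric])
        ultimately show False using neither z(2) by simp
      qed
    qed
  qed
  with z that show thesis by blast
qed

text \<open>
  Submodules whose annihilator is not contained in \<open>P\<close> are closed under adding a cyclic submodule
  with the same property, as a product of two elements outside \<open>P\<close> is outside \<open>P\<close>.
\<close>

lemma residual_of_element_below_prime:
  assumes A: "submodule A R M" and P: "primeideal P R"
    and ann: "residual R M {\<zero>\<^bsub>M\<^esub>} A \<subseteq> P"
  obtains z where "z \<in> A" "residual R M {\<zero>\<^bsub>M\<^esub>} {z} \<subseteq> P"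
proof (rule ccontr)
  assume "\<not> thesis"
  then have no: "\<not> residual R M {\<zero>\<^bsub>M\<^esub>} {z} \<subseteq> P" if "z \<in> A" for z
    using that \<open>\<And>z. z \<in> A \<Longrightarrow> _ z \<Longrightarrow> thesis\<close> by blast
  interpret P: primeideal P R by (rule P)
  let ?ann = "residual R M {\<zero>\<^bsub>M\<^esub>}"
  let ?S = "{K. submodule K R M \<and> K \<subseteq> A \<and> \<not> ?ann K \<subseteq> P}"
  have one: "\<one> \<notin> P" using P.one_imp_carrier P.I_notcarr by metis
  have "\<one> \<in> ?ann {\<zero>\<^bsub>M\<^esub>}" by (simp add: residual_def)
  then have zero: "{\<zero>\<^bsub>M\<^esub>} \<in> ?S"
    using one zero_submodule submodule_zero[OF A] by blast
  obtain K where K: "K \<in> ?S" and max: "\<And>B. B \<in> ?S \<Longrightarrow> K \<subseteq> B \<Longrightarrow> B = K"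
    using maximal_submodule[OF zero] by blast
  then have K': "submodule K R M" "K \<subseteq> A" by auto
  obtain c where c: "c \<in> ?ann K" "c \<notin> P" using K by blast
  have "A \<subseteq> K"
  proof
    fix z assume z: "z \<in> A"
    then have zc: "z \<in> carrier M" by (rule submodule_carrierD[OF A])
    obtain b where b: "b \<in> ?ann {z}" "b \<notin> P" using no[OF z] by blast
    have bc: "b \<in> carrier R" "c \<in> carrier R" using b c by (auto simp: residual_def)
    note Kz = submodule_set_add[OF K'(1) submodule_cyclic[OF zc]]
    have "(b \<otimes> c) \<odot>\<^bsub>M\<^esub> x = \<zero>\<^bsub>M\<^esub>" if "x \<in> K <+>\<^bsub>M\<^esub> cyclic R M z" for x
    proof -
      obtain k r where x: "k \<in> K" "r \<in> carrier R" "x = k \<oplus>\<^bsub>M\<^esub> r \<odot>\<^bsub>M\<^esub> z"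
        using \<open>x \<in> _\<close> by (auto simp: set_add_iff cyclic_def)
      have "c \<odot>\<^bsub>M\<^esub> k = \<zero>\<^bsub>M\<^esub>" "b \<odot>\<^bsub>M\<^esub> z = \<zero>\<^bsub>M\<^esub>" "k \<in> carrier M"
        using c b x(1) submodule_carrierD[OF K'(1)] by (auto simp: residual_def)
      moreover have "(b \<otimes> c) \<odot>\<^bsub>M\<^esub> (r \<odot>\<^bsub>M\<^esub> z) = (c \<otimes> r) \<odot>\<^bsub>M\<^esub> (b \<odot>\<^bsub>M\<^esub> z)"
        using bc x(2) zc by (simp add: R.m_ac flip: smult_assoc1)
      ultimately show ?thesis
        using bc x(2) zc by (simp add: x(3) smult_r_distr smult_assoc1[of b c k])
    qed
    then have "b \<otimes> c \<in> ?ann (K <+>\<^bsub>M\<^esub> cyclic R M z)" using bc by (simp add: residual_def)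
    moreover have "b \<otimes> c \<notin> P" using b c bc P.I_prime by blast
    moreover have "K <+>\<^bsub>M\<^esub> cyclic R M z \<subseteq> A"
      using K'(2) cyclic_subset_iff[OF A zc] z by (intro set_add_least A) auto
    ultimately have "K <+>\<^bsub>M\<^esub> cyclic R M z = K"
      using Kz set_add_upper1[OF K'(1) submodule_cyclic[OF zc]] by (intro max) auto
    then show "z \<in> K"
      using set_add_upper2[OF K'(1) submodule_cyclic[OF zc]] cyclic_self[OF zc] by blast
  qed
  with K'(2) c ann show False by auto
qed

end


section \<open>Modules over a Noetherian local ring\<close>

locale local_noetherian_module = noetherian_module R M
  for R (structure) and M (structure) and \<nn> +
  assumes local: "local_ring R \<nn>"
begin

lemma max_ideal: "ideal \<nn> R" "\<one> \<notin> \<nn>"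
proof -
  interpret maximalideal \<nn> R using local by (simp add: local_ring_def)
  show "ideal \<nn> R" by (rule ideal_axioms)
  show "\<one> \<notin> \<nn>" using one_imp_carrier I_notcarr by metis
qed

text \<open>
  Ideals that contain \<open>r\<close> but not \<open>1\<close> have maximal members, and these are maximal ideals.
\<close>

lemma not_in_max_ideal_imp_unit:
  assumes r: "r \<in> carrier R" "r \<notin> \<nn>"
  obtains s where "s \<in> carrier R" "s \<otimes> r = \<one>"
proof -
  have "PIdl r = carrier R"
  proof (rule ccontr)
    assume ne: "PIdl r \<noteq> carrier R"
    let ?S = "{I. ideal I R \<and> r \<in> I \<and> I \<noteq> carrier R}"
    have "PIdl r \<in> ?S" using r ne cgenideal_self R.cgenideal_ideal by blast
    then obtain I where I: "I \<in> ?S" and max: "\<And>B. B \<in> ?S \<Longrightarrow> I \<subseteq> B \<Longrightarrow> B = I"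
      using acc_imp_maximal[of "\<lambda>I. ideal I R" "PIdl r" ?S] ideal_acc by blast
    have "maximalideal I R"
    proof (rule maximalidealI)
      show "ideal I R" "carrier R \<noteq> I" using I by auto
      show "B = I \<or> B = carrier R" if "ideal B R" "I \<subseteq> B" "B \<subseteq> carrier R" for B
        using that I max[of B] by blast
    qed
    then have "I = \<nn>" using local by (simp add: local_ring_def)
    with I r show False by blast
  qed
  then have "\<one> \<in> PIdl r" by simp
  with that show thesis by (auto simp: cgenideal_def)
qed

lemma proper_ideal_le:
  assumes I: "ideal I R" "\<one> \<notin> I" shows "I \<subseteq> \<nn>"
proof (rule ccontr)
  assume "\<not> I \<subseteq> \<nn>"
  then obtain r where r: "r \<in> I" "r \<notin> \<nn>" by blast
  moreover have "r \<in> carrier R" using r(1) I(1) by (rule ideal_carrierD[rotated])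
  ultimately obtain s where "s \<in> carrier R" "s \<otimes> r = \<one>" using not_in_max_ideal_imp_unit by blast
  with ideal.I_l_closed[OF I(1) r(1)] I(2) show False by metis
qed

lemma prime_le: "primeideal P R \<Longrightarrow> P \<subseteq> \<nn>"
  using primeideal.I_notcarr[of P R] ideal.one_imp_carrier[of P R]
  by (intro proper_ideal_le) (auto simp: primeideal_def)

lemma prime_max_ideal: "primeideal \<nn> R"
  using local R.maximalideal_prime by (simp add: local_ring_def)

text \<open>
  If \<open>A \<subseteq> L\<close> fails, take \<open>K\<close> maximal among the submodules with \<open>L \<subseteq> K \<subset> A + L\<close>. Then \<open>J A \<subseteq> K\<close>: if
  \<open>j x \<notin> K\<close>, then \<open>x = k + r j x\<close> with \<open>k \<in> K\<close>, and \<open>1 - r j\<close> is a unit. So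
  \<open>A \<subseteq> J A + L \<subseteq> K\<close>.
\<close>

theorem nakayama:
  assumes J: "ideal J R" "J \<subseteq> \<nn>" and A: "submodule A R M" and L: "submodule L R M"
    and sub: "A \<subseteq> ideal_smult M J A <+>\<^bsub>M\<^esub> L"
  shows "A \<subseteq> L"
proof (rule ccontr)
  assume "\<not> A \<subseteq> L"
  note AL = submodule_set_add[OF A L]
  let ?S = "{K. submodule K R M \<and> L \<subseteq> K \<and> K \<subset> A <+>\<^bsub>M\<^esub> L}"
  have "L \<in> ?S"
    using L set_add_upper1[OF A L] set_add_upper2[OF A L] \<open>\<not> A \<subseteq> L\<close> by blast
  then obtain K where K: "K \<in> ?S" and max: "\<And>B. B \<in> ?S \<Longrightarrow> K \<subseteq> B \<Longrightarrow> B = K"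
    using maximal_submodule[of L ?S] by blast
  then have K': "submodule K R M" "L \<subseteq> K" "K \<subset> A <+>\<^bsub>M\<^esub> L" by auto
  have "j \<odot>\<^bsub>M\<^esub> x \<in> K" if j: "j \<in> J" and x: "x \<in> A" for j x
  proof (rule ccontr)
    assume notin: "j \<odot>\<^bsub>M\<^esub> x \<notin> K"
    have jR: "j \<in> carrier R" using j J(1) by (rule ideal_carrierD[rotated])
    have xM: "x \<in> carrier M" using x by (rule submodule_carrierD[OF A])
    let ?y = "j \<odot>\<^bsub>M\<^esub> x"
    have yM: "?y \<in> carrier M" using jR xM by simp
    note Ry = submodule_cyclic[OF yM]
    have "cyclic R M ?y \<subseteq> A <+>\<^bsub>M\<^esub> L"
      using set_add_upper1[OF A L] submodule_closed(2)[OF A jR x]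
      unfolding cyclic_subset_iff[OF AL yM] by blast
    then have "K <+>\<^bsub>M\<^esub> cyclic R M ?y \<subseteq> A <+>\<^bsub>M\<^esub> L"
      using K'(3) by (intro set_add_least AL) auto
    moreover have "K <+>\<^bsub>M\<^esub> cyclic R M ?y \<noteq> K"
      using set_add_upper2[OF K'(1) Ry] cyclic_self[OF yM] notin by blast
    ultimately have "K <+>\<^bsub>M\<^esub> cyclic R M ?y = A <+>\<^bsub>M\<^esub> L"
      using max[of "K <+>\<^bsub>M\<^esub> cyclic R M ?y"] submodule_set_add[OF K'(1) Ry]
        set_add_upper1[OF K'(1) Ry] K'(2) by blast
    then have "x \<in> K <+>\<^bsub>M\<^esub> cyclic R M ?y"
      using set_add_upper1[OF A L] x by blast
    then obtain k r where kr: "k \<in> K" "r \<in> carrier R" "x = k \<oplus>\<^bsub>M\<^esub> r \<odot>\<^bsub>M\<^esub> ?y"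
      by (auto simp: set_add_iff cyclic_def)
    have kM: "k \<in> carrier M" using kr(1) by (rule submodule_carrierD[OF K'(1)])
    have rj: "r \<otimes> j \<in> \<nn>" using ideal.I_l_closed[OF max_ideal(1), of j r] j J(2) kr(2) by blast
    have "\<one> \<ominus> r \<otimes> j \<notin> \<nn>"
    proof
      assume "\<one> \<ominus> r \<otimes> j \<in> \<nn>"
      then have "(\<one> \<ominus> r \<otimes> j) \<oplus> r \<otimes> j \<in> \<nn>"
        using rj max_ideal(1) by (simp add: ideal_def additive_subgroup.a_closed)
      then show False
        using max_ideal(2) jR kr(2) by (simp add: R.minus_eq R.a_assoc R.l_neg)
    qed
    then obtain s where s: "s \<in> carrier R" "s \<otimes> (\<one> \<ominus> r \<otimes> j) = \<one>"
      using not_in_max_ideal_imp_unit[of "\<one> \<ominus> r \<otimes> j"] jR kr(2) by blast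
    have "(\<one> \<ominus> r \<otimes> j) \<odot>\<^bsub>M\<^esub> x = x \<ominus>\<^bsub>M\<^esub> r \<odot>\<^bsub>M\<^esub> ?y"
      using jR kr(2) xM by (simp add: R.minus_eq a_minus_def smult_l_distr smult_l_minus smult_assoc1)
    also have "\<dots> = k \<oplus>\<^bsub>M\<^esub> r \<odot>\<^bsub>M\<^esub> ?y \<ominus>\<^bsub>M\<^esub> r \<odot>\<^bsub>M\<^esub> ?y"
      using kr(3) by (rule arg_cong)
    also have "\<dots> = k"
      using kM yM kr(2) by (simp add: a_minus_def M.a_assoc M.r_neg)
    finally have "s \<odot>\<^bsub>M\<^esub> ((\<one> \<ominus> r \<otimes> j) \<odot>\<^bsub>M\<^esub> x) \<in> K"
      using submodule_closed(2)[OF K'(1) s(1) kr(1)] by simp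
    then have "x \<in> K"
      using s jR kr(2) xM by (simp flip: smult_assoc1)
    with submodule_closed(2)[OF K'(1) jR] notin show False by blast
  qed
  then have "ideal_smult M J A \<subseteq> K"
    unfolding ideal_smult_subset_iff[OF K'(1)] by blast
  then have "ideal_smult M J A <+>\<^bsub>M\<^esub> L \<subseteq> K"
    using K'(1,2) by (intro set_add_least)
  then have "A <+>\<^bsub>M\<^esub> L \<subseteq> K"
    using sub K'(1,2) by (intro set_add_least) auto
  with K'(3) show False by blast
qed

text \<open>
  Among the submodules \<open>K\<close> that have finite length over \<open>J M\<close> take a maximal one. If it were
  proper, some \<open>K : z\<close> with \<open>z \<notin> K\<close> would be a prime above \<open>J\<close>, that is \<open>\<nn>\<close>, and \<open>K + R z\<close> would be
  longer than \<open>K\<close> by a simple module.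
\<close>

theorem finite_length_mod_primary:
  assumes J: "ideal J R" "J \<subseteq> \<nn>" and prim: "\<And>P. primeideal P R \<Longrightarrow> J \<subseteq> P \<Longrightarrow> P = \<nn>"
  shows "sub_len R M (ideal_smult M J (carrier M)) (carrier M) \<noteq> \<infinity>"
proof -
  let ?JM = "ideal_smult M J (carrier M)"
  note JM = submodule_ideal_smult[OF J(1) carrier_is_submodule]
  let ?S = "{K. submodule K R M \<and> ?JM \<subseteq> K \<and> sub_len R M ?JM K \<noteq> \<infinity>}"
  have "?JM \<in> ?S" using JM sub_len_eq_0_iff[OF JM JM] by (simp add: zero_enat_def)
  then obtain K where K: "K \<in> ?S" and max: "\<And>B. B \<in> ?S \<Longrightarrow> K \<subseteq> B \<Longrightarrow> B = K"
    using maximal_submodule[of ?JM ?S] by blast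
  then have K': "submodule K R M" "?JM \<subseteq> K" "sub_len R M ?JM K \<noteq> \<infinity>" by auto
  have "K = carrier M"
  proof (rule ccontr)
    assume "K \<noteq> carrier M"
    then obtain z\<^sub>0 where z0: "z\<^sub>0 \<in> carrier M" "z\<^sub>0 \<notin> K" using submoduleE(1)[OF K'(1)] by blast
    then have "residual R M K {z\<^sub>0} \<subseteq> \<nn>"
      by (intro proper_ideal_le residual_ideal K') (auto simp: residual_def)
    then obtain z where z: "z \<in> carrier M" "primeideal (residual R M K {z}) R"
        "residual R M K {z} \<subseteq> \<nn>"
      using prime_residual_below[OF K'(1) carrier_is_submodule prime_max_ideal z0(1)] by blast
    have "J \<subseteq> residual R M K {z}"
      using K'(2) z(1) ideal_carrierD[OF J(1)]
      unfolding ideal_smult_subset_iff[OF K'(1)] by (auto simp: residual_def)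
    then have res: "residual R M K {z} = \<nn>" using prim z(2) by blast
    note Rz = submodule_cyclic[OF z(1)]
    note KRz = submodule_set_add[OF K'(1) Rz]
    have "z \<notin> K" using res max_ideal(2) z(1) by (auto simp: residual_def)
    have simple: "S = K <+>\<^bsub>M\<^esub> cyclic R M z"
      if S: "submodule S R M" "K \<subset> S" "S \<subseteq> K <+>\<^bsub>M\<^esub> cyclic R M z" for S
    proof -
      obtain x where x: "x \<in> S" "x \<notin> K" using S(2) by blast
      then have "x \<in> K <+>\<^bsub>M\<^esub> cyclic R M z" using S(3) by blast
      then obtain k r where kr: "k \<in> K" "r \<in> carrier R" "x = k \<oplus>\<^bsub>M\<^esub> r \<odot>\<^bsub>M\<^esub> z"
        by (auto simp: set_add_iff cyclic_def)
      have kM: "k \<in> carrier M" using kr(1) by (rule submodule_carrierD[OF K'(1)])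
      have "x \<ominus>\<^bsub>M\<^esub> k \<in> S" using x(1) kr(1) S by (intro submodule_closed) auto
      moreover have "x \<ominus>\<^bsub>M\<^esub> k = r \<odot>\<^bsub>M\<^esub> z"
        unfolding kr(3) using kM kr(2) z(1)
        by (simp add: a_minus_def M.a_comm[of k] M.a_assoc M.r_neg)
      ultimately have rz: "r \<odot>\<^bsub>M\<^esub> z \<in> S" by simp
      have "r \<odot>\<^bsub>M\<^esub> z \<notin> K" using x(2) kr submodule_closed(3)[OF K'(1)] by blast
      then have "r \<notin> residual R M K {z}" by (simp add: residual_def)
      then have "r \<notin> \<nn>" using res by simp
      then obtain s where s: "s \<in> carrier R" "s \<otimes> r = \<one>"
        using not_in_max_ideal_imp_unit kr(2) by blast
      have "s \<odot>\<^bsub>M\<^esub> (r \<odot>\<^bsub>M\<^esub> z) \<in> S" using submodule_closed(2)[OF S(1) s(1) rz] .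
      then have "z \<in> S" using s kr(2) z(1) by (simp flip: smult_assoc1)
      then have "K <+>\<^bsub>M\<^esub> cyclic R M z \<subseteq> S"
        using S cyclic_subset_iff[OF S(1) z(1)] by (intro set_add_least) auto
      with S(3) show ?thesis by blast
    qed
    have "\<not> enat 2 \<le> sub_len R M K (K <+>\<^bsub>M\<^esub> cyclic R M z)"
    proof
      assume "enat 2 \<le> sub_len R M K (K <+>\<^bsub>M\<^esub> cyclic R M z)"
      then obtain S where S: "submodule_chain R M K (K <+>\<^bsub>M\<^esub> cyclic R M z) 2 S"
        using enat_le_sub_len_iff[OF K'(1) set_add_upper1[OF K'(1) Rz]] by blast
      have c: "submodule (S 1) R M" "submodule (S 2) R M" "K \<subseteq> S 0" "S 0 \<subset> S 1" "S 1 \<subset> S (Suc 1)"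
          "S 1 \<subseteq> K <+>\<^bsub>M\<^esub> cyclic R M z" "S 2 \<subseteq> K <+>\<^bsub>M\<^esub> cyclic R M z"
        using S unfolding submodule_chain_def by (auto dest: spec[of _ 0])
      then have "S 1 = K <+>\<^bsub>M\<^esub> cyclic R M z" by (intro simple) auto
      with c show False by (auto simp: numeral_2_eq_2)
    qed
    then have "sub_len R M K (K <+>\<^bsub>M\<^esub> cyclic R M z) \<noteq> \<infinity>"
      by (metis enat_ord_simps(3))
    then have "sub_len R M ?JM (K <+>\<^bsub>M\<^esub> cyclic R M z) \<noteq> \<infinity>"
      using sub_len_add[OF JM K'(1) KRz K'(2) set_add_upper1[OF K'(1) Rz]] K'(3)
      by (metis plus_eq_infty_iff_enat)
    then have "K <+>\<^bsub>M\<^esub> cyclic R M z = K"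
      using KRz K'(2) set_add_upper1[OF K'(1) Rz] by (intro max) auto
    then show False
      using set_add_upper2[OF K'(1) Rz] cyclic_self[OF z(1)] \<open>z \<notin> K\<close> by blast
  qed
  with K'(3) show ?thesis by simp
qed

end


section \<open>Powers and products of ideals\<close>

context cring
begin

lemma ideals_set_simps:
  "carrier (ideals_set R) = {I. ideal I R}" "mult (ideals_set R) = ideal_prod R"
  "one (ideals_set R) = carrier R"
  by (simp_all add: ideals_set_def)

lemma ideal_power_0: "ideal_power R I 0 = carrier R"
  by (simp add: ideal_power_def ideals_set_simps nat_pow_def)

lemma ideal_power_Suc: "ideal_power R I (Suc n) = ideal_prod R (ideal_power R I n) I"
  by (simp add: ideal_power_def ideals_set_simps nat_pow_def)

lemma ideal_ideal_power: "ideal I R \<Longrightarrow> ideal (ideal_power R I n) R"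
  by (induction n) (simp_all add: ideal_power_0 ideal_power_Suc oneideal ideal_prod_is_ideal)

lemma ideal_power_1: "ideal I R \<Longrightarrow> ideal_power R I 1 = I"
  by (simp add: ideal_power_0 ideal_power_Suc ideal_prod_commute[OF oneideal] ideal_prod_one)

lemma ideal_power_add:
  assumes "ideal I R"
  shows "ideal_power R I (m + n) = ideal_prod R (ideal_power R I m) (ideal_power R I n)"
proof -
  interpret IS: comm_monoid "ideals_set R" by (rule ideals_set_is_comm_monoid)
  show ?thesis
    using IS.nat_pow_mult[of I m n] assms by (simp add: ideals_set_simps ideal_power_def)
qed

lemma ideal_power_antimono:
  assumes I: "ideal I R" and "m \<le> n"
  shows "ideal_power R I n \<subseteq> ideal_power R I m"
  using ideal_power_add[OF I, of m "n - m"] assms(2)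
    ideal_prod_inter[OF ideal_ideal_power[OF I] ideal_ideal_power[OF I], of m "n - m"] by auto

lemma multi_power_ideal:
  assumes I: "\<forall>i\<le>d. ideal (I i) R"
  shows "ideal (multi_power R d I n) R"
proof -
  interpret IS: comm_monoid "ideals_set R" by (rule ideals_set_is_comm_monoid)
  have "multi_power R d I n \<in> carrier (ideals_set R)"
    unfolding multi_power_def using I by (intro IS.finprod_closed) (auto simp: ideals_set_simps ideal_ideal_power)
  then show ?thesis by (simp add: ideals_set_simps)
qed

lemma multi_power_cong:
  assumes I: "\<forall>i\<le>d. ideal (I i) R" and "\<And>i. i \<le> d \<Longrightarrow> m i = n i"
  shows "multi_power R d I m = multi_power R d I n"
proof -
  interpret IS: comm_monoid "ideals_set R" by (rule ideals_set_is_comm_monoid)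
  show ?thesis
    unfolding multi_power_def using assms
    by (intro IS.finprod_cong') (auto simp: ideals_set_simps ideal_ideal_power)
qed

lemma multi_power_add:
  assumes I: "\<forall>i\<le>d. ideal (I i) R"
  shows "multi_power R d I (\<lambda>i. m i + n i) = ideal_prod R (multi_power R d I m) (multi_power R d I n)"
proof -
  interpret IS: comm_monoid "ideals_set R" by (rule ideals_set_is_comm_monoid)
  have "multi_power R d I (\<lambda>i. m i + n i) =
      (\<Otimes>\<^bsub>ideals_set R\<^esub> i \<in> {..d}. ideal_power R (I i) (m i) \<otimes>\<^bsub>ideals_set R\<^esub> ideal_power R (I i) (n i))"
    unfolding multi_power_def using I
    by (intro IS.finprod_cong') (auto simp: ideals_set_simps ideal_ideal_power ideal_power_add ideal_prod_is_ideal)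
  also have "\<dots> = multi_power R d I m \<otimes>\<^bsub>ideals_set R\<^esub> multi_power R d I n"
    unfolding multi_power_def using I
    by (intro IS.finprod_multf) (auto simp: ideals_set_simps ideal_ideal_power)
  finally show ?thesis by (simp add: ideals_set_simps)
qed

lemma multi_power_zero:
  assumes I: "\<forall>i\<le>d. ideal (I i) R"
  shows "multi_power R d I (\<lambda>_. 0) = carrier R"
proof -
  interpret IS: comm_monoid "ideals_set R" by (rule ideals_set_is_comm_monoid)
  show ?thesis
    unfolding multi_power_def ideal_power_0
    using IS.finprod_one_eqI[of "{..d}" "\<lambda>_. carrier R"] by (simp add: ideals_set_simps)
qed

lemma multi_power_Suc:
  assumes I: "\<forall>i\<le>d. ideal (I i) R" and i: "i \<le> d"
  shows "multi_power R d I (n(i := Suc (n i))) = ideal_prod R (multi_power R d I n) (I i)"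
proof -
  interpret IS: comm_monoid "ideals_set R" by (rule ideals_set_is_comm_monoid)
  let ?e = "\<lambda>j. if i = j then 1 else 0 :: nat"
  have "multi_power R d I ?e =
      (\<Otimes>\<^bsub>ideals_set R\<^esub> j \<in> {..d}. if i = j then ideal_power R (I j) 1 else \<one>\<^bsub>ideals_set R\<^esub>)"
    unfolding multi_power_def using I
    by (intro IS.finprod_cong') (auto simp: ideals_set_simps ideal_ideal_power ideal_power_0 oneideal)
  also have "\<dots> = I i"
    using i I by (subst IS.finprod_singleton) (auto simp: ideals_set_simps ideal_power_1[unfolded One_nat_def] ideal_ideal_power)
  finally have e: "multi_power R d I ?e = I i" .
  have "multi_power R d I (n(i := Suc (n i))) = multi_power R d I (\<lambda>j. n j + ?e j)"
    by (intro multi_power_cong I) auto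
  also have "\<dots> = ideal_prod R (multi_power R d I n) (I i)"
    using multi_power_add[OF I, where m = n and n = ?e] e by simp
  finally show ?thesis .
qed

lemma multi_power_const:
  assumes I: "\<forall>i\<le>d. ideal (I i) R"
  shows "multi_power R d I (\<lambda>_. t) = ideal_power R (ideals_product R d I) t"
proof -
  interpret IS: comm_monoid "ideals_set R" by (rule ideals_set_is_comm_monoid)
  have "multi_power R d I (\<lambda>_. 1) = ideals_product R d I"
    unfolding multi_power_def ideals_product_def using I
    by (intro IS.finprod_cong') (auto simp: ideals_set_simps ideal_power_1[unfolded One_nat_def])
  then show ?thesis
    using multi_power_add[OF I, where n = "\<lambda>_. 1" and m = "\<lambda>_. s" for s] multi_power_zero[OF I]
    by (induction t) (simp_all add: ideal_power_0 ideal_power_Suc)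
qed

lemma ideals_product_ideal:
  assumes I: "\<forall>i\<le>d. ideal (I i) R"
  shows "ideal (ideals_product R d I) R"
proof -
  interpret IS: comm_monoid "ideals_set R" by (rule ideals_set_is_comm_monoid)
  have "ideals_product R d I \<in> carrier (ideals_set R)"
    unfolding ideals_product_def using I by (intro IS.finprod_closed) (auto simp: ideals_set_simps)
  then show ?thesis by (simp add: ideals_set_simps)
qed

lemma multi_power_antimono:
  assumes I: "\<forall>i\<le>d. ideal (I i) R" and le: "\<And>i. i \<le> d \<Longrightarrow> m i \<le> n i"
  shows "multi_power R d I n \<subseteq> multi_power R d I m"
proof -
  have "multi_power R d I n = multi_power R d I (\<lambda>i. m i + (n i - m i))"
    using le by (intro multi_power_cong I) auto
  also have "\<dots> \<subseteq> multi_power R d I m"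
    using ideal_prod_inter[OF multi_power_ideal[OF I] multi_power_ideal[OF I], of m "\<lambda>i. n i - m i"]
    unfolding multi_power_add[OF I] by blast
  finally show ?thesis .
qed

lemma multi_power_single:
  assumes "ideal (I 0) R"
  shows "multi_power R 0 I n = ideal_power R (I 0) (n 0)"
proof -
  interpret IS: comm_monoid "ideals_set R" by (rule ideals_set_is_comm_monoid)
  have "multi_power R 0 I n = multi_power R 0 I (\<lambda>_. n 0)"
    using assms by (intro multi_power_cong) auto
  also have "\<dots> = ideal_power R (ideals_product R 0 I) (n 0)"
    using assms by (intro multi_power_const) auto
  also have "ideals_product R 0 I = I 0"
    unfolding ideals_product_def using assms IS.finprod_insert[of "{}" 0 I] 
    by (simp add: ideals_set_simps ideal_prod_one)
  finally show ?thesis .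
qed

end


section \<open>Monomials in generators\<close>

fun gmon :: "('a, 'r) ring_scheme \<Rightarrow> (nat \<times> 'a) list \<Rightarrow> nat list \<Rightarrow> 'a" where
  "gmon R (g # gs) (m # \<alpha>) = snd g [^]\<^bsub>R\<^esub> m \<otimes>\<^bsub>R\<^esub> gmon R gs \<alpha>"
| "gmon R _ _ = \<one>\<^bsub>R\<^esub>"

definition vadd :: "nat list \<Rightarrow> nat list \<Rightarrow> nat list" where
  "vadd \<alpha> \<beta> = map2 (+) \<alpha> \<beta>"

lemma vadd_simps [simp]: "vadd [] \<beta> = []" "vadd (a # \<alpha>) (b # \<beta>) = (a + b) # vadd \<alpha> \<beta>"
  by (simp_all add: vadd_def)

lemma length_vadd [simp]: "length \<alpha> = length \<beta> \<Longrightarrow> length (vadd \<alpha> \<beta>) = length \<beta>"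
  by (simp add: vadd_def)

lemma cdeg_vadd:
  "length \<alpha> = length cs \<Longrightarrow> length \<beta> = length cs \<Longrightarrow>
    cdeg cs (vadd \<alpha> \<beta>) = (\<lambda>i. cdeg cs \<alpha> i + cdeg cs \<beta> i)"
proof (induction cs arbitrary: \<alpha> \<beta>)
  case (Cons c cs)
  then show ?case by (cases \<alpha>; cases \<beta>) (auto simp: fun_eq_iff)
qed simp

lemma vadd_less:
  "length \<alpha> = length \<gamma> \<Longrightarrow> length \<beta> = length \<gamma> \<Longrightarrow> \<alpha> < \<beta> \<Longrightarrow> vadd \<gamma> \<alpha> < vadd \<gamma> \<beta>"
proof (induction \<gamma> arbitrary: \<alpha> \<beta>)
  case (Cons c \<gamma>)
  then show ?case by (cases \<alpha>; cases \<beta>) auto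
qed simp

lemma list_all2_le_imp_vadd:
  "list_all2 (\<le>) \<alpha> \<beta> \<Longrightarrow> \<exists>\<gamma>. length \<gamma> = length \<beta> \<and> \<beta> = vadd \<gamma> \<alpha>"
proof (induction rule: list_all2_induct)
  case (Cons a \<alpha> b \<beta>)
  then obtain \<gamma> where "length \<gamma> = length \<beta>" "\<beta> = vadd \<gamma> \<alpha>" by blast
  with Cons.hyps show ?case by (intro exI[of _ "(b - a) # \<gamma>"]) simp
qed simp

context cring
begin

lemma gmon_closed: "snd ` set gs \<subseteq> carrier R \<Longrightarrow> gmon R gs \<alpha> \<in> carrier R"
  by (induction gs \<alpha> rule: list_induct2') auto

lemma gmon_vadd:
  "snd ` set gs \<subseteq> carrier R \<Longrightarrow> length \<alpha> = length gs \<Longrightarrow> length \<beta> = length gs \<Longrightarrow>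
    gmon R gs (vadd \<alpha> \<beta>) = gmon R gs \<alpha> \<otimes> gmon R gs \<beta>"
proof (induction gs arbitrary: \<alpha> \<beta>)
  case (Cons g gs)
  obtain a \<alpha>' b \<beta>' where [simp]: "\<alpha> = a # \<alpha>'" "\<beta> = b # \<beta>'"
    using Cons.prems by (cases \<alpha>; cases \<beta>) auto
  have "gmon R gs \<alpha>' \<in> carrier R" "gmon R gs \<beta>' \<in> carrier R" "snd g \<in> carrier R"
    using Cons.prems gmon_closed by auto
  then show ?case
    using Cons by (simp add: m_ac nat_pow_mult[symmetric])
qed simp

lemma gmon_in_multi_power:
  assumes I: "\<forall>i\<le>d. ideal (I i) R"
    and "\<forall>(c, a)\<in>set gs. c \<le> d \<and> a \<in> I c"
  shows "gmon R gs \<alpha> \<in> multi_power R d I (cdeg (map fst gs) \<alpha>)"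
  using assms(2)
proof (induction gs \<alpha> rule: list_induct2')
  case (4 g gs m \<alpha>)
  obtain c a where g: "g = (c, a)" "c \<le> d" "a \<in> I c" using 4(2) by (cases g) auto
  have a: "a \<in> carrier R" by (rule ideal.Icarr[OF I[rule_format, OF g(2)] g(3)])
  define n where "n = cdeg (map fst gs) \<alpha>"
  have x: "gmon R gs \<alpha> \<in> multi_power R d I n" using 4 by (simp add: n_def)
  have xR: "gmon R gs \<alpha> \<in> carrier R" using ideal.Icarr[OF multi_power_ideal[OF I] x] .
  have "a [^] m \<otimes> gmon R gs \<alpha> \<in> multi_power R d I (n(c := m + n c))"
  proof (induction m)
    case (Suc m)
    let ?n = "n(c := m + n c)"
    have "(a [^] m \<otimes> gmon R gs \<alpha>) \<otimes> a \<in> ideal_prod R (multi_power R d I ?n) (I c)"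
      using Suc g(3) by (intro ideal_prod.prod)
    also have "\<dots> = multi_power R d I (?n(c := Suc (?n c)))"
      by (rule multi_power_Suc[OF I g(2), symmetric])
    also have "?n(c := Suc (?n c)) = n(c := Suc m + n c)"
      by (simp add: fun_eq_iff)
    also have "(a [^] m \<otimes> gmon R gs \<alpha>) \<otimes> a = a [^] Suc m \<otimes> gmon R gs \<alpha>"
      using a xR by (simp add: m_ac)
    finally show ?case .
  qed (use x xR in simp)
  then show ?case by (simp add: g n_def fun_upd_def)
qed (use multi_power_zero[OF I] in simp_all)

end

context module
begin

definition Idl_smult :: "'a set \<Rightarrow> 'c set" where
  "Idl_smult S = ideal_smult M (Idl\<^bsub>R\<^esub> S) (carrier M)"

lemma submodule_Idl_smult: "S \<subseteq> carrier R \<Longrightarrow> submodule (Idl_smult S) R M"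
  unfolding Idl_smult_def by (intro submodule_ideal_smult R.genideal_ideal carrier_is_submodule)

lemma Idl_smult_subset_iff:
  assumes S: "S \<subseteq> carrier R" and K: "submodule K R M"
  shows "Idl_smult S \<subseteq> K \<longleftrightarrow> (\<forall>s\<in>S. \<forall>m\<in>carrier M. s \<odot>\<^bsub>M\<^esub> m \<in> K)"
proof
  show "Idl_smult S \<subseteq> K" if "\<forall>s\<in>S. \<forall>m\<in>carrier M. s \<odot>\<^bsub>M\<^esub> m \<in> K"
    unfolding Idl_smult_def using that by (intro ideal_smult_Idl_subset S K) auto
  show "\<forall>s\<in>S. \<forall>m\<in>carrier M. s \<odot>\<^bsub>M\<^esub> m \<in> K" if "Idl_smult S \<subseteq> K"
    using that R.genideal_self[OF S] unfolding Idl_smult_def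
    by (meson ideal_smult.prod subsetD)
qed

lemma Idl_smultI: "S \<subseteq> carrier R \<Longrightarrow> s \<in> S \<Longrightarrow> m \<in> carrier M \<Longrightarrow> s \<odot>\<^bsub>M\<^esub> m \<in> Idl_smult S"
  using Idl_smult_subset_iff[OF _ submodule_Idl_smult, of S S] by blast

lemma smult_linear_map: "r \<in> carrier R \<Longrightarrow> linear_map R M M (\<lambda>m. r \<odot>\<^bsub>M\<^esub> m)"
  by (intro linear_map.intro module_axioms linear_map_axioms.intro)
    (auto simp: smult_r_distr R.m_comm simp flip: smult_assoc1)

lemma submodule_smult_image:
  "r \<in> carrier R \<Longrightarrow> submodule A R M \<Longrightarrow> submodule ((\<lambda>m. r \<odot>\<^bsub>M\<^esub> m) ` A) R M"
  by (rule linear_map.submodule_image[OF smult_linear_map])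

lemma submodule_smult_vimage:
  "r \<in> carrier R \<Longrightarrow> submodule A R M \<Longrightarrow> submodule {m \<in> carrier M. r \<odot>\<^bsub>M\<^esub> m \<in> A} R M"
  by (rule linear_map.submodule_vimage[OF smult_linear_map])

lemma Idl_smult_insert:
  assumes S: "S \<subseteq> carrier R" and s: "s \<in> carrier R"
  shows "Idl_smult (insert s S) = (\<lambda>m. s \<odot>\<^bsub>M\<^esub> m) ` carrier M <+>\<^bsub>M\<^esub> Idl_smult S"
proof
  have sS: "insert s S \<subseteq> carrier R" using assms by auto
  note sM = submodule_smult_image[OF s carrier_is_submodule] and SM = submodule_Idl_smult[OF S]
  show "Idl_smult (insert s S) \<subseteq> (\<lambda>m. s \<odot>\<^bsub>M\<^esub> m) ` carrier M <+>\<^bsub>M\<^esub> Idl_smult S"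
    unfolding Idl_smult_subset_iff[OF sS submodule_set_add[OF sM SM]]
  proof (intro ballI)
    fix r m assume rm: "r \<in> insert s S" "m \<in> carrier M"
    show "r \<odot>\<^bsub>M\<^esub> m \<in> (\<lambda>m. s \<odot>\<^bsub>M\<^esub> m) ` carrier M <+>\<^bsub>M\<^esub> Idl_smult S"
    proof (cases "r = s")
      case True
      then have "r \<odot>\<^bsub>M\<^esub> m \<in> (\<lambda>m. s \<odot>\<^bsub>M\<^esub> m) ` carrier M" using rm(2) by simp
      with set_add_upper1[OF sM SM] show ?thesis by (rule subsetD)
    next
      case False
      then have "r \<odot>\<^bsub>M\<^esub> m \<in> Idl_smult S" using rm by (intro Idl_smultI S) auto
      with set_add_upper2[OF sM SM] show ?thesis by (rule subsetD)
    qed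
  qed
  have "Idl_smult S \<subseteq> Idl_smult (insert s S)"
    unfolding Idl_smult_subset_iff[OF S submodule_Idl_smult[OF sS]]
    by (intro ballI Idl_smultI[OF sS]) auto
  moreover have "(\<lambda>m. s \<odot>\<^bsub>M\<^esub> m) ` carrier M \<subseteq> Idl_smult (insert s S)"
    by (intro image_subsetI Idl_smultI[OF sS]) auto
  ultimately show "(\<lambda>m. s \<odot>\<^bsub>M\<^esub> m) ` carrier M <+>\<^bsub>M\<^esub> Idl_smult S \<subseteq> Idl_smult (insert s S)"
    by (intro set_add_least submodule_Idl_smult[OF sS])
qed

end


section \<open>Leading coefficients\<close>

text \<open>
  A pair \<open>(c, a)\<close> in \<open>gs\<close> is a generator \<open>a\<close> of the ideal with the number \<open>c\<close>.
\<close>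

locale generated_ideals = module R M for R (structure) and M (structure) +
  fixes d :: nat and I :: "nat \<Rightarrow> 'a set" and gs :: "(nat \<times> 'a) list"
  assumes I: "\<forall>i\<le>d. ideal (I i) R"
    and gs: "\<forall>(c, a)\<in>set gs. c \<le> d \<and> a \<in> I c"
    and generate: "\<And>i. i \<le> d \<Longrightarrow> I i = Idl {a. (i, a) \<in> set gs}"
begin

abbreviation "cs \<equiv> map fst gs"
abbreviation "monom_of \<equiv> gmon R gs"
abbreviation "mdeg \<equiv> cdeg cs"
abbreviation "Pow_M n \<equiv> ideal_smult M (multi_power R d I n) (carrier M)"

lemma gs_carrier: "snd ` set gs \<subseteq> carrier R"
proof
  fix a assume "a \<in> snd ` set gs"
  then obtain c where c: "(c, a) \<in> set gs" by auto
  then have "c \<le> d" "a \<in> I c" using gs by auto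
  then show "a \<in> carrier R" using ideal_carrierD[OF I[rule_format]] by blast
qed

lemmas mon_closed = R.gmon_closed[OF gs_carrier]

lemma mon_image: "monom_of ` T \<subseteq> carrier R"
  using mon_closed by blast

lemma cs_le: "set cs \<subseteq> {..d}"
  using gs by fastforce

lemma submodule_pow: "submodule (Pow_M n) R M"
  by (intro submodule_ideal_smult R.multi_power_ideal I carrier_is_submodule)

lemma mon_smult_pow:
  assumes "x \<in> Pow_M n"
  shows "monom_of \<gamma> \<odot>\<^bsub>M\<^esub> x \<in> Pow_M (\<lambda>i. mdeg \<gamma> i + n i)"
  unfolding R.multi_power_add[OF I]
    ideal_smult_ideal_prod[OF R.multi_power_ideal[OF I] R.multi_power_ideal[OF I] carrier_is_submodule]
  using R.gmon_in_multi_power[OF I gs] assms by (intro ideal_smult.prod)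

lemma mon_smult_in_pow: "m \<in> carrier M \<Longrightarrow> monom_of \<alpha> \<odot>\<^bsub>M\<^esub> m \<in> Pow_M (mdeg \<alpha>)"
  using R.gmon_in_multi_power[OF I gs] by (intro ideal_smult.prod)

text \<open>
  The powers of the ideals, applied to the module, are spanned by the monomials of the right
  multidegree. One factor is split off at a time, and multiplication by a generator is
  multiplication by a monomial of degree one.
\<close>

lemma pow_eq_Idl_smult:
  assumes "n \<in> multi_index d"
  shows "Pow_M n = Idl_smult (monom_of ` exps cs n)"
proof
  show "Idl_smult (monom_of ` exps cs n) \<subseteq> Pow_M n"
    unfolding Idl_smult_subset_iff[OF mon_image submodule_pow]
    using mon_smult_in_pow by (auto simp: exps_def)
  show "Pow_M n \<subseteq> Idl_smult (monom_of ` exps cs n)"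
    using assms
  proof (induction "\<Sum>i\<le>d. n i" arbitrary: n)
    case 0
    have "n i = 0" for i
      using 0 by (cases "i \<le> d") (auto simp: multi_index_def)
    then have n: "n = (\<lambda>_. 0)" by auto
    let ?z = "replicate (length gs) 0"
    have "monom_of ?z = \<one>" using gs_carrier by (induction gs) auto
    moreover have "mdeg ?z = (\<lambda>_. 0)" by (induction gs) (auto simp: fun_eq_iff)
    ultimately have one: "\<one> \<in> monom_of ` exps cs n"
      by (auto simp: exps_def n intro!: image_eqI[of _ _ ?z])
    have "m \<in> Idl_smult (monom_of ` exps cs n)" if "m \<in> carrier M" for m
      using Idl_smultI[OF mon_image one that] that by simp
    moreover have "Pow_M n \<subseteq> carrier M" by (rule submoduleE(1)[OF submodule_pow])
    ultimately show ?case by blast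
  next
    case (Suc N)
    have "\<exists>i\<le>d. n i \<noteq> 0"
    proof (rule ccontr)
      assume "\<not> ?thesis"
      then have "(\<Sum>i\<le>d. n i) = 0" by simp
      with Suc.hyps(2) show False by simp
    qed
    then obtain i where i: "i \<le> d" "n i \<noteq> 0" by blast
    define n' where "n' = n(i := n i - 1)"
    have n: "n = n'(i := Suc (n' i))" using i(2) by (auto simp: n'_def)
    have n'_idx: "n' \<in> multi_index d" using Suc.prems i(1) by (simp add: n'_def multi_index_upd)
    have "(\<Sum>i\<le>d. n i) = n i + (\<Sum>j\<in>{..d}-{i}. n j)" "(\<Sum>i\<le>d. n' i) = n' i + (\<Sum>j\<in>{..d}-{i}. n' j)"
      using i(1) by (simp_all add: sum.remove)
    moreover have "(\<Sum>j\<in>{..d}-{i}. n' j) = (\<Sum>j\<in>{..d}-{i}. n j)"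
      by (intro sum.cong) (auto simp: n'_def)
    ultimately have "(\<Sum>i\<le>d. n' i) = N" using Suc.hyps(2) i(2) by (simp add: n'_def)
    then have IH: "Pow_M n' \<subseteq> Idl_smult (monom_of ` exps cs n')" using Suc.hyps(1) n'_idx by blast
    let ?K = "Idl_smult (monom_of ` exps cs n)"
    note K = submodule_Idl_smult[OF mon_image]
    have step: "s \<odot>\<^bsub>M\<^esub> x \<in> ?K" if s: "(i, s) \<in> set gs" and x: "x \<in> Pow_M n'" for s x
    proof -
      have sR: "s \<in> carrier R" using s gs_carrier by force
      have shift: "\<exists>\<gamma>. length \<gamma> = length gs \<and> monom_of \<gamma> = s \<and> mdeg \<gamma> = (\<lambda>j. if j = i then 1 else 0)"
        using s gs_carrier
      proof (induction gs)
        case (Cons g gs)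
        let ?z = "replicate (length gs) 0"
        have z: "gmon R gs ?z = \<one>" "cdeg (map fst gs) ?z = (\<lambda>_. 0)"
          using Cons.prems(2) by (induction gs) (auto simp: fun_eq_iff)
        show ?case
        proof (cases "g = (i, s)")
          case True
          then show ?thesis
            using z Cons.prems(2) by (intro exI[of _ "1 # ?z"]) (auto simp: fun_eq_iff)
        next
          case False
          then obtain \<gamma> where \<gamma>: "length \<gamma> = length gs" "gmon R gs \<gamma> = s"
              "cdeg (map fst gs) \<gamma> = (\<lambda>j. if j = i then 1 else 0)"
            using Cons by auto
          then show ?thesis
            using Cons.prems(2) sR by (intro exI[of _ "0 # \<gamma>"]) (auto simp: fun_eq_iff)
        qed
      qed simp
      then obtain \<gamma> where \<gamma>: "length \<gamma> = length gs" "monom_of \<gamma> = s" "mdeg \<gamma> = (\<lambda>j. if j = i then 1 else 0)"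
        by blast
      have "Idl_smult (monom_of ` exps cs n') \<subseteq> {x \<in> carrier M. s \<odot>\<^bsub>M\<^esub> x \<in> ?K}"
        unfolding Idl_smult_subset_iff[OF mon_image submodule_smult_vimage[OF sR K]]
      proof (intro ballI CollectI conjI)
        fix r m assume r: "r \<in> monom_of ` exps cs n'" and m: "m \<in> carrier M"
        then obtain \<beta> where \<beta>: "length \<beta> = length gs" "mdeg \<beta> = n'" "r = monom_of \<beta>"
          by (auto simp: exps_def)
        have "mdeg (vadd \<gamma> \<beta>) = n"
          using \<gamma> \<beta> n by (subst cdeg_vadd) (auto simp: fun_eq_iff)
        then have "vadd \<gamma> \<beta> \<in> exps cs n" using \<gamma> \<beta> by (simp add: exps_def)
        then have "monom_of (vadd \<gamma> \<beta>) \<odot>\<^bsub>M\<^esub> m \<in> ?K" using m by (intro Idl_smultI mon_image imageI)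
        then show "s \<odot>\<^bsub>M\<^esub> (r \<odot>\<^bsub>M\<^esub> m) \<in> ?K"
          using \<gamma> \<beta> m mon_closed[of \<beta>] sR by (simp add: R.gmon_vadd[OF gs_carrier] smult_assoc1)
        show "r \<odot>\<^bsub>M\<^esub> m \<in> carrier M" using \<beta> m mon_closed by simp
      qed
      with IH x show ?thesis by blast
    qed
    have "Pow_M n = ideal_smult M (Idl {a. (i, a) \<in> set gs}) (Pow_M n')"
      unfolding generate[OF i(1), symmetric]
      by (subst n, subst R.multi_power_Suc[OF I i(1)], subst R.ideal_prod_commute[OF R.multi_power_ideal[OF I] I[rule_format, OF i(1)]],
        subst ideal_smult_ideal_prod[OF I[rule_format, OF i(1)] R.multi_power_ideal[OF I] carrier_is_submodule])
        simp_all
    also have "\<dots> \<subseteq> ?K"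
      using gs_carrier step submoduleE(1)[OF submodule_pow, of n']
      by (intro ideal_smult_Idl_subset K) force+
    finally show ?case .
  qed
qed

definition lower :: "nat list \<Rightarrow> 'c set" where
  "lower \<alpha> = Idl_smult (monom_of ` {\<beta> \<in> exps cs (mdeg \<alpha>). \<beta> < \<alpha>})"

text \<open>
  The coefficients with which the monomial \<open>\<alpha>\<close> occurs as the leading one in a combination of
  monomials that represents an element of \<open>L\<close>.
\<close>

definition leading :: "'c set \<Rightarrow> nat list \<Rightarrow> 'c set" where
  "leading L \<alpha> = {m \<in> carrier M. monom_of \<alpha> \<odot>\<^bsub>M\<^esub> m \<in> lower \<alpha> <+>\<^bsub>M\<^esub> L}"

lemma submodule_lower: "submodule (lower \<alpha>) R M"
  unfolding lower_def by (rule submodule_Idl_smult[OF mon_image])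

lemma submodule_leading: "submodule L R M \<Longrightarrow> submodule (leading L \<alpha>) R M"
  unfolding leading_def
  by (intro submodule_smult_vimage mon_closed submodule_set_add submodule_lower)

lemma mon_smult_lower:
  assumes len: "length \<gamma> = length gs" "length \<alpha> = length gs" and x: "x \<in> lower \<alpha>"
  shows "monom_of \<gamma> \<odot>\<^bsub>M\<^esub> x \<in> lower (vadd \<gamma> \<alpha>)"
proof -
  have "lower \<alpha> \<subseteq> {x \<in> carrier M. monom_of \<gamma> \<odot>\<^bsub>M\<^esub> x \<in> lower (vadd \<gamma> \<alpha>)}"
    unfolding lower_def[of \<alpha>]
      Idl_smult_subset_iff[OF mon_image submodule_smult_vimage[OF mon_closed submodule_lower]]
  proof (intro ballI CollectI conjI)
    fix r m assume r: "r \<in> monom_of ` {\<beta> \<in> exps cs (mdeg \<alpha>). \<beta> < \<alpha>}" and m: "m \<in> carrier M"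
    then obtain \<beta> where \<beta>: "length \<beta> = length gs" "mdeg \<beta> = mdeg \<alpha>" "\<beta> < \<alpha>" "r = monom_of \<beta>"
      by (auto simp: exps_def)
    then show "r \<odot>\<^bsub>M\<^esub> m \<in> carrier M" using m mon_closed by simp
    have "vadd \<gamma> \<beta> \<in> {\<beta> \<in> exps cs (mdeg (vadd \<gamma> \<alpha>)). \<beta> < vadd \<gamma> \<alpha>}"
      using \<beta> len by (auto simp: exps_def cdeg_vadd intro!: vadd_less)
    then have "monom_of (vadd \<gamma> \<beta>) \<odot>\<^bsub>M\<^esub> m \<in> lower (vadd \<gamma> \<alpha>)"
      unfolding lower_def using m by (intro Idl_smultI mon_image imageI)
    then show "monom_of \<gamma> \<odot>\<^bsub>M\<^esub> (r \<odot>\<^bsub>M\<^esub> m) \<in> lower (vadd \<gamma> \<alpha>)"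
      using \<beta> len m mon_closed by (simp add: R.gmon_vadd[OF gs_carrier] smult_assoc1)
  qed
  with x show ?thesis by blast
qed

text \<open>
  Multiplication by a monomial respects the lexicographic order.
\<close>

lemma leading_mono:
  assumes len: "length \<gamma> = length gs" "length \<alpha> = length gs"
    and L: "submodule L R M" "submodule L' R M" and sub: "\<And>x. x \<in> L \<Longrightarrow> monom_of \<gamma> \<odot>\<^bsub>M\<^esub> x \<in> L'"
  shows "leading L \<alpha> \<subseteq> leading L' (vadd \<gamma> \<alpha>)"
proof
  fix m assume "m \<in> leading L \<alpha>"
  then obtain w l where m: "m \<in> carrier M" and w: "w \<in> lower \<alpha>" and l: "l \<in> L"
    and eq: "monom_of \<alpha> \<odot>\<^bsub>M\<^esub> m = w \<oplus>\<^bsub>M\<^esub> l"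
    by (auto simp: leading_def set_add_iff)
  have "monom_of (vadd \<gamma> \<alpha>) \<odot>\<^bsub>M\<^esub> m = monom_of \<gamma> \<odot>\<^bsub>M\<^esub> (w \<oplus>\<^bsub>M\<^esub> l)"
    using len m mon_closed by (simp add: R.gmon_vadd[OF gs_carrier] smult_assoc1 flip: eq)
  also have "\<dots> = monom_of \<gamma> \<odot>\<^bsub>M\<^esub> w \<oplus>\<^bsub>M\<^esub> monom_of \<gamma> \<odot>\<^bsub>M\<^esub> l"
    using w l submodule_carrierD[OF submodule_lower] submodule_carrierD[OF L(1)] mon_closed
    by (simp add: smult_r_distr)
  finally have "monom_of (vadd \<gamma> \<alpha>) \<odot>\<^bsub>M\<^esub> m \<in> lower (vadd \<gamma> \<alpha>) <+>\<^bsub>M\<^esub> L'"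
    using mon_smult_lower[OF len w] sub[OF l] unfolding set_add_iff by blast
  with m show "m \<in> leading L' (vadd \<gamma> \<alpha>)" by (simp add: leading_def)
qed

end


section \<open>Hilbert functions\<close>

lemma enat_le_finite: "x \<le> y \<Longrightarrow> y \<noteq> \<infinity> \<Longrightarrow> x \<noteq> (\<infinity>::enat)"
  by (cases x; cases y) auto

context generated_ideals
begin

text \<open>
  Adding the next monomial to the filtration contributes \<open>M\<close> modulo its leading coefficients, by
  the second isomorphism theorem and the map \<open>m \<mapsto> a^\<alpha> m\<close>.
\<close>

lemma sub_len_leading_step:
  assumes B: "submodule B R M"
  shows "sub_len R M (lower \<alpha> <+>\<^bsub>M\<^esub> B) ((\<lambda>m. monom_of \<alpha> \<odot>\<^bsub>M\<^esub> m) ` carrier M <+>\<^bsub>M\<^esub> (lower \<alpha> <+>\<^bsub>M\<^esub> B)) =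
    sub_len R M (leading B \<alpha>) (carrier M)"
proof -
  interpret \<phi>: linear_map R M M "\<lambda>m. monom_of \<alpha> \<odot>\<^bsub>M\<^esub> m" by (rule smult_linear_map[OF mon_closed])
  let ?\<phi> = "\<lambda>m. monom_of \<alpha> \<odot>\<^bsub>M\<^esub> m"
  note LB = submodule_set_add[OF submodule_lower[of \<alpha>] B]
  note ld = submodule_leading[OF B, of \<alpha>]
  have img: "?\<phi> ` leading B \<alpha> = ?\<phi> ` carrier M \<inter> (lower \<alpha> <+>\<^bsub>M\<^esub> B)"
    by (auto simp: leading_def)
  have "\<phi>.ker \<subseteq> leading B \<alpha>"
    using submodule_zero[OF LB] by (auto simp: \<phi>.ker_def leading_def)
  then have "leading B \<alpha> <+>\<^bsub>M\<^esub> \<phi>.ker = leading B \<alpha>"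
    by (rule set_add_absorb[OF ld \<phi>.submodule_ker])
  moreover have "carrier M <+>\<^bsub>M\<^esub> \<phi>.ker = carrier M"
    by (rule set_add_absorb[OF carrier_is_submodule \<phi>.submodule_ker submoduleE(1)[OF \<phi>.submodule_ker]])
  ultimately have "sub_len R M (?\<phi> ` leading B \<alpha>) (?\<phi> ` carrier M) = sub_len R M (leading B \<alpha>) (carrier M)"
    using \<phi>.sub_len_image[OF carrier_is_submodule ld submoduleE(1)[OF ld]] by simp
  then show ?thesis
    unfolding img sub_len_second_iso[OF \<phi>.submodule_image[OF carrier_is_submodule] LB] .
qed

lemma sub_len_filtration:
  assumes B: "submodule B R M" and T: "T \<subseteq> exps cs n"
    and down: "\<And>\<alpha> \<beta>. \<alpha> \<in> T \<Longrightarrow> \<beta> \<in> exps cs n \<Longrightarrow> \<beta> < \<alpha> \<Longrightarrow> \<beta> \<in> T"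
  shows "sub_len R M B (Idl_smult (monom_of ` T) <+>\<^bsub>M\<^esub> B) =
    (\<Sum>\<alpha>\<in>T. sub_len R M (leading B \<alpha>) (carrier M))"
proof -
  have "finite T" using T finite_exps finite_subset by blast
  then show ?thesis using T down
  proof (induction T rule: finite_linorder_max_induct)
    case empty
    have "Idl_smult {} \<subseteq> B" by (subst Idl_smult_subset_iff[OF _ B]) auto
    then have "Idl_smult {} <+>\<^bsub>M\<^esub> B = B"
      by (intro set_add_absorb2 B submodule_Idl_smult) auto
    then show ?case using sub_len_eq_0_iff[OF B B] by simp
  next
    case (insert b T)
    have b: "b \<in> exps cs n" "T \<subseteq> exps cs n" using insert.prems(1) by auto
    have "T = {\<beta> \<in> exps cs n. \<beta> < b}"
    proof (intro equalityI subsetI)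
      fix \<beta> assume "\<beta> \<in> {\<beta> \<in> exps cs n. \<beta> < b}"
      then show "\<beta> \<in> T" using insert.prems(2)[of b \<beta>] by auto
    qed (use b insert.hyps(2) in auto)
    moreover have "mdeg b = n" using b by (simp add: exps_def)
    ultimately have low: "Idl_smult (monom_of ` T) = lower b" by (simp add: lower_def)
    have "\<beta> \<in> T" if "\<alpha> \<in> T" "\<beta> \<in> exps cs n" "\<beta> < \<alpha>" for \<alpha> \<beta>
      using insert.prems(2)[of \<alpha> \<beta>] insert.hyps(2) that by fastforce
    then have IH: "sub_len R M B (lower b <+>\<^bsub>M\<^esub> B) =
        (\<Sum>\<alpha>\<in>T. sub_len R M (leading B \<alpha>) (carrier M))"
      using insert.IH b(2) unfolding low by blast
    let ?bM = "(\<lambda>m. monom_of b \<odot>\<^bsub>M\<^esub> m) ` carrier M"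
    note bM = submodule_smult_image[OF mon_closed[of b] carrier_is_submodule]
    note LB = submodule_set_add[OF submodule_lower[of b] B]
    have "Idl_smult (monom_of ` insert b T) <+>\<^bsub>M\<^esub> B = ?bM <+>\<^bsub>M\<^esub> (lower b <+>\<^bsub>M\<^esub> B)"
      unfolding image_insert Idl_smult_insert[OF mon_image mon_closed] low
      by (rule set_add_assoc[OF bM submodule_lower B])
    moreover have "sub_len R M B (?bM <+>\<^bsub>M\<^esub> (lower b <+>\<^bsub>M\<^esub> B)) =
        sub_len R M B (lower b <+>\<^bsub>M\<^esub> B) + sub_len R M (leading B b) (carrier M)"
      unfolding sub_len_leading_step[OF B, symmetric]
      using set_add_upper2[OF submodule_lower[of b] B] set_add_upper2[OF bM LB]
      by (intro sub_len_add B LB submodule_set_add[OF bM LB])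
    moreover have "b \<notin> T" using insert.hyps(2) by blast
    ultimately show ?case using insert.hyps(1) IH by (simp add: add.commute)
  qed
qed

abbreviation "suc0 n \<equiv> n(0 := Suc (n 0))"

lemma pow_suc0_subset: "Pow_M (suc0 n) \<subseteq> Pow_M n"
  by (intro ideal_smult_mono R.multi_power_antimono I) auto

lemma sub_len_pow_eq_sum:
  assumes "n \<in> multi_index d"
  shows "sub_len R M (Pow_M (suc0 n)) (Pow_M n) =
    (\<Sum>\<alpha>\<in>exps cs n. sub_len R M (leading (Pow_M (suc0 (mdeg \<alpha>))) \<alpha>) (carrier M))"
proof -
  have "Pow_M n <+>\<^bsub>M\<^esub> Pow_M (suc0 n) = Pow_M n"
    by (intro set_add_absorb submodule_pow pow_suc0_subset)
  then have "sub_len R M (Pow_M (suc0 n)) (Pow_M n) =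
      (\<Sum>\<alpha>\<in>exps cs n. sub_len R M (leading (Pow_M (suc0 n)) \<alpha>) (carrier M))"
    using sub_len_filtration[OF submodule_pow order_refl, of n "suc0 n"]
    unfolding pow_eq_Idl_smult[OF assms, symmetric] by simp
  also have "\<dots> = (\<Sum>\<alpha>\<in>exps cs n. sub_len R M (leading (Pow_M (suc0 (mdeg \<alpha>))) \<alpha>) (carrier M))"
    by (intro sum.cong) (auto simp: exps_def)
  finally show ?thesis .
qed

text \<open>
  The summand of an exponent vector is the length of \<open>M\<close> modulo leading coefficients. It is
  antitone by \<open>leading_mono\<close> and finite because \<open>I\<^sub>0 M\<close> consists of leading coefficients.
\<close>

theorem hilbert_function_mvpoly:
  assumes fin: "sub_len R M (ideal_smult M (I 0) (carrier M)) (carrier M) \<noteq> \<infinity>"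
  shows "\<exists>F. mvpoly d F \<and> (\<forall>n\<in>multi_index d. \<exists>l.
    sub_len R M (Pow_M (suc0 n)) (Pow_M n) = enat l \<and> int l = F n)"
proof -
  define L where "L \<alpha> = leading (Pow_M (suc0 (mdeg \<alpha>))) \<alpha>" for \<alpha>
  have L: "submodule (L \<alpha>) R M" for \<alpha>
    unfolding L_def by (intro submodule_leading submodule_pow)
  have lfin: "sub_len R M (L \<alpha>) (carrier M) \<noteq> \<infinity>" for \<alpha>
  proof -
    have "ideal_smult M (I 0) (carrier M) \<subseteq> L \<alpha>"
      unfolding ideal_smult_subset_iff[OF L]
    proof (intro ballI)
      fix a x assume a: "a \<in> I 0" and x: "x \<in> carrier M"
      have aR: "a \<in> carrier R" using a I ideal_carrierD by blast
      have "(monom_of \<alpha> \<otimes> a) \<odot>\<^bsub>M\<^esub> x \<in> Pow_M (suc0 (mdeg \<alpha>))"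
        unfolding R.multi_power_Suc[OF I le0]
        using R.gmon_in_multi_power[OF I gs] a x by (intro ideal_smult.prod ideal_prod.prod)
      then have "monom_of \<alpha> \<odot>\<^bsub>M\<^esub> (a \<odot>\<^bsub>M\<^esub> x) \<in> Pow_M (suc0 (mdeg \<alpha>))"
        using aR x mon_closed by (simp add: smult_assoc1)
      then show "a \<odot>\<^bsub>M\<^esub> x \<in> L \<alpha>"
        using set_add_upper2[OF submodule_lower[of \<alpha>] submodule_pow] aR x
        by (auto simp: L_def leading_def)
    qed
    then have "sub_len R M (L \<alpha>) (carrier M) \<le> sub_len R M (ideal_smult M (I 0) (carrier M)) (carrier M)"
      by (intro sub_len_mono) auto
    then show ?thesis using fin by (rule enat_le_finite)
  qed
  define f where "f \<alpha> = the_enat (sub_len R M (L \<alpha>) (carrier M))" for \<alpha>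
  have f: "sub_len R M (L \<alpha>) (carrier M) = enat (f \<alpha>)" for \<alpha>
    using lfin[of \<alpha>] by (auto simp: f_def)
  have "f \<beta> \<le> f \<alpha>" if hyp: "length \<beta> = length cs" "list_all2 (\<le>) \<alpha> \<beta>" for \<alpha> \<beta>
  proof -
    have len: "length \<alpha> = length gs" using hyp list_all2_lengthD by fastforce
    obtain \<gamma> where \<gamma>: "length \<gamma> = length gs" "\<beta> = vadd \<gamma> \<alpha>"
      using list_all2_le_imp_vadd[OF hyp(2)] hyp(1) by auto
    have "monom_of \<gamma> \<odot>\<^bsub>M\<^esub> x \<in> Pow_M (suc0 (mdeg \<beta>))" if x: "x \<in> Pow_M (suc0 (mdeg \<alpha>))" for x
    proof -
      have "suc0 (mdeg \<beta>) = (\<lambda>i. mdeg \<gamma> i + (suc0 (mdeg \<alpha>)) i)"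
        using len \<gamma> by (simp add: cdeg_vadd fun_eq_iff)
      then show ?thesis using mon_smult_pow[OF x, of \<gamma>] by simp
    qed
    then have "L \<alpha> \<subseteq> L \<beta>"
      unfolding L_def \<gamma>(2) by (intro leading_mono \<gamma>(1) len submodule_pow) auto
    then have "sub_len R M (L \<beta>) (carrier M) \<le> sub_len R M (L \<alpha>) (carrier M)"
      by (intro sub_len_mono) auto
    then show ?thesis by (simp add: f)
  qed
  then obtain F where F: "mvpoly d F" "\<forall>n\<in>multi_index d. int (\<Sum>\<alpha>\<in>exps cs n. f \<alpha>) = F n"
    using antitone_sum_is_mvpoly[OF cs_le, of f] by blast
  have enat_sum: "(\<Sum>\<alpha>\<in>A. enat (f \<alpha>)) = enat (\<Sum>\<alpha>\<in>A. f \<alpha>)" for A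
    by (induction A rule: infinite_finite_induct) (auto simp: zero_enat_def)
  have "sub_len R M (Pow_M (suc0 n)) (Pow_M n) = enat (\<Sum>\<alpha>\<in>exps cs n. f \<alpha>)" if "n \<in> multi_index d" for n
    unfolding sub_len_pow_eq_sum[OF that] L_def[symmetric] f enat_sum ..
  with F(2) have "\<forall>n\<in>multi_index d. \<exists>l.
      sub_len R M (Pow_M (suc0 n)) (Pow_M n) = enat l \<and> int l = F n" by metis
  with F(1) show ?thesis by (intro exI conjI)
qed

end

lemma (in noetherian_ring) generating_list:
  assumes I: "\<forall>i\<le>(d::nat). ideal (I i) R"
  obtains gs where "\<forall>(c, a)\<in>set gs. c \<le> d \<and> a \<in> I c"
    "\<And>i. i \<le> d \<Longrightarrow> I i = Idl {a. (i, a) \<in> set gs}"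
proof -
  have "\<forall>i. \<exists>A. i \<le> d \<longrightarrow> A \<subseteq> carrier R \<and> finite A \<and> I i = Idl A"
    using I finetely_gen by blast
  then obtain A where A: "\<And>i. i \<le> d \<Longrightarrow> A i \<subseteq> carrier R \<and> finite (A i) \<and> I i = Idl (A i)"
    by metis
  have "finite (SIGMA i:{..d}. A i)" using A by (intro finite_SigmaI) auto
  then obtain gs where gs: "set gs = (SIGMA i:{..d}. A i)" using finite_list by blast
  have "c \<le> d \<and> a \<in> I c" if "(c, a) \<in> set gs" for c a
  proof -
    have "c \<le> d" "a \<in> A c" using that by (auto simp: gs)
    then show ?thesis using A[of c] genideal_self[of "A c"] by auto
  qed
  then have 1: "\<forall>(c, a)\<in>set gs. c \<le> d \<and> a \<in> I c" by auto
  have 2: "I i = Idl {a. (i, a) \<in> set gs}" if "i \<le> d" for i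
  proof -
    have "{a. (i, a) \<in> set gs} = A i" using that by (auto simp: gs)
    then show ?thesis using A[OF that] by simp
  qed
  show thesis by (rule that[OF 1 2])
qed


section \<open>The Artin-Rees lemma\<close>

text \<open>
  A counterexample for every \<open>c\<close> yields exponent vectors, each chosen with a bound that exceeds
  all earlier ones. Along an increasing subsequence the values of \<open>V\<close> would all be different.
\<close>

lemma dickson_finite_generation:
  fixes V :: "nat list \<Rightarrow> 'x set"
  assumes mono: "\<And>\<alpha> \<beta>. length \<beta> = r \<Longrightarrow> list_all2 (\<le>) \<alpha> \<beta> \<Longrightarrow> V \<alpha> \<subseteq> V \<beta>"
    and acc: "\<And>\<alpha> :: nat \<Rightarrow> nat list. (\<And>i. length (\<alpha> i) = r) \<Longrightarrow> (\<And>i. V (\<alpha> i) \<subseteq> V (\<alpha> (Suc i))) \<Longrightarrow>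
      \<exists>n. V (\<alpha> n) = V (\<alpha> (Suc n))"
  shows "\<exists>c. \<forall>\<alpha>. length \<alpha> = r \<longrightarrow> (\<exists>\<sigma>. list_all2 (\<le>) \<sigma> \<alpha> \<and> V \<sigma> = V \<alpha> \<and> sum_list \<sigma> \<le> c)"
proof (rule ccontr)
  assume "\<not> ?thesis"
  then have "\<forall>c. \<exists>\<alpha>. length \<alpha> = r \<and> (\<forall>\<sigma>. list_all2 (\<le>) \<sigma> \<alpha> \<longrightarrow> V \<sigma> = V \<alpha> \<longrightarrow> \<not> sum_list \<sigma> \<le> c)"
    by blast
  then obtain \<alpha> where \<alpha>: "\<And>c. length (\<alpha> c) = r"
    and bad: "\<And>c \<sigma>. list_all2 (\<le>) \<sigma> (\<alpha> c) \<Longrightarrow> V \<sigma> = V (\<alpha> c) \<Longrightarrow> \<not> sum_list \<sigma> \<le> c"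
    by metis
  \<comment> \<open>\<open>N (i + 1)\<close> bounds the degree of \<open>\<alpha> (N i)\<close>, so that earlier vectors are admissible witnesses later.\<close>
  define N where "N = rec_nat 0 (\<lambda>_ c. c + sum_list (\<alpha> c))"
  have N_Suc: "N (Suc i) = N i + sum_list (\<alpha> (N i))" for i by (simp add: N_def)
  have N_mono: "N i \<le> N j" if "i \<le> j" for i j
    by (rule lift_Suc_mono_le[of N, OF _ that]) (simp add: N_Suc)
  obtain g :: "nat \<Rightarrow> nat" where g: "strict_mono g"
      "\<And>i j. i \<le> j \<Longrightarrow> list_all2 (\<le>) (\<alpha> (N (g i))) (\<alpha> (N (g j)))"
    using dickson[of "\<lambda>i. \<alpha> (N i)" r] \<alpha> by blast
  have "V (\<alpha> (N (g i))) \<subseteq> V (\<alpha> (N (g (Suc i))))" for i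
    by (intro mono \<alpha> g(2)) simp
  then obtain n where n: "V (\<alpha> (N (g n))) = V (\<alpha> (N (g (Suc n))))"
    using acc[of "\<lambda>i. \<alpha> (N (g i))"] \<alpha> by blast
  have "Suc (g n) \<le> g (Suc n)" using g(1) by (simp add: strict_mono_def Suc_leI)
  then have "sum_list (\<alpha> (N (g n))) \<le> N (g (Suc n))"
    using N_mono[of "Suc (g n)" "g (Suc n)"] by (simp add: N_Suc)
  with bad[OF g(2)[of n "Suc n"] n] show False by simp
qed

lemma cdeg_single_colour:
  "set cs \<subseteq> {0} \<Longrightarrow> length \<alpha> = length cs \<Longrightarrow> cdeg cs \<alpha> = (\<lambda>i. if i = 0 then sum_list \<alpha> else 0)"
proof (induction cs arbitrary: \<alpha>)
  case (Cons c cs)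
  then show ?case by (cases \<alpha>) (auto simp: fun_eq_iff)
qed (auto simp: fun_eq_iff)

text \<open>
  Let \<open>c\<close> bound the degrees of finitely many exponent vectors that account for all leading
  coefficient submodules of \<open>L\<close>. For \<open>x \<in> L\<close> of degree \<open>n \<ge> c\<close> with leading term \<open>a^b m\<close>, the
  coefficient \<open>m\<close> already occurs at some \<open>\<sigma> \<le> b\<close> of degree at most \<open>c\<close>, in an element \<open>l \<in> L\<close>.
  Subtracting \<open>a^(b - \<sigma>) l\<close>, which lies in \<open>J^(n - c) L\<close>, lowers the leading term.
\<close>

theorem (in noetherian_module) artin_rees:
  assumes J: "ideal J R" and L: "submodule L R M"
  obtains c where "\<And>n. n \<ge> c \<Longrightarrow> 
    ideal_smult M (ideal_power R J n) (carrier M) \<inter> L \<subseteq> ideal_smult M (ideal_power R J (n - c)) L"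
proof -
  let ?e = "\<lambda>n i::nat. if i = 0 then n else 0 :: nat"
  obtain gs where gs: "\<forall>(c, a)\<in>set gs. c \<le> (0::nat) \<and> a \<in> J"
      "\<And>i. i \<le> 0 \<Longrightarrow> J = Idl {a. (i, a) \<in> set gs}"
    by (rule generating_list[of 0 "\<lambda>_. J"]) (use J in simp, blast)
  interpret generated_ideals R M 0 "\<lambda>_. J" gs
    by (intro generated_ideals.intro generated_ideals_axioms.intro module_axioms)
      (use J in simp, rule gs(1), rule gs(2))
  note JL = submodule_ideal_smult[OF R.ideal_ideal_power[OF J] L]
  have deg: "mdeg \<alpha> = ?e (sum_list \<alpha>)" if "length \<alpha> = length gs" for \<alpha>
    using cs_le that by (intro cdeg_single_colour) auto
  have pow: "Pow_M (?e n) = ideal_smult M (ideal_power R J n) (carrier M)" for n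
    using R.multi_power_single[of "\<lambda>_. J" "?e n"] J by simp
  have mon: "monom_of \<gamma> \<in> ideal_power R J (sum_list \<gamma>)" if "length \<gamma> = length gs" for \<gamma>
    using R.gmon_in_multi_power[OF I local.gs, of \<gamma>] R.multi_power_single[of "\<lambda>_. J"] J deg[OF that] by simp
  have mono: "leading L \<alpha> \<subseteq> leading L \<beta>" if hyp: "length \<beta> = length gs" "list_all2 (\<le>) \<alpha> \<beta>" for \<alpha> \<beta>
  proof -
    have len: "length \<alpha> = length gs" using hyp list_all2_lengthD by fastforce
    obtain \<gamma> where \<gamma>: "length \<gamma> = length gs" "\<beta> = vadd \<gamma> \<alpha>"
      using list_all2_le_imp_vadd[OF hyp(2)] hyp(1) by auto
    show ?thesis
      unfolding \<gamma>(2) using submodule_closed(2)[OF L mon_closed] by (intro leading_mono \<gamma>(1) len L)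
  qed
  have "\<exists>n. leading L (\<alpha> n) = leading L (\<alpha> (Suc n))"
    if inc: "\<And>i. leading L (\<alpha> i) \<subseteq> leading L (\<alpha> (Suc i))" for \<alpha> :: "nat \<Rightarrow> nat list"
  proof -
    obtain n where n: "\<And>m. m \<ge> n \<Longrightarrow> leading L (\<alpha> m) = leading L (\<alpha> n)"
      using acc[of "\<lambda>i. leading L (\<alpha> i)", OF submodule_leading[OF L] inc] by blast
    from n[of "Suc n"] show ?thesis by auto
  qed
  then obtain c where c: "\<And>\<alpha>. length \<alpha> = length gs \<Longrightarrow>
      \<exists>\<sigma>. list_all2 (\<le>) \<sigma> \<alpha> \<and> leading L \<sigma> = leading L \<alpha> \<and> sum_list \<sigma> \<le> c"
    using dickson_finite_generation[of "length gs" "leading L", OF mono] by blast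
  have main: "x \<in> ideal_smult M (ideal_power R J (n - c)) L"
    if "n \<ge> c" "T \<subseteq> exps cs (?e n)"
      "\<And>\<alpha> \<beta>. \<alpha> \<in> T \<Longrightarrow> \<beta> \<in> exps cs (?e n) \<Longrightarrow> \<beta> < \<alpha> \<Longrightarrow> \<beta> \<in> T"
      "x \<in> L" "x \<in> Idl_smult (monom_of ` T)" for n T x
  proof -
    have "finite T" using that(2) finite_exps finite_subset by blast
    then show ?thesis using that(2-)
    proof (induction T arbitrary: x rule: finite_linorder_max_induct)
      case empty
      have "Idl_smult {} \<subseteq> {\<zero>\<^bsub>M\<^esub>}" by (subst Idl_smult_subset_iff[OF _ zero_submodule]) auto
      then have "x = \<zero>\<^bsub>M\<^esub>" using empty.prems by auto
      then show ?case using submodule_zero[OF JL] by simp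
    next
      case (insert b T)
      have b: "b \<in> exps cs (?e n)" "T \<subseteq> exps cs (?e n)" using insert.prems(1) by auto
      then have blen: "length b = length gs" and bdeg: "mdeg b = ?e n" by (auto simp: exps_def)
      have "sum_list b = n" using bdeg deg[OF blen] by (auto dest: fun_cong[of _ _ 0])
      have "T = {\<beta> \<in> exps cs (?e n). \<beta> < b}"
      proof (intro equalityI subsetI)
        fix \<beta> assume "\<beta> \<in> {\<beta> \<in> exps cs (?e n). \<beta> < b}"
        then show "\<beta> \<in> T" using insert.prems(2)[of b \<beta>] by auto
      qed (use b insert.hyps(2) in auto)
      then have low: "Idl_smult (monom_of ` T) = lower b" by (simp add: lower_def bdeg)
      have down: "\<beta> \<in> T" if "\<alpha> \<in> T" "\<beta> \<in> exps cs (?e n)" "\<beta> < \<alpha>" for \<alpha> \<beta>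
        using insert.prems(2)[of \<alpha> \<beta>] insert.hyps(2) that by fastforce
      have "x \<in> (\<lambda>m. monom_of b \<odot>\<^bsub>M\<^esub> m) ` carrier M <+>\<^bsub>M\<^esub> lower b"
        using insert.prems(4) unfolding image_insert Idl_smult_insert[OF mon_image mon_closed] low .
      then obtain m w where x: "m \<in> carrier M" "w \<in> lower b" "x = monom_of b \<odot>\<^bsub>M\<^esub> m \<oplus>\<^bsub>M\<^esub> w"
        by (auto simp: set_add_iff)
      have wM: "w \<in> carrier M" using x(2) by (rule submodule_carrierD[OF submodule_lower])
      have bm: "monom_of b \<odot>\<^bsub>M\<^esub> m \<in> carrier M" using x(1) mon_closed by simp
      have "monom_of b \<odot>\<^bsub>M\<^esub> m = \<ominus>\<^bsub>M\<^esub> w \<oplus>\<^bsub>M\<^esub> x"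
        unfolding x(3) using wM bm by (simp add: M.a_lcomm[of "\<ominus>\<^bsub>M\<^esub> w"] M.l_neg)
      then have "monom_of b \<odot>\<^bsub>M\<^esub> m \<in> lower b <+>\<^bsub>M\<^esub> L"
        unfolding set_add_iff using submodule_closed(1)[OF submodule_lower x(2)] insert.prems(3) by blast
      then have "m \<in> leading L b" using x(1) by (simp add: leading_def)
      then obtain \<sigma> where \<sigma>: "list_all2 (\<le>) \<sigma> b" "m \<in> leading L \<sigma>" "sum_list \<sigma> \<le> c"
        using c[OF blen] by blast
      have \<sigma>len: "length \<sigma> = length gs" using \<sigma>(1) blen list_all2_lengthD by fastforce
      obtain \<gamma> where \<gamma>: "length \<gamma> = length gs" "b = vadd \<gamma> \<sigma>"
        using list_all2_le_imp_vadd[OF \<sigma>(1)] blen by auto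
      obtain w' l where wl: "w' \<in> lower \<sigma>" "l \<in> L" "monom_of \<sigma> \<odot>\<^bsub>M\<^esub> m = w' \<oplus>\<^bsub>M\<^esub> l"
        using \<sigma>(2) by (auto simp: leading_def set_add_iff)
      have carr: "w' \<in> carrier M" "l \<in> carrier M"
        using wl submodule_carrierD[OF submodule_lower] submodule_carrierD[OF L] by auto
      let ?gw = "monom_of \<gamma> \<odot>\<^bsub>M\<^esub> w'" and ?gl = "monom_of \<gamma> \<odot>\<^bsub>M\<^esub> l"
      have gcarr: "?gw \<in> carrier M" "?gl \<in> carrier M" using carr mon_closed by auto
      have "monom_of b \<odot>\<^bsub>M\<^esub> m = monom_of \<gamma> \<odot>\<^bsub>M\<^esub> (w' \<oplus>\<^bsub>M\<^esub> l)"
        using \<gamma> \<sigma>len x(1) mon_closed by (simp add: R.gmon_vadd[OF gs_carrier] smult_assoc1 flip: wl(3))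
      also have "\<dots> = ?gw \<oplus>\<^bsub>M\<^esub> ?gl" using carr mon_closed by (simp add: smult_r_distr)
      finally have xeq: "x = (?gw \<oplus>\<^bsub>M\<^esub> w) \<oplus>\<^bsub>M\<^esub> ?gl"
        using x(3) gcarr wM by (simp add: M.a_ac)
      then have diff: "x \<ominus>\<^bsub>M\<^esub> ?gl = ?gw \<oplus>\<^bsub>M\<^esub> w"
        using gcarr wM by (simp add: a_minus_def M.a_assoc M.r_neg)
      have "sum_list b = sum_list \<gamma> + sum_list \<sigma>"
        using cdeg_vadd[of \<gamma> cs \<sigma>] deg[OF \<gamma>(1)] deg[OF \<sigma>len] deg[OF blen] \<gamma> \<sigma>len
        by (auto dest: fun_cong[of _ _ 0])
      then have "n - c \<le> sum_list \<gamma>" using \<open>sum_list b = n\<close> \<sigma>(3) by simp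
      then have "monom_of \<gamma> \<in> ideal_power R J (n - c)"
        using mon[OF \<gamma>(1)] R.ideal_power_antimono[OF J] by blast
      then have gl: "?gl \<in> ideal_smult M (ideal_power R J (n - c)) L"
        using wl(2) by (rule ideal_smult.prod)
      have "x \<ominus>\<^bsub>M\<^esub> ?gl \<in> Idl_smult (monom_of ` T)"
        unfolding diff low using mon_smult_lower[OF \<gamma>(1) \<sigma>len wl(1)] x(2) \<gamma>(2)
        by (intro submodule_closed(3)[OF submodule_lower]) auto
      moreover have "x \<ominus>\<^bsub>M\<^esub> ?gl \<in> L"
        using insert.prems(3) wl(2) by (intro submodule_closed[OF L] mon_closed)
      ultimately have "x \<ominus>\<^bsub>M\<^esub> ?gl \<in> ideal_smult M (ideal_power R J (n - c)) L"
        using insert.IH b(2) down by blast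
      then have "(x \<ominus>\<^bsub>M\<^esub> ?gl) \<oplus>\<^bsub>M\<^esub> ?gl \<in> ideal_smult M (ideal_power R J (n - c)) L"
        using gl by (rule submodule_closed(3)[OF JL])
      then show ?case unfolding diff using xeq by simp
    qed
  qed
  have "?e n \<in> multi_index 0" for n by (simp add: multi_index_def)
  note powI = pow_eq_Idl_smult[OF this, unfolded pow]
  have "ideal_smult M (ideal_power R J n) (carrier M) \<inter> L \<subseteq> ideal_smult M (ideal_power R J (n - c)) L"
    if "n \<ge> c" for n
    unfolding powI using main[OF that order_refl] by blast
  with that show thesis by blast
qed


section \<open>Powers of ideals and primes\<close>

context cring
begin

lemma ideal_prod_subset_iff:
  assumes K: "ideal K R"
  shows "ideal_prod R I J \<subseteq> K \<longleftrightarrow> (\<forall>i\<in>I. \<forall>j\<in>J. i \<otimes> j \<in> K)"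
proof
  show "\<forall>i\<in>I. \<forall>j\<in>J. i \<otimes> j \<in> K" if "ideal_prod R I J \<subseteq> K"
    using that ideal_prod.prod[of _ I _ J R] by blast
next
  assume *: "\<forall>i\<in>I. \<forall>j\<in>J. i \<otimes> j \<in> K"
  show "ideal_prod R I J \<subseteq> K"
  proof
    fix y assume "y \<in> ideal_prod R I J"
    then show "y \<in> K"
      by induction (use * K in \<open>auto simp: ideal_def intro: additive_subgroup.a_closed\<close>)
  qed
qed

lemma ideal_power_subset_prime:
  assumes J: "ideal J R" and P: "primeideal P R" and sub: "ideal_power R J n \<subseteq> P"
  shows "J \<subseteq> P"
  using sub
proof (induction n)
  case 0
  then have "P = carrier R"
    using P by (auto simp: ideal_power_0 primeideal_def ideal_def additive_subgroup.a_subset[THEN subsetD])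
  then show ?case using primeideal.I_notcarr[OF P] by simp
next
  case (Suc n)
  then show ?case
    using primeideal_divides_ideal_prod[OF P ideal_ideal_power[OF J] J] by (auto simp: ideal_power_Suc)
qed

end

text \<open>
  An ideal that is maximal among those that contain \<open>A\<close> but no power of \<open>J\<close> is prime: two larger
  ideals contain powers of \<open>J\<close>, hence so does their product.
\<close>

lemma (in noetherian_ring) ideal_power_subset:
  assumes cring: "cring R" and J: "ideal J R" and A: "ideal A R"
    and prim: "\<And>P. primeideal P R \<Longrightarrow> A \<subseteq> P \<Longrightarrow> J \<subseteq> P"
  shows "\<exists>m. ideal_power R J m \<subseteq> A"
proof (rule ccontr)
  interpret cring R by (rule cring)
  assume none: "\<not> ?thesis"
  let ?S = "{B. ideal B R \<and> A \<subseteq> B \<and> (\<forall>m. \<not> ideal_power R J m \<subseteq> B)}"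
  have "A \<in> ?S" using A none by blast
  then obtain B where B: "B \<in> ?S" and max: "\<And>C. C \<in> ?S \<Longrightarrow> B \<subseteq> C \<Longrightarrow> C = B"
    using acc_imp_maximal[of "\<lambda>I. ideal I R" A ?S] ideal_acc by blast
  then have B': "ideal B R" "A \<subseteq> B" "\<And>m. \<not> ideal_power R J m \<subseteq> B" by auto
  have "primeideal B R"
  proof (rule divides_ideal_prod_imp_primeideal[OF B'(1)])
    show "B \<noteq> carrier R"
      using B'(3)[of 0] by (auto simp: ideal_power_0)
    fix I\<^sub>1 I\<^sub>2 assume I: "ideal I\<^sub>1 R" "ideal I\<^sub>2 R" "ideal_prod R I\<^sub>1 I\<^sub>2 \<subseteq> B"
    show "I\<^sub>1 \<subseteq> B \<or> I\<^sub>2 \<subseteq> B"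
    proof (rule ccontr)
      assume neither: "\<not> (I\<^sub>1 \<subseteq> B \<or> I\<^sub>2 \<subseteq> B)"
      have power: "\<exists>s. ideal_power R J s \<subseteq> B <+>\<^bsub>R\<^esub> I'" if I': "ideal I' R" "\<not> I' \<subseteq> B" for I'
      proof -
        have BI: "ideal (B <+>\<^bsub>R\<^esub> I') R" by (rule add_ideals[OF B'(1) I'(1)])
        have eq: "B <+>\<^bsub>R\<^esub> I' = Idl (B \<union> I')" using union_genideal[OF B'(1) I'(1)] by simp
        have "B \<union> I' \<subseteq> B <+>\<^bsub>R\<^esub> I'"
          unfolding eq using B'(1) I'(1) by (intro genideal_self) (auto dest: ideal.Icarr)
        then have "B \<subseteq> B <+>\<^bsub>R\<^esub> I'" "B <+>\<^bsub>R\<^esub> I' \<noteq> B" using I'(2) by auto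
        then have "B <+>\<^bsub>R\<^esub> I' \<notin> ?S" using max[of "B <+>\<^bsub>R\<^esub> I'"] by blast
        then show ?thesis using BI B'(2) \<open>B \<subseteq> B <+>\<^bsub>R\<^esub> I'\<close> by blast
      qed
      obtain s t where st: "ideal_power R J s \<subseteq> B <+>\<^bsub>R\<^esub> I\<^sub>1" "ideal_power R J t \<subseteq> B <+>\<^bsub>R\<^esub> I\<^sub>2"
        using power[OF I(1)] power[OF I(2)] neither by blast
      have "ideal_power R J (s + t) \<subseteq> B"
        unfolding ideal_power_add[OF J] ideal_prod_subset_iff[OF B'(1)]
      proof (intro ballI)
        fix x y assume xy: "x \<in> ideal_power R J s" "y \<in> ideal_power R J t"
        have "x \<in> B <+>\<^bsub>R\<^esub> I\<^sub>1" "y \<in> B <+>\<^bsub>R\<^esub> I\<^sub>2" using xy st by auto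
        then obtain b\<^sub>1 i\<^sub>1 b\<^sub>2 i\<^sub>2 where x: "b\<^sub>1 \<in> B" "i\<^sub>1 \<in> I\<^sub>1" "x = b\<^sub>1 \<oplus> i\<^sub>1"
          and y: "b\<^sub>2 \<in> B" "i\<^sub>2 \<in> I\<^sub>2" "y = b\<^sub>2 \<oplus> i\<^sub>2"
          by (auto simp: set_add_def')
        have carr: "b\<^sub>1 \<in> carrier R" "i\<^sub>1 \<in> carrier R" "b\<^sub>2 \<in> carrier R" "i\<^sub>2 \<in> carrier R"
          using x y ideal.Icarr[OF B'(1)] ideal.Icarr[OF I(1)] ideal.Icarr[OF I(2)] by auto
        have "x \<otimes> y = b\<^sub>1 \<otimes> y \<oplus> (i\<^sub>1 \<otimes> b\<^sub>2 \<oplus> i\<^sub>1 \<otimes> i\<^sub>2)"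
          unfolding x(3) y(3) using carr by (simp add: l_distr r_distr a_ac)
        moreover have "b\<^sub>1 \<otimes> y \<in> B" unfolding y(3) using carr by (intro ideal.I_r_closed[OF B'(1) x(1)]) simp
        moreover have "i\<^sub>1 \<otimes> b\<^sub>2 \<in> B" using carr by (intro ideal.I_l_closed[OF B'(1) y(1)])
        moreover have "i\<^sub>1 \<otimes> i\<^sub>2 \<in> B" using I(3) x(2) y(2) ideal_prod.prod[of i\<^sub>1 I\<^sub>1 i\<^sub>2 I\<^sub>2 R] by blast
        ultimately show "x \<otimes> y \<in> B"
          using B'(1) by (simp add: ideal_def additive_subgroup.a_closed)
      qed
      with B'(3) show False by blast
    qed
  qed
  then have "J \<subseteq> B" using prim B'(2) by blast
  moreover have "ideal_power R J 1 = J" by (rule ideal_power_1[OF J])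
  ultimately show False using B'(3)[of 1] by simp
qed


section \<open>Linear growth bounds the dimension\<close>

lemma quadratic_exceeds_linear:
  assumes "\<And>k::nat. (\<Sum>i\<le>k. i) \<le> C * (k * q + c)"
  shows False
proof -
  \<comment> \<open>Twice the left side is \<open>k (k + 1)\<close>, twice the right side at most \<open>2 C (q + c) k\<close>.\<close>
  define k where "k = 2 * C * (q + c) + 1"
  have "2 * (\<Sum>i\<le>k. i) = k * (k + 1)"
    using gauss_sum_nat[of k] by (simp add: atMost_atLeast0)
  then have "k * (k + 1) \<le> 2 * (C * (k * q + c))"
    using assms[of k] by linarith
  also have "\<dots> \<le> 2 * (C * (k * q + k * c))"
    by (intro mult_left_mono add_left_mono) (simp_all add: k_def)
  also have "\<dots> = (k - 1) * k" by (simp add: k_def algebra_simps)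
  also have "\<dots> < k * (k + 1)" by (simp add: k_def)
  finally show False by simp
qed

context local_noetherian_module
begin

abbreviation "ipow J n A \<equiv> ideal_smult M (ideal_power R J n) A"

lemma submodule_ipow: "ideal J R \<Longrightarrow> submodule A R M \<Longrightarrow> submodule (ipow J n A) R M"
  by (intro submodule_ideal_smult R.ideal_ideal_power)

lemma ipow_Suc: "ideal J R \<Longrightarrow> submodule A R M \<Longrightarrow> ipow J (Suc n) A = ideal_smult M J (ipow J n A)"
  using ideal_smult_ideal_prod[OF _ R.ideal_ideal_power, of J J A n]
    R.ideal_prod_commute[OF R.ideal_ideal_power, of J J n]
  by (simp add: R.ideal_power_Suc)

lemma ipow_antimono: "ideal J R \<Longrightarrow> m \<le> n \<Longrightarrow> ipow J n A \<subseteq> ipow J m A"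
  by (intro ideal_smult_mono R.ideal_power_antimono) auto

lemma ipow_subset: "ideal J R \<Longrightarrow> submodule A R M \<Longrightarrow> ipow J n A \<subseteq> A"
  by (intro ideal_smult_subset R.ideal_ideal_power)

text \<open>
  Choose \<open>z \<in> A\<close> whose annihilator \<open>Q\<close> is a prime contained in \<open>P\<^sub>0\<close>, and \<open>y \<in> P\<^sub>1\<close> outside \<open>P\<^sub>0\<close>.
  Let \<open>Z = R z\<close> and \<open>W = y Z\<close>, which is isomorphic to \<open>Z\<close>. The length \<open>D n\<close> of \<open>Z / J^n Z\<close> grows at
  most linearly, by the Artin-Rees lemma for \<open>Z\<close>. On the other hand, the Artin-Rees lemma for \<open>W\<close>
  gives \<open>D (n + q) \<ge> D n + E (n + q)\<close>, where \<open>E n\<close> is the length of \<open>Z / (J^n Z + W)\<close>. The submodules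
  \<open>J^n Z + W\<close> descend strictly: otherwise \<open>J^n Z \<subseteq> W\<close> by Nakayama's lemma, hence \<open>J \<subseteq> P\<^sub>1\<close> and
  \<open>P\<^sub>1\<close> is maximal. So \<open>E n \<ge> n\<close>, and \<open>D\<close> grows quadratically.
\<close>

theorem no_long_prime_chain:
  assumes J: "ideal J R" "J \<subseteq> \<nn>" and prim: "\<And>P. primeideal P R \<Longrightarrow> J \<subseteq> P \<Longrightarrow> P = \<nn>"
    and A: "submodule A R M"
    and growth: "\<And>n. sub_len R M (ipow J n A) A \<le> enat (C * (n + 1))"
    and P: "primeideal P\<^sub>0 R" "primeideal P\<^sub>1 R" "primeideal P\<^sub>2 R" "P\<^sub>0 \<subset> P\<^sub>1" "P\<^sub>1 \<subset> P\<^sub>2"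
    and ann: "residual R M {\<zero>\<^bsub>M\<^esub>} A \<subseteq> P\<^sub>0"
  shows False
proof -
  note Z = zero_submodule
  obtain z where z: "z \<in> A" "primeideal (residual R M {\<zero>\<^bsub>M\<^esub>} {z}) R" "residual R M {\<zero>\<^bsub>M\<^esub>} {z} \<subseteq> P\<^sub>0"
  proof -
    obtain z\<^sub>0 where "z\<^sub>0 \<in> A" "residual R M {\<zero>\<^bsub>M\<^esub>} {z\<^sub>0} \<subseteq> P\<^sub>0"
      using residual_of_element_below_prime[OF A P(1) ann] .
    then show thesis using prime_residual_below[OF Z A P(1)] that by blast
  qed
  define Q where "Q = residual R M {\<zero>\<^bsub>M\<^esub>} {z}"
  have zM: "z \<in> carrier M" by (rule submodule_carrierD[OF A z(1)])
  have Q: "primeideal Q R" "Q \<subseteq> P\<^sub>0" and Q_iff: "\<And>r. r \<in> Q \<longleftrightarrow> r \<in> carrier R \<and> r \<odot>\<^bsub>M\<^esub> z = \<zero>\<^bsub>M\<^esub>"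
    using z by (auto simp: Q_def residual_def)
  obtain y where y: "y \<in> P\<^sub>1" "y \<notin> P\<^sub>0" using P(4) by blast
  have P1: "ideal P\<^sub>1 R" using P(2) by (simp add: primeideal_def)
  have yR: "y \<in> carrier R" using y(1) by (rule ideal_carrierD[OF P1])
  let ?Z = "cyclic R M z"
  note Rz = submodule_cyclic[OF zM]
  interpret \<phi>: linear_map R M M "\<lambda>m. y \<odot>\<^bsub>M\<^esub> m" by (rule smult_linear_map[OF yR])
  define W where "W = (\<lambda>m. y \<odot>\<^bsub>M\<^esub> m) ` ?Z"
  have W: "submodule W R M" unfolding W_def by (rule \<phi>.submodule_image[OF Rz])
  have WZ: "W \<subseteq> ?Z" using submodule_closed(2)[OF Rz yR] by (auto simp: W_def)
  have ZA: "?Z \<subseteq> A" using cyclic_subset_iff[OF A zM] z(1) by simp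
  note JZ = submodule_ipow[OF J(1) Rz]
  define D where "D n = sub_len R M (ipow J n ?Z) ?Z" for n
  have kerZ: "\<phi>.ker \<inter> ?Z \<subseteq> {\<zero>\<^bsub>M\<^esub>}"
  proof
    fix m assume "m \<in> \<phi>.ker \<inter> ?Z"
    then obtain r where r: "r \<in> carrier R" "m = r \<odot>\<^bsub>M\<^esub> z" "y \<odot>\<^bsub>M\<^esub> m = \<zero>\<^bsub>M\<^esub>"
      by (auto simp: \<phi>.ker_def cyclic_def)
    then have "y \<otimes> r \<in> Q" using yR zM by (simp add: Q_iff smult_assoc1)
    moreover have "y \<notin> Q" using y(2) Q(2) by blast
    ultimately have "r \<in> Q" using primeideal.I_prime[OF Q(1) yR r(1)] by blast
    then show "m \<in> {\<zero>\<^bsub>M\<^esub>}" using r(2) by (simp add: Q_iff)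
  qed
  have D_W: "sub_len R M (ipow J n W) W = D n" for n
  proof -
    have "ipow J n W = (\<lambda>m. y \<odot>\<^bsub>M\<^esub> m) ` ipow J n ?Z"
      unfolding W_def by (rule \<phi>.image_ideal_smult[OF R.ideal_ideal_power[OF J(1)] Rz, symmetric])
    then have "sub_len R M (ipow J n W) W = sub_len R M (ipow J n ?Z <+>\<^bsub>M\<^esub> (\<phi>.ker \<inter> ?Z)) ?Z"
      unfolding W_def using \<phi>.sub_len_image_Int[OF Rz JZ ipow_subset[OF J(1) Rz]] by simp
    also have "ipow J n ?Z <+>\<^bsub>M\<^esub> (\<phi>.ker \<inter> ?Z) = ipow J n ?Z"
      using kerZ submodule_zero[OF JZ, of n]
      by (intro set_add_absorb JZ submodule_Int \<phi>.submodule_ker Rz) blast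
    finally show ?thesis by (simp add: D_def)
  qed
  obtain c where c: "\<And>n. n \<ge> c \<Longrightarrow> ipow J n (carrier M) \<inter> ?Z \<subseteq> ipow J (n - c) ?Z"
    using artin_rees[OF J(1) Rz] by blast
  obtain c' where c': "\<And>n. n \<ge> c' \<Longrightarrow> ipow J n (carrier M) \<inter> W \<subseteq> ipow J (n - c') W"
    using artin_rees[OF J(1) W] by blast
  have D_le: "D n \<le> enat (C * (n + (c + 1)))" for n
  proof -
    note JA = submodule_ipow[OF J(1) A, of "n + c"]
    have "ipow J (n + c) A \<subseteq> ipow J (n + c) (carrier M)"
      using submoduleE(1)[OF A] by (intro ideal_smult_mono) auto
    then have "?Z \<inter> ipow J (n + c) A \<subseteq> ipow J n ?Z" using c[of "n + c"] by auto
    then have "D n \<le> sub_len R M (?Z \<inter> ipow J (n + c) A) ?Z"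
      unfolding D_def by (intro sub_len_mono) auto
    also have "\<dots> = sub_len R M (ipow J (n + c) A) (?Z <+>\<^bsub>M\<^esub> ipow J (n + c) A)"
      by (rule sub_len_second_iso[OF Rz JA, symmetric])
    also have "\<dots> \<le> sub_len R M (ipow J (n + c) A) A"
      by (intro sub_len_mono set_add_least A ZA ipow_subset J(1)) simp
    also have "\<dots> \<le> enat (C * (n + (c + 1)))" using growth[of "n + c"] by (simp add: add.assoc)
    finally show ?thesis .
  qed
  define E where "E n = sub_len R M (ipow J n ?Z <+>\<^bsub>M\<^esub> W) ?Z" for n
  note JZW = submodule_set_add[OF JZ W]
  have JZW_le: "ipow J n ?Z <+>\<^bsub>M\<^esub> W \<subseteq> ?Z" for n
    by (intro set_add_least Rz WZ ipow_subset J(1))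
  have E_ge: "enat n \<le> E n" for n
  proof (induction n)
    case (Suc n)
    have sub: "ipow J (Suc n) ?Z <+>\<^bsub>M\<^esub> W \<subseteq> ipow J n ?Z <+>\<^bsub>M\<^esub> W"
      by (intro set_add_mono ipow_antimono J(1)) auto
    have "ipow J (Suc n) ?Z <+>\<^bsub>M\<^esub> W \<noteq> ipow J n ?Z <+>\<^bsub>M\<^esub> W"
    proof
      assume eq: "ipow J (Suc n) ?Z <+>\<^bsub>M\<^esub> W = ipow J n ?Z <+>\<^bsub>M\<^esub> W"
      have "ipow J n ?Z \<subseteq> ideal_smult M J (ipow J n ?Z) <+>\<^bsub>M\<^esub> W"
        using eq set_add_upper1[OF JZ W, of n] unfolding ipow_Suc[OF J(1) Rz] by simp
      then have sub: "ipow J n ?Z \<subseteq> W" by (rule nakayama[OF J JZ W])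
      have "ideal_power R J n \<subseteq> P\<^sub>1"
      proof
        fix a assume a: "a \<in> ideal_power R J n"
        have aR: "a \<in> carrier R" using a by (rule ideal_carrierD[OF R.ideal_ideal_power[OF J(1)]])
        have "a \<odot>\<^bsub>M\<^esub> z \<in> ipow J n ?Z" using a cyclic_self[OF zM] by (rule ideal_smult.prod)
        with sub obtain r where r: "r \<in> carrier R" "a \<odot>\<^bsub>M\<^esub> z = y \<odot>\<^bsub>M\<^esub> (r \<odot>\<^bsub>M\<^esub> z)"
          by (auto simp: W_def cyclic_def)
        have "(a \<ominus> y \<otimes> r) \<odot>\<^bsub>M\<^esub> z = a \<odot>\<^bsub>M\<^esub> z \<ominus>\<^bsub>M\<^esub> y \<odot>\<^bsub>M\<^esub> (r \<odot>\<^bsub>M\<^esub> z)"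
          using aR yR r(1) zM
          by (simp add: R.minus_eq a_minus_def smult_l_distr smult_l_minus smult_assoc1)
        also have "\<dots> = \<zero>\<^bsub>M\<^esub>" using r yR zM by (simp add: a_minus_def M.r_neg)
        finally have "a \<ominus> y \<otimes> r \<in> Q" using aR yR r(1) by (simp add: Q_iff)
        then have "a \<ominus> y \<otimes> r \<in> P\<^sub>1" using Q(2) P(4) by blast
        moreover have "y \<otimes> r \<in> P\<^sub>1" using ideal.I_r_closed[OF P1 y(1) r(1)] .
        ultimately have "(a \<ominus> y \<otimes> r) \<oplus> y \<otimes> r \<in> P\<^sub>1"
          using P1 by (simp add: ideal_def additive_subgroup.a_closed)
        then show "a \<in> P\<^sub>1" using aR yR r(1) by (simp add: R.minus_eq R.a_assoc R.l_neg)
      qed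
      then have "J \<subseteq> P\<^sub>1" by (rule R.ideal_power_subset_prime[OF J(1) P(2)])
      then have "P\<^sub>1 = \<nn>" by (rule prim[OF P(2)])
      with P(5) prime_le[OF P(3)] show False by blast
    qed
    with sub have "ipow J (Suc n) ?Z <+>\<^bsub>M\<^esub> W \<subset> ipow J n ?Z <+>\<^bsub>M\<^esub> W" by (simp add: psubset_eq)
    then have "1 \<le> sub_len R M (ipow J (Suc n) ?Z <+>\<^bsub>M\<^esub> W) (ipow J n ?Z <+>\<^bsub>M\<^esub> W)"
      by (rule one_le_sub_len[OF JZW JZW])
    then have "enat n + 1 \<le> E n + sub_len R M (ipow J (Suc n) ?Z <+>\<^bsub>M\<^esub> W) (ipow J n ?Z <+>\<^bsub>M\<^esub> W)"
      by (intro add_mono Suc.IH)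
    also have "\<dots> = E (Suc n)"
      unfolding E_def using sub_len_add[OF JZW JZW Rz sub JZW_le] by (simp add: add.commute)
    finally show ?case by (simp add: one_enat_def)
  qed (simp add: zero_enat_def[symmetric])
  \<comment> \<open>The increment \<open>1\<close> keeps \<open>q\<close> positive when the constant of the Artin-Rees lemma is \<open>0\<close>.\<close>
  define q where "q = c' + 1"
  have D_step: "D n + enat (n + q) \<le> D (n + q)" for n
  proof -
    have "W \<inter> ipow J (n + q) ?Z \<subseteq> W \<inter> ipow J (n + q) (carrier M)"
      using submoduleE(1)[OF Rz] ideal_smult_mono[OF order_refl] by blast
    also have "\<dots> \<subseteq> ipow J (n + 1) W" using c'[of "n + q"] by (auto simp: q_def)
    also have "\<dots> \<subseteq> ipow J n W" by (intro ipow_antimono J(1)) simp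
    finally have "D n \<le> sub_len R M (W \<inter> ipow J (n + q) ?Z) W"
      unfolding D_W[symmetric] by (intro sub_len_mono) auto
    also have "\<dots> = sub_len R M (ipow J (n + q) ?Z) (ipow J (n + q) ?Z <+>\<^bsub>M\<^esub> W)"
      using sub_len_second_iso[OF W JZ] set_add_commute[OF W JZ] by simp
    finally have "D n + enat (n + q) \<le>
        sub_len R M (ipow J (n + q) ?Z) (ipow J (n + q) ?Z <+>\<^bsub>M\<^esub> W) + E (n + q)"
      using E_ge by (intro add_mono)
    also have "\<dots> = D (n + q)"
      unfolding E_def D_def
      by (rule sub_len_add[OF JZ JZW Rz set_add_upper1[OF JZ W] JZW_le, symmetric])
    finally show ?thesis .
  qed
  have "enat (\<Sum>i\<le>k. i) \<le> D (k * q)" for k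
  proof (induction k)
    case (Suc k)
    have "enat (\<Sum>i\<le>Suc k. i) \<le> enat (\<Sum>i\<le>k. i) + enat (k * q + q)"
      by (simp add: q_def)
    also have "\<dots> \<le> D (k * q) + enat (k * q + q)" by (intro add_mono Suc.IH order_refl)
    also have "\<dots> \<le> D (Suc k * q)" using D_step[of "k * q"] by (simp add: add.commute)
    finally show ?case .
  qed (simp add: zero_enat_def[symmetric])
  then have "enat (\<Sum>i\<le>k. i) \<le> enat (C * (k * q + (c + 1)))" for k
    using D_le order_trans by blast
  then have "(\<Sum>i\<le>k. i) \<le> C * (k * q + (c + 1))" for k
    by (simp only: enat_ord_simps)
  then show False by (rule quadratic_exceeds_linear)
qed

end


section \<open>Torsion-free modules with constant Hilbert function\<close>

lemma mvpoly_0_evpoly: "mvpoly 0 F \<Longrightarrow> evpoly (\<lambda>n. F (\<lambda>i. if i = 0 then n else 0))"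
proof (induction rule: mvpoly.induct)
  case (prod g)
  have "evpoly (g 0)" by (rule prod) simp
  then show ?case by simp
next
  case (add F G)
  then show ?case by (intro evpoly_add)
qed

lemma rat_poly_eqI:
  fixes p q :: "rat poly"
  assumes "\<And>n::nat. n \<ge> m \<Longrightarrow> Polynomial.poly p (of_nat n) = Polynomial.poly q (of_nat n)"
  shows "p = q"
proof (rule ccontr)
  assume "p \<noteq> q"
  then have "finite {x. Polynomial.poly (p - q) x = 0}" by (intro poly_roots_finite) simp
  moreover have "of_nat ` {m..} \<subseteq> {x. Polynomial.poly (p - q) x = 0}" using assms by auto
  ultimately have "finite (of_nat ` {m..} :: rat set)" by (rule finite_subset[rotated])
  then have "finite {m..}" by (rule finite_imageD) (simp add: inj_on_def)
  then show False by (simp add: infinite_Ici)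
qed

lemma (in module) sub_len_filtration_sum:
  assumes F: "\<And>k::nat. submodule (F k) R M" and dec: "\<And>k. F (Suc k) \<subseteq> F k"
    and h: "\<And>k. sub_len R M (F (Suc k)) (F k) = enat (h k)"
  shows "sub_len R M (F n) (F 0) = enat (\<Sum>k<n. h k)"
proof (induction n)
  case 0
  then show ?case using sub_len_eq_0_iff[OF F F, of 0 0] by (simp add: zero_enat_def)
next
  case (Suc n)
  have "F n \<subseteq> F 0" using dec by (rule lift_Suc_antimono_le) simp
  then have "sub_len R M (F (Suc n)) (F 0) = sub_len R M (F (Suc n)) (F n) + sub_len R M (F n) (F 0)"
    by (intro sub_len_add F dec)
  then show ?case using Suc h[of n] by (simp add: add.commute)
qed

lemma (in local_noetherian_module) hilbert_mvpoly:
  assumes I: "\<forall>i\<le>d. ideal (I i) R" and J: "I 0 \<subseteq> \<nn>"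
    and prim: "\<And>P. primeideal P R \<Longrightarrow> I 0 \<subseteq> P \<Longrightarrow> P = \<nn>"
  shows "\<exists>F. mvpoly d F \<and> (\<forall>n\<in>multi_index d. \<exists>l.
    sub_len R M (ideal_smult M (multi_power R d I (n(0 := Suc (n 0)))) (carrier M))
      (ideal_smult M (multi_power R d I n) (carrier M)) = enat l \<and> int l = F n)"
proof -
  obtain gs where gs: "\<forall>(c, a)\<in>set gs. c \<le> d \<and> a \<in> I c"
      "\<And>i. i \<le> d \<Longrightarrow> I i = Idl {a. (i, a) \<in> set gs}"
    using generating_list[OF I] by blast
  interpret generated_ideals R M d I gs
    by (intro generated_ideals.intro generated_ideals_axioms.intro module_axioms I gs)
  show ?thesis
    using I J prim by (intro hilbert_function_mvpoly finite_length_mod_primary) auto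
qed

text \<open>
  The situation after dividing by a weak-(FC)-sequence and by the torsion: the Hilbert function
  has the constant value \<open>e\<close> from \<open>n\<^sub>0\<close> on.
\<close>

locale torsion_free_constant = local_noetherian_module R M \<nn>
  for R (structure) and M (structure) and \<nn> +
  fixes d :: nat and I :: "nat \<Rightarrow> 'a set" and n\<^sub>0 e :: nat
  assumes I: "\<forall>i\<le>d. ideal (I i) R" and J: "I 0 \<subseteq> \<nn>"
    and prim: "\<And>P. primeideal P R \<Longrightarrow> I 0 \<subseteq> P \<Longrightarrow> P = \<nn>"
    and torsion_free: "\<And>s m. m \<in> carrier M \<Longrightarrow>
      (\<forall>a\<in>ideal_power R (ideals_product R d I) s. a \<odot>\<^bsub>M\<^esub> m = \<zero>\<^bsub>M\<^esub>) \<Longrightarrow> m = \<zero>\<^bsub>M\<^esub>"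
    and const: "\<And>n. n \<in> multi_index d \<Longrightarrow> \<forall>i\<le>d. n\<^sub>0 \<le> n i \<Longrightarrow>
      sub_len R M (ideal_smult M (multi_power R d I (n(0 := Suc (n 0)))) (carrier M))
        (ideal_smult M (multi_power R d I n) (carrier M)) = enat e"
    and nonzero: "carrier M \<noteq> {\<zero>\<^bsub>M\<^esub>}"
begin

abbreviation "J \<equiv> I 0"

lemma J_ideal: "ideal J R" using I by simp

definition v :: "nat \<Rightarrow> nat \<Rightarrow> nat" where
  "v k = (\<lambda>i. if i = 0 then k else if i \<le> d then n\<^sub>0 else 0)"

lemma v_multi_index: "v k \<in> multi_index d"
  by (simp add: v_def multi_index_def)

lemma v_Suc: "(v k)(0 := Suc (v k 0)) = v (Suc k)"
  by (auto simp: v_def fun_eq_iff)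

definition "\<bb> = multi_power R d I (v 0)"
definition "B = ideal_smult M \<bb> (carrier M)"

lemma bb_ideal: "ideal \<bb> R" unfolding \<bb>_def by (rule R.multi_power_ideal[OF I])

lemma submodule_B: "submodule B R M"
  unfolding B_def by (rule submodule_ideal_smult[OF bb_ideal carrier_is_submodule])

lemma pow_v: "ideal_smult M (multi_power R d I (v k)) (carrier M) = ipow J k B"
proof (induction k)
  case 0
  show ?case
    using ideal_smult_one[OF submodule_B] by (simp add: R.ideal_power_0 B_def \<bb>_def)
next
  case (Suc k)
  note mp = R.multi_power_ideal[OF I, of "v k"]
  have "multi_power R d I (v (Suc k)) = ideal_prod R J (multi_power R d I (v k))"
    unfolding v_Suc[symmetric] R.multi_power_Suc[OF I le0]
    by (rule R.ideal_prod_commute[OF mp J_ideal])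
  then show ?case
    using ideal_smult_ideal_prod[OF J_ideal mp carrier_is_submodule] Suc
      ipow_Suc[OF J_ideal submodule_B] by simp
qed

lemma power_product_subset_bb: "ideal_power R (ideals_product R d I) n\<^sub>0 \<subseteq> \<bb>"
  unfolding R.multi_power_const[OF I, symmetric] \<bb>_def
  by (rule R.multi_power_antimono[OF I]) (simp add: v_def)

lemma bb_torsion_free: "m \<in> carrier M \<Longrightarrow> (\<forall>a\<in>\<bb>. a \<odot>\<^bsub>M\<^esub> m = \<zero>\<^bsub>M\<^esub>) \<Longrightarrow> m = \<zero>\<^bsub>M\<^esub>"
  using torsion_free[of m n\<^sub>0] power_product_subset_bb by blast

lemma ideal_smult_eq_zero:
  assumes K: "\<And>m. m \<in> carrier M \<Longrightarrow> (\<forall>a\<in>K. a \<odot>\<^bsub>M\<^esub> m = \<zero>\<^bsub>M\<^esub>) \<Longrightarrow> m = \<zero>\<^bsub>M\<^esub>"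
  shows "\<not> ideal_smult M K (carrier M) \<subseteq> {\<zero>\<^bsub>M\<^esub>}"
proof
  assume "ideal_smult M K (carrier M) \<subseteq> {\<zero>\<^bsub>M\<^esub>}"
  then have "\<forall>a\<in>K. \<forall>m\<in>carrier M. a \<odot>\<^bsub>M\<^esub> m = \<zero>\<^bsub>M\<^esub>"
    unfolding ideal_smult_subset_iff[OF zero_submodule] by simp
  then have "carrier M = {\<zero>\<^bsub>M\<^esub>}" using K by auto
  with nonzero show False by contradiction
qed

lemma power_smult_nonzero:
  "\<not> ideal_smult M (ideal_power R (ideals_product R d I) s) (carrier M) \<subseteq> {\<zero>\<^bsub>M\<^esub>}"
  by (rule ideal_smult_eq_zero) (rule torsion_free)

lemma const_Y: "k \<ge> n\<^sub>0 \<Longrightarrow> sub_len R M (ipow J (Suc k) B) (ipow J k B) = enat e"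
  using const[OF v_multi_index, of k] unfolding v_Suc pow_v by (auto simp: v_def)

text \<open>
  If \<open>e = 0\<close>, then \<open>J^(n\<^sub>0 + 1) B = J^n\<^sub>0 B\<close>, and Nakayama's lemma makes this \<open>0\<close>, so that a power of
  the product of all ideals annihilates \<open>M\<close>.
\<close>

theorem e_nonzero: "e \<noteq> 0"
proof
  assume "e = 0"
  let ?Y = "ipow J n\<^sub>0 B"
  note Y = submodule_ipow[OF J_ideal submodule_B]
  have "ipow J (Suc n\<^sub>0) B = ?Y"
    using const_Y[of n\<^sub>0] \<open>e = 0\<close> sub_len_eq_0_iff[OF Y Y ipow_antimono[OF J_ideal], of n\<^sub>0 "Suc n\<^sub>0"]
    by (simp add: zero_enat_def)
  then have "?Y \<subseteq> ideal_smult M J ?Y <+>\<^bsub>M\<^esub> {\<zero>\<^bsub>M\<^esub>}"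
    using set_add_upper1[OF Y zero_submodule, of n\<^sub>0] ipow_Suc[OF J_ideal submodule_B] by simp
  then have "?Y \<subseteq> {\<zero>\<^bsub>M\<^esub>}" by (rule nakayama[OF J_ideal J Y zero_submodule])
  moreover have "ideal_smult M (ideal_power R (ideals_product R d I) n\<^sub>0) (carrier M) \<subseteq> ?Y"
    unfolding pow_v[symmetric] R.multi_power_const[OF I, symmetric]
    by (intro ideal_smult_mono R.multi_power_antimono[OF I]) (simp_all add: v_def)
  ultimately have "ideal_smult M (ideal_power R (ideals_product R d I) n\<^sub>0) (carrier M) \<subseteq> {\<zero>\<^bsub>M\<^esub>}"
    by (rule order_trans[rotated])
  with power_smult_nonzero show False by contradiction
qed

text \<open>
  If \<open>r\<close> annihilates \<open>B = \<bb> M\<close>, then \<open>\<bb>\<close> annihilates \<open>r M\<close>, which is \<open>0\<close> by torsion-freeness.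
\<close>

lemma annihilator_eq: "residual R M {\<zero>\<^bsub>M\<^esub>} B = module_annihilator R M"
proof (intro equalityI subsetI)
  fix r assume r: "r \<in> residual R M {\<zero>\<^bsub>M\<^esub>} B"
  then have rR: "r \<in> carrier R" by (simp add: residual_def)
  have "r \<odot>\<^bsub>M\<^esub> m = \<zero>\<^bsub>M\<^esub>" if m: "m \<in> carrier M" for m
  proof (rule bb_torsion_free)
    show "\<forall>a\<in>\<bb>. a \<odot>\<^bsub>M\<^esub> (r \<odot>\<^bsub>M\<^esub> m) = \<zero>\<^bsub>M\<^esub>"
    proof
      fix a assume a: "a \<in> \<bb>"
      have aR: "a \<in> carrier R" using a by (rule ideal_carrierD[OF bb_ideal])
      have "a \<odot>\<^bsub>M\<^esub> m \<in> B" unfolding B_def using a m by (rule ideal_smult.prod)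
      then have "r \<odot>\<^bsub>M\<^esub> (a \<odot>\<^bsub>M\<^esub> m) = \<zero>\<^bsub>M\<^esub>" using r by (simp add: residual_def)
      then show "a \<odot>\<^bsub>M\<^esub> (r \<odot>\<^bsub>M\<^esub> m) = \<zero>\<^bsub>M\<^esub>"
        using aR rR m R.m_comm[of a r] by (simp flip: smult_assoc1)
    qed
  qed (use rR m in simp)
  with rR show "r \<in> module_annihilator R M" by (simp add: module_annihilator_def)
qed (use submodule_carrierD[OF submodule_B] in \<open>auto simp: module_annihilator_def residual_def\<close>)

lemma Y_lengths:
  obtains h where "\<And>k. sub_len R M (ipow J (Suc k) B) (ipow J k B) = enat (h k)"
    "\<And>k. k \<ge> n\<^sub>0 \<Longrightarrow> h k = e"
proof -
  obtain F where F: "\<forall>n\<in>multi_index d. \<exists>l.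
    sub_len R M (ideal_smult M (multi_power R d I (n(0 := Suc (n 0)))) (carrier M))
      (ideal_smult M (multi_power R d I n) (carrier M)) = enat l \<and> int l = F n"
    using hilbert_mvpoly[OF I J prim] by blast
  have "\<exists>l. sub_len R M (ipow J (Suc k) B) (ipow J k B) = enat l" for k
    using bspec[OF F v_multi_index[of k]] unfolding v_Suc pow_v by blast
  then obtain h where h: "\<And>k. sub_len R M (ipow J (Suc k) B) (ipow J k B) = enat (h k)"
    by metis
  moreover have "h k = e" if "k \<ge> n\<^sub>0" for k using const_Y[OF that] h[of k] by simp
  ultimately show thesis by (rule that)
qed

lemma B_lengths:
  obtains b where "\<And>k. sub_len R M (ipow J k B) B = enat (b k)"
    "\<And>k. k \<ge> n\<^sub>0 \<Longrightarrow> b k = b n\<^sub>0 + e * (k - n\<^sub>0)" "\<And>k. b k \<le> (b n\<^sub>0 + e) * (k + 1)"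
proof -
  obtain h where h: "\<And>k. sub_len R M (ipow J (Suc k) B) (ipow J k B) = enat (h k)"
    "\<And>k. k \<ge> n\<^sub>0 \<Longrightarrow> h k = e" by (rule Y_lengths) (rule that)
  define b where "b n = (\<Sum>k<n. h k)" for n
  have 1: "sub_len R M (ipow J k B) B = enat (b k)" for k
    using sub_len_filtration_sum[of "\<lambda>k. ipow J k B", OF submodule_ipow[OF J_ideal submodule_B] _ h(1)]
      ipow_antimono[OF J_ideal] ideal_smult_one[OF submodule_B]
    by (simp add: b_def R.ideal_power_0)
  have 2: "b k = b n\<^sub>0 + e * (k - n\<^sub>0)" if "k \<ge> n\<^sub>0" for k
    using that
  proof (induction k rule: dec_induct)
    case (step k)
    then show ?case by (simp add: b_def h(2) Suc_diff_le)
  qed simp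
  have "b k \<le> (b n\<^sub>0 + e) * (k + 1)" for k
  proof (cases "k \<ge> n\<^sub>0")
    case True
    have "b n\<^sub>0 + e * (k - n\<^sub>0) \<le> b n\<^sub>0 + e * k" by simp
    also have "\<dots> \<le> (b n\<^sub>0 + e) * (k + 1)" by (simp add: algebra_simps)
    finally show ?thesis using 2[OF True] by simp
  next
    case False
    then have "b k \<le> b n\<^sub>0" unfolding b_def by (intro sum_mono2) auto
    then show ?thesis by (simp add: algebra_simps trans_le_add1)
  qed
  with 1 2 show thesis by (rule that)
qed

lemma no_chain:
  assumes "primeideal P\<^sub>0 R" "primeideal P\<^sub>1 R" "primeideal P\<^sub>2 R" "P\<^sub>0 \<subset> P\<^sub>1" "P\<^sub>1 \<subset> P\<^sub>2"
    and "module_annihilator R M \<subseteq> P\<^sub>0"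
  shows False
proof -
  obtain b where b: "\<And>k. sub_len R M (ipow J k B) B = enat (b k)"
    "\<And>k. k \<ge> n\<^sub>0 \<Longrightarrow> b k = b n\<^sub>0 + e * (k - n\<^sub>0)" "\<And>k. b k \<le> (b n\<^sub>0 + e) * (k + 1)"
    by (rule B_lengths) (rule that)
  have growth: "sub_len R M (ipow J k B) B \<le> enat ((b n\<^sub>0 + e) * (k + 1))" for k
    unfolding b(1) enat_ord_simps by (rule b(3))
  show False
    by (rule no_long_prime_chain[OF J_ideal J prim submodule_B growth assms(1-5)])
      (use assms(6) in \<open>simp_all add: annihilator_eq\<close>)
qed

lemma annihilator_residual: "module_annihilator R M = residual R M {\<zero>\<^bsub>M\<^esub>} (carrier M)"
  by (simp add: module_annihilator_def residual_def)

lemma annihilator_ideal: "ideal (module_annihilator R M) R"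
  unfolding annihilator_residual by (rule residual_ideal[OF zero_submodule order_refl])

lemma annihilator_le: "module_annihilator R M \<subseteq> \<nn>"
proof (rule proper_ideal_le[OF annihilator_ideal])
  show "\<one> \<notin> module_annihilator R M"
    using nonzero by (auto simp: module_annihilator_def)
qed

text \<open>
  If all primes above the annihilator contained \<open>J\<close>, a power of \<open>J\<close> would annihilate \<open>M\<close>.
  So there is a prime below \<open>\<nn>\<close>, and longer chains are excluded.
\<close>

theorem dim_eq_1: "module_dim R M = 1"
proof -
  let ?Ann = "module_annihilator R M"
  have "\<exists>P. primeideal P R \<and> ?Ann \<subseteq> P \<and> \<not> J \<subseteq> P"
  proof (rule ccontr)
    assume "\<not> ?thesis"
    then obtain m where m: "ideal_power R J m \<subseteq> ?Ann"
      using ideal_power_subset[OF R.is_cring J_ideal annihilator_ideal] by blast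
    have "ideal_power R (ideals_product R d I) m \<subseteq> ideal_power R J m"
    proof -
      have "ideal_power R J m = multi_power R d I (\<lambda>i. if i = 0 then m else 0)"
      proof (induction m)
        case 0
        then show ?case using R.multi_power_zero[OF I] by (simp add: R.ideal_power_0)
      next
        case (Suc m)
        have eq: "(\<lambda>i. if i = 0 then m else 0)(0 := Suc (if (0::nat) = 0 then m else 0)) =
            (\<lambda>i. if i = 0 then Suc m else 0)" by auto
        show ?case
          using R.multi_power_Suc[OF I le0, of "\<lambda>i. if i = 0 then m else 0"]
          unfolding eq R.ideal_power_Suc Suc by (rule sym)
      qed
      then show ?thesis
        using R.multi_power_antimono[OF I, of "\<lambda>i. if i = 0 then m else 0" "\<lambda>_. m"]
        by (simp add: R.multi_power_const[OF I])
    qed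
    with m have "ideal_smult M (ideal_power R (ideals_product R d I) m) (carrier M) \<subseteq> {\<zero>\<^bsub>M\<^esub>}"
      unfolding ideal_smult_subset_iff[OF zero_submodule] module_annihilator_def by blast
    with power_smult_nonzero show False by contradiction
  qed
  then obtain P where P: "primeideal P R" "?Ann \<subseteq> P" "\<not> J \<subseteq> P" by blast
  then have "P \<subset> \<nn>" using prime_le[OF P(1)] J by blast
  let ?D = "{ereal (real n) | n. \<exists>P :: nat \<Rightarrow> 'a set.
     (\<forall>i\<le>n. primeideal (P i) R \<and> ?Ann \<subseteq> P i) \<and> (\<forall>i<n. P i \<subset> P (Suc i))}"
  have "ereal (real 1) \<in> ?D"
    using P \<open>P \<subset> \<nn>\<close> prime_max_ideal annihilator_le
    by (intro CollectI exI[of _ 1] conjI refl exI[of _ "\<lambda>i. if i = 0 then P else \<nn>"])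
      (auto simp: le_Suc_eq)
  then have "ereal (real 1) \<le> Sup ?D" by (rule Sup_upper)
  moreover have "Sup ?D \<le> ereal (real 1)"
  proof (rule Sup_least)
    fix x assume "x \<in> ?D"
    then obtain n Q where x: "x = ereal (real n)"
      and Q: "\<forall>i\<le>n. primeideal (Q i) R \<and> ?Ann \<subseteq> Q i" "\<forall>i<n. Q i \<subset> Q (Suc i)" by blast
    have "n \<le> 1"
    proof (rule ccontr)
      assume n: "\<not> n \<le> 1"
      have "Q 0 \<subset> Q 1" "Q 1 \<subset> Q 2"
        using n Q(2)[rule_format, of 0] Q(2)[rule_format, of 1] by (auto simp: numeral_2_eq_2)
      moreover have "primeideal (Q 0) R" "primeideal (Q 1) R" "primeideal (Q 2) R" "?Ann \<subseteq> Q 0"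
        using n Q(1) by auto
      ultimately show False using no_chain by blast
    qed
    then show "x \<le> ereal (real 1)" by (simp add: x)
  qed
  ultimately show ?thesis by (simp add: module_dim_def one_ereal_def)
qed

text \<open>
  A prime \<open>P \<noteq> \<nn>\<close> above \<open>B : M\<close> would, as the dimension is \<open>1\<close>, be the annihilator of some \<open>z\<close>;
  then \<open>\<bb> \<subseteq> P\<close> annihilates \<open>z\<close>, against torsion-freeness.
\<close>

lemma J_power_in_B: "\<exists>m. ipow J m (carrier M) \<subseteq> B"
proof -
  let ?C = "residual R M B (carrier M)"
  have C: "ideal ?C R" by (rule residual_ideal[OF submodule_B order_refl])
  have "\<bb> \<subseteq> ?C"
    using ideal_smult_subset_iff_residual[OF submodule_B, of \<bb>] ideal_carrierD[OF bb_ideal]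
    unfolding B_def by blast
  have "J \<subseteq> P" if P: "primeideal P R" "?C \<subseteq> P" for P
  proof (rule ccontr)
    assume "\<not> J \<subseteq> P"
    then have lt: "P \<subset> \<nn>" using prime_le[OF P(1)] J by blast
    have "module_annihilator R M \<subseteq> ?C"
      using submodule_zero[OF submodule_B] by (auto simp: module_annihilator_def residual_def)
    then have "residual R M {\<zero>\<^bsub>M\<^esub>} (carrier M) \<subseteq> P"
      using P(2) by (simp add: annihilator_residual)
    then obtain z\<^sub>0 where "z\<^sub>0 \<in> carrier M" "residual R M {\<zero>\<^bsub>M\<^esub>} {z\<^sub>0} \<subseteq> P"
      by (rule residual_of_element_below_prime[OF carrier_is_submodule P(1)])
    then obtain z where z: "z \<in> carrier M" "primeideal (residual R M {\<zero>\<^bsub>M\<^esub>} {z}) R"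
        "residual R M {\<zero>\<^bsub>M\<^esub>} {z} \<subseteq> P"
      by (rule prime_residual_below[OF zero_submodule carrier_is_submodule P(1)])
    have "module_annihilator R M \<subseteq> residual R M {\<zero>\<^bsub>M\<^esub>} {z}"
      using z(1) by (auto simp: module_annihilator_def residual_def)
    then have "\<not> residual R M {\<zero>\<^bsub>M\<^esub>} {z} \<subset> P"
      using no_chain[OF z(2) P(1) prime_max_ideal _ lt] by blast
    with z(3) have "residual R M {\<zero>\<^bsub>M\<^esub>} {z} = P" by blast
    with P(2) \<open>\<bb> \<subseteq> ?C\<close> have "\<forall>a\<in>\<bb>. a \<odot>\<^bsub>M\<^esub> z = \<zero>\<^bsub>M\<^esub>" by (auto simp: residual_def)
    then have "z = \<zero>\<^bsub>M\<^esub>" by (rule bb_torsion_free[OF z(1)])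
    then have "carrier R \<subseteq> residual R M {\<zero>\<^bsub>M\<^esub>} {z}" by (auto simp: residual_def)
    with z(3) lt max_ideal(2) show False by blast
  qed
  then obtain m where "ideal_power R J m \<subseteq> ?C"
    using ideal_power_subset[OF R.is_cring J_ideal C] by blast
  then show ?thesis
    using ideal_smult_subset_iff_residual[OF submodule_B, of "ideal_power R J m"]
      ideal_carrierD[OF R.ideal_ideal_power[OF J_ideal]] by blast
qed

text \<open>
  From \<open>J^m M \<subseteq> B \<subseteq> M\<close> the lengths of \<open>M / J^n M\<close> and \<open>B / J^n B\<close> differ by a bounded amount, and the
  latter is \<open>e n\<close> plus a constant. An eventually polynomial function at bounded distance from
  \<open>e n\<close> differs from it by a constant.
\<close>

theorem hs_multiplicity_eq: "hs_multiplicity R J M = of_nat e"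
proof -
  note cM = carrier_is_submodule and JM = submodule_ipow[OF J_ideal carrier_is_submodule]
  note JB = submodule_ipow[OF J_ideal submodule_B]
  have BM: "B \<subseteq> carrier M" by (rule submoduleE(1)[OF submodule_B])
  obtain b where b: "\<And>k. sub_len R M (ipow J k B) B = enat (b k)"
    "\<And>k. k \<ge> n\<^sub>0 \<Longrightarrow> b k = b n\<^sub>0 + e * (k - n\<^sub>0)" "\<And>k. b k \<le> (b n\<^sub>0 + e) * (k + 1)"
    by (rule B_lengths) (rule that)
  obtain m where m: "ipow J m (carrier M) \<subseteq> B" using J_power_in_B by blast
  obtain F where F: "mvpoly 0 F" "\<forall>n\<in>multi_index 0. \<exists>l.
      sub_len R M (ideal_smult M (multi_power R 0 (\<lambda>_. J) (n(0 := Suc (n 0)))) (carrier M))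
        (ideal_smult M (multi_power R 0 (\<lambda>_. J) n) (carrier M)) = enat l \<and> int l = F n"
    using hilbert_mvpoly[of 0 "\<lambda>_. J"] J_ideal J prim by blast
  let ?e = "\<lambda>n i::nat. if i = 0 then n else 0 :: nat"
  have "\<exists>l. sub_len R M (ipow J (Suc n) (carrier M)) (ipow J n (carrier M)) = enat l \<and> int l = F (?e n)" for n
  proof -
    have "?e n \<in> multi_index 0" by (simp add: multi_index_def)
    from bspec[OF F(2) this] show ?thesis
      by (simp add: R.multi_power_single J_ideal)
  qed
  then obtain h where h: "\<And>n. sub_len R M (ipow J (Suc n) (carrier M)) (ipow J n (carrier M)) = enat (h n)"
      "\<And>n. int (h n) = F (?e n)" by metis
  define a where "a n = (\<Sum>k<n. h k)" for n
  have a: "sub_len R M (ipow J n (carrier M)) (carrier M) = enat (a n)" for n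
    using sub_len_filtration_sum[of "\<lambda>k. ipow J k (carrier M)", OF JM _ h(1)]
      ipow_antimono[OF J_ideal] ideal_smult_one[OF cM]
    by (simp add: a_def R.ideal_power_0)
  \<comment> \<open>The Hilbert-Samuel polynomial belongs to the exponent \<open>n + 1\<close>, hence \<open>a (Suc n)\<close>.\<close>
  define g where "g n = int (a (Suc n)) + (- int e) * int n" for n
  have "evpoly (\<lambda>n. int (h n))" unfolding h(2) by (rule mvpoly_0_evpoly[OF F(1)])
  then have "evpoly (\<lambda>n. \<Sum>k\<le>n. int (h k))" by (rule evpoly_cumulative)
  then have "evpoly g"
    unfolding g_def a_def by (intro evpoly_add evpoly_linear) (simp add: lessThan_Suc_atMost)
  have upper: "a n \<le> a m + b n" for n
  proof -
    have "enat (a n) \<le> sub_len R M (ipow J n B) (carrier M)"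
      unfolding a[symmetric] using BM by (intro sub_len_mono ideal_smult_mono) auto
    also have "\<dots> = sub_len R M (ipow J n B) B + sub_len R M B (carrier M)"
      by (rule sub_len_add[OF JB submodule_B cM ipow_subset[OF J_ideal submodule_B] BM])
    also have "\<dots> \<le> enat (b n) + enat (a m)"
      unfolding b(1) a[symmetric] using m by (intro add_left_mono sub_len_mono) auto
    finally show ?thesis by simp
  qed
  have lower: "b n \<le> a (n + m)" for n
  proof -
    have sub: "ipow J (n + m) (carrier M) \<subseteq> ipow J n B"
      unfolding R.ideal_power_add[OF J_ideal]
        ideal_smult_ideal_prod[OF R.ideal_ideal_power[OF J_ideal] R.ideal_ideal_power[OF J_ideal] cM]
      using m by (intro ideal_smult_mono) auto
    have "enat (b n) \<le> sub_len R M (ipow J n B) (carrier M)"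
      unfolding b(1)[symmetric] using BM by (intro sub_len_mono) auto
    also have "\<dots> \<le> enat (a (n + m))"
      unfolding a[symmetric] using sub by (intro sub_len_mono) auto
    finally show ?thesis by simp
  qed
  have "\<bar>g n\<bar> \<le> int (a m + b n\<^sub>0 + e + e * (m + n\<^sub>0))" if n: "n \<ge> n\<^sub>0 + m" for n
  proof -
    have "a (Suc n) \<le> a m + (b n\<^sub>0 + e * (Suc n - n\<^sub>0))"
      using upper[of "Suc n"] b(2)[of "Suc n"] n by simp
    also have "\<dots> \<le> a m + b n\<^sub>0 + e + e * n"
      using mult_le_mono2[of "Suc n - n\<^sub>0" "Suc n" e] by simp
    finally have u: "int (a (Suc n)) \<le> int (a m + b n\<^sub>0 + e) + int e * int n"
      by (metis of_nat_add of_nat_le_iff of_nat_mult)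
    have "b n\<^sub>0 + e * (n - m - n\<^sub>0) = b (n - m)" using b(2)[of "n - m"] n by simp
    also have "\<dots> \<le> a n" using lower[of "n - m"] n by simp
    also have "\<dots> \<le> a (Suc n)" by (simp add: a_def)
    finally have "e * (n - m - n\<^sub>0) \<le> a (Suc n)" by simp
    moreover have "int (e * (n - m - n\<^sub>0)) = int e * int n - int (e * (m + n\<^sub>0))"
    proof -
      have "int (n - m - n\<^sub>0) = int n - int m - int n\<^sub>0" using n by simp
      then have "int (e * (n - m - n\<^sub>0)) = int e * (int n - int m - int n\<^sub>0)"
        by (simp only: of_nat_mult)
      then show ?thesis by (simp only: of_nat_mult of_nat_add right_diff_distrib distrib_left)
    qed
    ultimately have l: "int e * int n - int (e * (m + n\<^sub>0)) \<le> int (a (Suc n))" by linarith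
    have "0 \<le> int (a m + b n\<^sub>0 + e)" "0 \<le> int (e * (m + n\<^sub>0))" by simp_all
    moreover have "int (a m + b n\<^sub>0 + e + e * (m + n\<^sub>0)) = int (a m + b n\<^sub>0 + e) + int (e * (m + n\<^sub>0))"
      by (rule of_nat_add)
    ultimately show ?thesis
      using u l unfolding g_def abs_le_iff by linarith
  qed
  then obtain K n\<^sub>1 where K: "\<And>n. n \<ge> n\<^sub>1 \<Longrightarrow> g n = K"
    using evpoly_bounded_imp_constant[OF \<open>evpoly g\<close>] by blast
  define p :: "rat poly" where "p = [:of_int K, of_nat e:]"
  have len: "module_length R (quot_module M (ideal_smult M (ideal_power R J (Suc n)) (carrier M))) =
      enat (a (Suc n))" for n
    unfolding module_length_quot[OF JM] a ..
  have p: "of_nat (a (Suc n)) = Polynomial.poly p (of_nat n)" if "n \<ge> n\<^sub>1" for n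
  proof -
    have "int (a (Suc n)) = K + int e * int n" using K[OF that] by (simp add: g_def)
    then have "(of_int (int (a (Suc n))) :: rat) = of_int (K + int e * int n)" by (rule arg_cong)
    then show ?thesis by (simp add: p_def mult.commute)
  qed
  have "hilbert_samuel_poly R J M = p"
    unfolding hilbert_samuel_poly_def len
  proof (rule the_equality)
    show "\<exists>n\<^sub>0. \<forall>n\<ge>n\<^sub>0. \<exists>l. enat (a (Suc n)) = enat l \<and> of_nat l = Polynomial.poly p (of_nat n)"
      using p by blast
    fix q :: "rat poly"
    assume "\<exists>n\<^sub>0. \<forall>n\<ge>n\<^sub>0. \<exists>l. enat (a (Suc n)) = enat l \<and> of_nat l = Polynomial.poly q (of_nat n)"
    then obtain n\<^sub>2 where q: "\<And>n. n \<ge> n\<^sub>2 \<Longrightarrow> of_nat (a (Suc n)) = Polynomial.poly q (of_nat n)" by auto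
    show "q = p"
      by (rule rat_poly_eqI[of "max n\<^sub>1 n\<^sub>2"]) (simp flip: p q)
  qed
  moreover have "(THE s::nat. module_dim R M = ereal (real s)) = 1"
    unfolding dim_eq_1 by (rule the_equality) (auto simp: one_ereal_def)
  ultimately show ?thesis using nonzero by (simp add: hs_multiplicity_def p_def)
qed

end


section \<open>Hilbert polynomials\<close>

locale ideal_tuple =
  fixes R :: "('a, 'r) ring_scheme" (structure) and \<nn> :: "'a set" and d :: nat and I :: "nat \<Rightarrow> 'a set"
  assumes noetherian: "noetherian_ring R" and local: "local_ring R \<nn>"
    and ideals: "\<forall>i\<le>d. ideal (I i) R"
    and primary: "primary_ideal (I 0) R" "ideal_radical R (I 0) = \<nn>"

sublocale ideal_tuple \<subseteq> cring R
  using local by (simp add: local_ring_def)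

sublocale ideal_tuple \<subseteq> noetherian_ring R
  by (rule noetherian)

context ideal_tuple
begin

lemma J_le: "I 0 \<subseteq> \<nn>"
proof
  fix a assume a: "a \<in> I 0"
  have aR: "a \<in> carrier R" using ideal.Icarr[OF ideals[rule_format, OF le0] a] .
  then have "a [^] (1::nat) \<in> I 0" using a by simp
  with aR show "a \<in> \<nn>" unfolding primary(2)[symmetric] ideal_radical_def by blast
qed

lemma prime_over_J:
  assumes P: "primeideal P R" "I 0 \<subseteq> P"
  shows "P = \<nn>"
proof -
  interpret P: primeideal P R by (rule P(1))
  have "\<nn> \<subseteq> P"
  proof
    fix a assume "a \<in> \<nn>"
    then obtain n :: nat where a: "a \<in> carrier R" "a [^] n \<in> P"
      using P(2) unfolding primary(2)[symmetric] ideal_radical_def by blast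
    show "a \<in> P" using a(2)
    proof (induction n)
      case 0
      then show ?case using P.one_imp_carrier P.I_notcarr by simp
    next
      case (Suc n)
      then show ?case using P.I_prime[of "a [^] n" a] a(1) by auto
    qed
  qed
  moreover have "maximalideal \<nn> R" using local by (simp add: local_ring_def)
  ultimately show ?thesis
    using maximalideal.I_maximal[of \<nn> R P] P.ideal_axioms P.a_subset P.I_notcarr by auto
qed

lemma local_noetherian: "noetherian_module R M \<Longrightarrow> local_noetherian_module R M \<nn>"
  by (intro local_noetherian_module.intro local_noetherian_module_axioms.intro local)

text \<open>
  The multigraded filtration whose steps in direction \<open>0\<close> are measured by the Hilbert function.
\<close>

definition X :: "('a, 'b, 'm) module_scheme \<Rightarrow> (nat \<Rightarrow> nat) \<Rightarrow> 'b set" where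
  "X M n = ideal_smult M (multi_power R d I n) (carrier M)"

abbreviation suc0 :: "(nat \<Rightarrow> nat) \<Rightarrow> nat \<Rightarrow> nat" where
  "suc0 n \<equiv> n(0 := Suc (n 0))"

definition hilb :: "('a, 'b, 'm) module_scheme \<Rightarrow> (nat \<Rightarrow> nat) \<Rightarrow> enat" where
  "hilb M n = sub_len R M (X M (suc0 n)) (X M n)"

lemma submodule_X: "module R M \<Longrightarrow> submodule (X M n) R M"
  unfolding X_def
  by (intro module.submodule_ideal_smult module.carrier_is_submodule multi_power_ideal ideals)

lemma X_antimono: "module R M \<Longrightarrow> (\<And>i. i \<le> d \<Longrightarrow> m i \<le> n i) \<Longrightarrow> X M n \<subseteq> X M m"
  unfolding X_def by (intro module.ideal_smult_mono multi_power_antimono ideals) auto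

lemma X_suc0: "module R M \<Longrightarrow> X M (suc0 n) \<subseteq> X M n"
  by (rule X_antimono) auto

text \<open>
  Eventuality for multi-indices: all components have to be large.
\<close>

definition large :: "((nat \<Rightarrow> nat) \<Rightarrow> bool) \<Rightarrow> bool" where
  "large P \<longleftrightarrow> (\<exists>n\<^sub>0. \<forall>n\<in>multi_index d. (\<forall>i\<le>d. n\<^sub>0 \<le> n i) \<longrightarrow> P n)"

lemma large_mono: "large P \<Longrightarrow> (\<And>n. n \<in> multi_index d \<Longrightarrow> P n \<Longrightarrow> Q n) \<Longrightarrow> large Q"
  unfolding large_def by blast

lemma large_conj: "large P \<Longrightarrow> large Q \<Longrightarrow> large (\<lambda>n. P n \<and> Q n)"
proof -
  assume "large P" "large Q"
  then obtain m n where "\<forall>k\<in>multi_index d. (\<forall>i\<le>d. m \<le> k i) \<longrightarrow> P k"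
      "\<forall>k\<in>multi_index d. (\<forall>i\<le>d. n \<le> k i) \<longrightarrow> Q k"
    unfolding large_def by blast
  then show ?thesis unfolding large_def by (intro exI[of _ "max m n"]) auto
qed

lemma large_pred:
  assumes "large P" "i \<le> d"
  shows "large (\<lambda>n. n i > 0 \<and> P (n(i := n i - 1)))"
proof -
  obtain m where m: "\<forall>n\<in>multi_index d. (\<forall>i\<le>d. m \<le> n i) \<longrightarrow> P n"
    using assms(1) unfolding large_def by blast
  have "n i > 0 \<and> P (n(i := n i - 1))" if n: "n \<in> multi_index d" "\<forall>i\<le>d. Suc m \<le> n i" for n
  proof
    have ni: "Suc m \<le> n i" using n(2) assms(2) by blast
    then show "n i > 0" by simp
    have "\<forall>j\<le>d. m \<le> (n(i := n i - 1)) j" using n(2) ni by (auto simp: Suc_le_eq less_imp_le)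
    with m multi_index_upd[OF n(1) assms(2)] show "P (n(i := n i - 1))" by blast
  qed
  then show ?thesis unfolding large_def by blast
qed

definition hilb_poly :: "('a, 'b, 'm) module_scheme \<Rightarrow> ((nat \<Rightarrow> nat) \<Rightarrow> int) \<Rightarrow> bool" where
  "hilb_poly M c \<longleftrightarrow> coeff_fun d c \<and> large (\<lambda>n. \<exists>l. hilb M n = enat l \<and> int l = binom_eval d c n)"

lemma hilb_poly_exists:
  assumes "noetherian_module R M"
  shows "\<exists>c. hilb_poly M c"
proof -
  interpret local_noetherian_module R M \<nn> by (rule local_noetherian[OF assms])
  obtain F where F: "mvpoly d F" "\<forall>n\<in>multi_index d. \<exists>l. hilb M n = enat l \<and> int l = F n"
    using hilbert_mvpoly[OF ideals J_le prime_over_J] unfolding hilb_def X_def by blast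
  obtain c n\<^sub>0 where c: "coeff_fun d c" "\<forall>n. (\<forall>i\<le>d. n\<^sub>0 \<le> n i) \<longrightarrow> F n = binom_eval d c n"
    using mvpoly_imp_binom_eval[OF F(1)] by blast
  have "large (\<lambda>n. \<exists>l. hilb M n = enat l \<and> int l = binom_eval d c n)"
    unfolding large_def using F(2) c(2) by metis
  with c(1) show ?thesis unfolding hilb_poly_def by blast
qed

lemma hilb_poly_unique:
  assumes b: "hilb_poly M b" and c: "hilb_poly M c"
  shows "b = c"
proof -
  have "large (\<lambda>n. (\<exists>l. hilb M n = enat l \<and> int l = binom_eval d b n) \<and>
      (\<exists>l. hilb M n = enat l \<and> int l = binom_eval d c n))"
    using b c unfolding hilb_poly_def by (intro large_conj) auto
  then have "large (\<lambda>n. binom_eval d b n = binom_eval d c n)"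
    by (rule large_mono) auto
  then obtain n\<^sub>0 where "\<forall>n\<in>multi_index d. (\<forall>i\<le>d. n\<^sub>0 \<le> n i) \<longrightarrow> binom_eval d b n = binom_eval d c n"
    unfolding large_def by blast
  then show ?thesis
    using b c unfolding hilb_poly_def by (intro binom_eval_eq_imp_eq[of d b c n\<^sub>0]) auto
qed

lemma module_length_graded_component:
  "module R M \<Longrightarrow> module_length R (graded_component R d I M n) = hilb M n"
  unfolding graded_component_def hilb_def X_def[symmetric]
  by (intro module.module_length_subquotient submodule_X X_suc0)

lemma hilbert_coeffs_eq:
  assumes M: "noetherian_module R M" and c: "hilb_poly M c"
  shows "hilbert_coeffs R d I M = c"
proof -
  have "module R M" using M by (simp add: noetherian_module_def)
  have "hilbert_coeffs R d I M = (THE c. hilb_poly M c)"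
    unfolding hilbert_coeffs_def hilb_poly_def coeff_fun_def large_def binom_eval_def
      module_length_graded_component[OF \<open>module R M\<close>] conj_assoc ..
  also have "\<dots> = c" using c hilb_poly_unique by (intro the_equality) auto
  finally show ?thesis .
qed

lemma hilb_poly_hilbert_coeffs:
  "noetherian_module R M \<Longrightarrow> hilb_poly M (hilbert_coeffs R d I M)"
  using hilb_poly_exists[of M] hilbert_coeffs_eq[of M] by metis

lemma hilbert_coeffs_cong:
  assumes M: "noetherian_module R M" and M': "noetherian_module R M'"
    and eq: "large (\<lambda>n. hilb M n = hilb M' n)"
  shows "hilbert_coeffs R d I M = hilbert_coeffs R d I M'"
proof (rule hilbert_coeffs_eq[OF M])
  have "large (\<lambda>n. hilb M n = hilb M' n \<and>
      (\<exists>l. hilb M' n = enat l \<and> int l = binom_eval d (hilbert_coeffs R d I M') n))"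
    using hilb_poly_hilbert_coeffs[OF M'] eq unfolding hilb_poly_def by (intro large_conj) auto
  then have "large (\<lambda>n. \<exists>l. hilb M n = enat l \<and> int l = binom_eval d (hilbert_coeffs R d I M') n)"
    by (rule large_mono) auto
  then show "hilb_poly M (hilbert_coeffs R d I M')"
    using hilb_poly_hilbert_coeffs[OF M'] unfolding hilb_poly_def by blast
qed


section \<open>Torsion\<close>

abbreviation "\<I> \<equiv> ideals_product R d I"

lemma prod_ideal: "ideal \<I> R" by (rule ideals_product_ideal[OF ideals])

text \<open>
  The submodules \<open>K : \<I>^t\<close> ascend, so their union is one of them.
\<close>

lemma colon_infinity_stable:
  assumes M: "noetherian_module R M" and K: "submodule K R M"
  obtains t where "submodule (colon_infinity R M K \<I>) R M" "K \<subseteq> colon_infinity R M K \<I>"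
    "colon_infinity R M K \<I> = {m \<in> carrier M. \<forall>a\<in>ideal_power R \<I> t. a \<odot>\<^bsub>M\<^esub> m \<in> K}"
proof -
  interpret noetherian_module R M by (rule M)
  define T where "T t = {m \<in> carrier M. \<forall>a\<in>ideal_power R \<I> t. a \<odot>\<^bsub>M\<^esub> m \<in> K}" for t
  have T: "submodule (T t) R M" for t
  proof -
    have aR: "a \<in> carrier R" if "a \<in> ideal_power R \<I> t" for a
      using that by (rule ideal_carrierD[OF ideal_ideal_power[OF prod_ideal]])
    show ?thesis
      unfolding T_def
    proof (rule submoduleI)
      fix r m assume r: "r \<in> carrier R" and m: "m \<in> {m \<in> carrier M. \<forall>a\<in>ideal_power R \<I> t. a \<odot>\<^bsub>M\<^esub> m \<in> K}"
      have "a \<odot>\<^bsub>M\<^esub> (r \<odot>\<^bsub>M\<^esub> m) \<in> K" if a: "a \<in> ideal_power R \<I> t" for a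
      proof -
        have "a \<odot>\<^bsub>M\<^esub> (r \<odot>\<^bsub>M\<^esub> m) = r \<odot>\<^bsub>M\<^esub> (a \<odot>\<^bsub>M\<^esub> m)"
          using aR[OF a] r m m_comm[of a r] by (simp flip: smult_assoc1)
        then show ?thesis using submodule_closed(2)[OF K r] m a by simp
      qed
      then show "r \<odot>\<^bsub>M\<^esub> m \<in> {m \<in> carrier M. \<forall>a\<in>ideal_power R \<I> t. a \<odot>\<^bsub>M\<^esub> m \<in> K}"
        using r m by simp
    qed (use submodule_closed[OF K] aR in \<open>auto simp: smult_r_minus smult_r_distr\<close>)
  qed
  have inc: "T t \<subseteq> T (Suc t)" for t
    using ideal_power_antimono[OF prod_ideal, of t "Suc t"] by (auto simp: T_def)
  obtain t where t: "\<And>s. s \<ge> t \<Longrightarrow> T s = T t"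
    using acc[of T, OF T inc] by blast
  have "T s \<subseteq> T t" for s
  proof (cases "s \<ge> t")
    case True
    show ?thesis using t[OF True] by (rule equalityD1)
  next
    case False
    show ?thesis by (rule lift_Suc_mono_le[of T, OF inc]) (use False in simp)
  qed
  then have eq: "colon_infinity R M K \<I> = T t"
    unfolding colon_infinity_def T_def by blast
  have "K \<subseteq> T t"
    unfolding T_def using submoduleE(1)[OF K] submodule_closed(2)[OF K]
      ideal_carrierD[OF ideal_ideal_power[OF prod_ideal]] by blast
  with T[of t] eq have "submodule (colon_infinity R M K \<I>) R M" "K \<subseteq> colon_infinity R M K \<I>"
    by simp_all
  then show thesis using eq[unfolded T_def] by (rule that)
qed

text \<open>
  The torsion submodule is annihilated by a fixed power of the product of all ideals, and the
  Artin-Rees lemma exhibits elements of the intersection as multiples from a higher power.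
\<close>

lemma X_Int_torsion:
  assumes M: "noetherian_module R M"
  shows "large (\<lambda>n. X M n \<inter> colon_infinity R M {\<zero>\<^bsub>M\<^esub>} \<I> \<subseteq> {\<zero>\<^bsub>M\<^esub>})"
proof -
  interpret noetherian_module R M by (rule M)
  let ?L = "colon_infinity R M {\<zero>\<^bsub>M\<^esub>} \<I>"
  obtain t where L: "submodule ?L R M" and "{\<zero>\<^bsub>M\<^esub>} \<subseteq> ?L"
    and t: "?L = {m \<in> carrier M. \<forall>a\<in>ideal_power R \<I> t. a \<odot>\<^bsub>M\<^esub> m \<in> {\<zero>\<^bsub>M\<^esub>}}"
    by (rule colon_infinity_stable[OF M zero_submodule])
  obtain c where c: "\<And>n. n \<ge> c \<Longrightarrow>
      ideal_smult M (ideal_power R \<I> n) (carrier M) \<inter> ?L \<subseteq> ideal_smult M (ideal_power R \<I> (n - c)) ?L"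
    by (rule artin_rees[OF prod_ideal L]) (rule that)
  have "ideal_smult M (ideal_power R \<I> t) ?L \<subseteq> {\<zero>\<^bsub>M\<^esub>}"
    unfolding ideal_smult_subset_iff[OF zero_submodule] using t by blast
  then have zero: "ideal_smult M (ideal_power R \<I> (t + c)) (carrier M) \<inter> ?L \<subseteq> {\<zero>\<^bsub>M\<^esub>}"
    using c[of "t + c"] by auto
  have "X M n \<inter> ?L \<subseteq> {\<zero>\<^bsub>M\<^esub>}" if n: "\<forall>i\<le>d. t + c \<le> n i" for n
  proof -
    have "X M n \<subseteq> ideal_smult M (ideal_power R \<I> (t + c)) (carrier M)"
      unfolding X_def multi_power_const[OF ideals, symmetric] using n
      by (intro ideal_smult_mono multi_power_antimono ideals) auto
    with zero show ?thesis by blast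
  qed
  then show ?thesis unfolding large_def by blast
qed


section \<open>Quotients\<close>

lemma sub_len_quot:
  assumes "module R N" "submodule H R N" "submodule A R N" "submodule B R N" "B \<subseteq> A"
  shows "sub_len R (quot_module N H) ((\<lambda>x. H +>\<^bsub>N\<^esub> x) ` B) ((\<lambda>x. H +>\<^bsub>N\<^esub> x) ` A) =
    sub_len R N (B <+>\<^bsub>N\<^esub> H) (A <+>\<^bsub>N\<^esub> H)"
proof -
  interpret module R N by (rule assms(1))
  show ?thesis
    using linear_map.sub_len_image[OF quot_linear_map[OF assms(2)] assms(3-5)]
    by (simp add: quot_ker[OF assms(2)])
qed

lemma X_quot:
  assumes "module R N" "submodule H R N"
  shows "X (quot_module N H) n = (\<lambda>x. H +>\<^bsub>N\<^esub> x) ` X N n"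
proof -
  interpret module R N by (rule assms(1))
  show ?thesis
    unfolding X_def quot_carrier
    by (rule linear_map.image_ideal_smult[OF quot_linear_map[OF assms(2)]
          multi_power_ideal[OF ideals] carrier_is_submodule, symmetric])
qed

lemma hilb_quot:
  assumes N: "module R N" and H: "submodule H R N"
  shows "hilb (quot_module N H) n = sub_len R N (X N (suc0 n) <+>\<^bsub>N\<^esub> H) (X N n <+>\<^bsub>N\<^esub> H)"
  unfolding hilb_def X_quot[OF N H]
  by (rule sub_len_quot[OF N H submodule_X[OF N] submodule_X[OF N] X_suc0[OF N]])

text \<open>
  In \<open>N / H\<close> the colon submodule becomes the torsion of \<open>X_Int_torsion\<close>.
\<close>

lemma hilbert_coeffs_quot_torsion:
  assumes N: "noetherian_module R N" and H: "submodule H R N"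
  shows "hilbert_coeffs R d I (quot_module N (colon_infinity R N H \<I>)) =
    hilbert_coeffs R d I (quot_module N H)"
proof -
  interpret N: noetherian_module R N by (rule N)
  let ?L = "colon_infinity R N H \<I>" and ?M = "quot_module N H"
  let ?\<pi> = "\<lambda>x. H +>\<^bsub>N\<^esub> x"
  interpret \<pi>: linear_map R N ?M ?\<pi> by (rule N.quot_linear_map[OF H])
  have M: "noetherian_module R ?M" by (rule N.noetherian_module_quot[OF H])
  have L: "submodule ?L R N" "H \<subseteq> ?L"
    by (rule colon_infinity_stable[OF N H], assumption)+
  let ?L' = "colon_infinity R ?M {\<zero>\<^bsub>?M\<^esub>} \<I>"
  have L': "submodule ?L' R ?M"
    by (rule colon_infinity_stable[OF M \<pi>.M'.zero_submodule])
  have ker: "?\<pi> x = \<zero>\<^bsub>?M\<^esub> \<longleftrightarrow> x \<in> H" if "x \<in> carrier N" for x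
    using N.quot_ker[OF H] that unfolding \<pi>.ker_def by blast
  have "?\<pi> x \<in> ?L' \<longleftrightarrow> x \<in> ?L" if x: "x \<in> carrier N" for x
  proof -
    have "a \<odot>\<^bsub>?M\<^esub> ?\<pi> x \<in> {\<zero>\<^bsub>?M\<^esub>} \<longleftrightarrow> a \<odot>\<^bsub>N\<^esub> x \<in> H" if "a \<in> ideal_power R \<I> t" for a t
      using ker[of "a \<odot>\<^bsub>N\<^esub> x"] x \<pi>.map_smult[of a x]
        N.ideal_carrierD[OF ideal_ideal_power[OF prod_ideal] that] by simp
    then show ?thesis
      unfolding colon_infinity_def using x \<pi>.map_closed[OF x] by auto
  qed
  then have "?L = {x \<in> carrier N. ?\<pi> x \<in> ?L'}"
    using N.submoduleE(1)[OF L(1)] by blast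
  moreover have "?L' \<subseteq> ?\<pi> ` carrier N"
    using \<pi>.M'.submoduleE(1)[OF L'] by (simp add: N.quot_carrier)
  ultimately have imgL: "?\<pi> ` ?L = ?L'" using \<pi>.image_vimage by simp
  have "hilb (quot_module N ?L) n = hilb ?M n"
    if "X ?M n \<inter> ?L' \<subseteq> {\<zero>\<^bsub>?M\<^esub>}" for n
  proof -
    note X = submodule_X[OF N.module_axioms] and XM = submodule_X[OF \<pi>.M'.module_axioms]
    have plus: "(X N m <+>\<^bsub>N\<^esub> ?L) <+>\<^bsub>N\<^esub> H = X N m <+>\<^bsub>N\<^esub> ?L" for m
      by (simp only: N.set_add_assoc[OF X L(1) H] N.set_add_absorb[OF L(1) H L(2)])
    have img: "?\<pi> ` (X N m <+>\<^bsub>N\<^esub> ?L) = X ?M m <+>\<^bsub>?M\<^esub> ?L'" for m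
      unfolding \<pi>.image_set_add[OF X L(1)] imgL X_quot[OF N.module_axioms H] ..
    have "hilb (quot_module N ?L) n = sub_len R N (X N (suc0 n) <+>\<^bsub>N\<^esub> ?L) (X N n <+>\<^bsub>N\<^esub> ?L)"
      by (rule hilb_quot[OF N.module_axioms L(1)])
    also have "\<dots> = sub_len R ?M (X ?M (suc0 n) <+>\<^bsub>?M\<^esub> ?L') (X ?M n <+>\<^bsub>?M\<^esub> ?L')"
      using sub_len_quot[OF N.module_axioms H N.submodule_set_add[OF X L(1)] N.submodule_set_add[OF X L(1)]
          N.set_add_mono[OF X_suc0[OF N.module_axioms] order_refl], of n]
      unfolding plus img by (rule sym)
    also have "\<dots> = sub_len R ?M (X ?M (suc0 n) <+>\<^bsub>?M\<^esub> (?L' \<inter> X ?M n)) (X ?M n)"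
      by (rule \<pi>.M'.sub_len_quotient_le(1)[OF XM XM L' X_suc0[OF \<pi>.M'.module_axioms]])
    also have "X ?M (suc0 n) <+>\<^bsub>?M\<^esub> (?L' \<inter> X ?M n) = X ?M (suc0 n)"
      using that \<pi>.M'.submodule_zero[OF XM, of "suc0 n"]
      by (intro \<pi>.M'.set_add_absorb XM \<pi>.M'.submodule_Int L') blast
    finally show ?thesis by (simp add: hilb_def)
  qed
  then have "large (\<lambda>n. hilb (quot_module N ?L) n = hilb ?M n)"
    by (intro large_mono[OF X_Int_torsion[OF M]])
  then show ?thesis
    by (rule hilbert_coeffs_cong[OF N.noetherian_module_quot[OF L(1)] M])
qed

text \<open>
  If \<open>\<I>^s x \<subseteq> H : \<I>^t\<close>, then \<open>\<I>^(t + s) x \<subseteq> H\<close>.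
\<close>

lemma quot_torsion_free:
  assumes N: "noetherian_module R N" and H: "submodule H R N"
    and m: "m \<in> carrier (quot_module N (colon_infinity R N H \<I>))"
      "\<forall>a\<in>ideal_power R \<I> s. a \<odot>\<^bsub>quot_module N (colon_infinity R N H \<I>)\<^esub> m =
        \<zero>\<^bsub>quot_module N (colon_infinity R N H \<I>)\<^esub>"
  shows "m = \<zero>\<^bsub>quot_module N (colon_infinity R N H \<I>)\<^esub>"
proof -
  interpret N: noetherian_module R N by (rule N)
  let ?L = "colon_infinity R N H \<I>"
  obtain t where L: "submodule ?L R N" and "H \<subseteq> ?L"
    and t: "?L = {m \<in> carrier N. \<forall>a\<in>ideal_power R \<I> t. a \<odot>\<^bsub>N\<^esub> m \<in> H}"
    by (rule colon_infinity_stable[OF N H])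
  interpret \<pi>: linear_map R N "quot_module N ?L" "\<lambda>x. ?L +>\<^bsub>N\<^esub> x" by (rule N.quot_linear_map[OF L])
  have ker: "?L +>\<^bsub>N\<^esub> x = \<zero>\<^bsub>quot_module N ?L\<^esub> \<longleftrightarrow> x \<in> ?L" if "x \<in> carrier N" for x
    using N.quot_ker[OF L] that unfolding \<pi>.ker_def by blast
  obtain x where x: "x \<in> carrier N" "m = ?L +>\<^bsub>N\<^esub> x" using m(1) by (auto simp: N.quot_carrier)
  have ax: "a \<odot>\<^bsub>N\<^esub> x \<in> ?L" if a: "a \<in> ideal_power R \<I> s" for a
  proof -
    have aR: "a \<in> carrier R" using a by (rule N.ideal_carrierD[OF ideal_ideal_power[OF prod_ideal]])
    have "?L +>\<^bsub>N\<^esub> (a \<odot>\<^bsub>N\<^esub> x) = \<zero>\<^bsub>quot_module N ?L\<^esub>"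
      using bspec[OF m(2) a] \<pi>.map_smult[OF aR x(1)] unfolding x(2) by simp
    then show ?thesis using ker[of "a \<odot>\<^bsub>N\<^esub> x"] aR x(1) by simp
  qed
  have "ideal_power R \<I> (t + s) \<subseteq> residual R N H {x}"
    unfolding ideal_power_add[OF prod_ideal]
      ideal_prod_subset_iff[OF N.residual_ideal[OF H, of "{x}", simplified, OF x(1)]]
  proof (intro ballI)
    fix b a assume ba: "b \<in> ideal_power R \<I> t" "a \<in> ideal_power R \<I> s"
    have carr: "b \<in> carrier R" "a \<in> carrier R"
      using ba N.ideal_carrierD[OF ideal_ideal_power[OF prod_ideal]] by blast+
    have "b \<odot>\<^bsub>N\<^esub> (a \<odot>\<^bsub>N\<^esub> x) \<in> H" using ax[OF ba(2)] ba(1) t by blast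
    then show "b \<otimes> a \<in> residual R N H {x}"
      using carr x(1) by (simp add: residual_def N.smult_assoc1)
  qed
  then have "\<forall>a\<in>ideal_power R \<I> (t + s). a \<odot>\<^bsub>N\<^esub> x \<in> H" by (auto simp: residual_def)
  then have "x \<in> ?L" unfolding colon_infinity_def using x(1) by blast
  then show ?thesis using ker[OF x(1)] x(2) by simp
qed


section \<open>Weak (FC)-sequences\<close>

text \<open>
  Write \<open>n' = n - \<epsilon>\<^sub>i\<close>. Between \<open>X M (suc0 n)\<close> and \<open>X M n\<close> insert \<open>X M (suc0 n) + a (X M n')\<close>. The upper
  part is the Hilbert function of \<open>M / a M\<close>, since \<open>a M\<close> meets \<open>X M n\<close> in \<open>a (X M n')\<close>. The lower part
  is isomorphic to the step of the filtration at \<open>n'\<close>, since \<open>0 : a\<close> meets \<open>X M n'\<close> in \<open>0\<close>.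
\<close>

lemma weak_FC_hilb:
  assumes M: "noetherian_module R M" and fc: "weak_FC_element R d I M i a"
  shows "large (\<lambda>n. n i > 0 \<and> hilb M n =
    sub_len R M (X M (suc0 n) <+>\<^bsub>M\<^esub> (\<lambda>m. a \<odot>\<^bsub>M\<^esub> m) ` carrier M) (X M n <+>\<^bsub>M\<^esub> (\<lambda>m. a \<odot>\<^bsub>M\<^esub> m) ` carrier M) +
    hilb M (n(i := n i - 1)))"
proof -
  interpret noetherian_module R M by (rule M)
  have i: "i \<le> d" and a: "a \<in> I i" using fc by (simp_all add: weak_FC_element_def)
  have aR: "a \<in> carrier R" using ideal_carrierD[OF ideals[rule_format, OF i] a] .
  interpret \<phi>: linear_map R M M "\<lambda>m. a \<odot>\<^bsub>M\<^esub> m" by (rule smult_linear_map[OF aR])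
  let ?\<phi> = "\<lambda>m. a \<odot>\<^bsub>M\<^esub> m"
  let ?aM = "?\<phi> ` carrier M"
  note aM = \<phi>.submodule_image[OF carrier_is_submodule] and X = submodule_X[OF module_axioms]
  let ?FC = "\<lambda>n. ?aM \<inter> X M (n(i := Suc (n i))) = ?\<phi> ` X M n"
  have FC: "large ?FC"
    using fc unfolding weak_FC_element_def large_def X_def multi_power_Suc[OF ideals i] by blast
  have FC_suc: "large (\<lambda>n. ?FC (suc0 n))"
  proof -
    obtain n\<^sub>0 where n0: "\<forall>n\<in>multi_index d. (\<forall>i\<le>d. n\<^sub>0 \<le> n i) \<longrightarrow> ?FC n"
      using FC unfolding large_def by blast
    have "?FC (suc0 n)" if n: "n \<in> multi_index d" "\<forall>i\<le>d. n\<^sub>0 \<le> n i" for n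
    proof -
      have "\<forall>i\<le>d. n\<^sub>0 \<le> (suc0 n) i" using n(2) by (auto simp: le_Suc_eq)
      with n0 multi_index_upd[OF n(1) le0] show ?thesis by blast
    qed
    then show ?thesis unfolding large_def by blast
  qed
  have ker: "large (\<lambda>n. X M n \<inter> \<phi>.ker \<subseteq> {\<zero>\<^bsub>M\<^esub>})"
  proof -
    have "\<phi>.ker \<subseteq> colon_infinity R M {\<zero>\<^bsub>M\<^esub>} \<I>"
      using fc by (simp add: weak_FC_element_def colon_elem_def \<phi>.ker_def)
    then show ?thesis by (intro large_mono[OF X_Int_torsion[OF M]]) blast
  qed
  have "large (\<lambda>n. n i > 0 \<and> (?FC (n(i := n i - 1)) \<and> ?FC (suc0 (n(i := n i - 1))) \<and>
      X M (n(i := n i - 1)) \<inter> \<phi>.ker \<subseteq> {\<zero>\<^bsub>M\<^esub>}))"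
    by (rule large_pred[OF large_conj[OF FC large_conj[OF FC_suc ker]] i])
  then show ?thesis
  proof (rule large_mono)
    fix n :: "nat \<Rightarrow> nat"
    define n' where "n' = n(i := n i - 1)"
    assume "n i > 0 \<and> (?FC (n(i := n i - 1)) \<and> ?FC (suc0 (n(i := n i - 1))) \<and>
      X M (n(i := n i - 1)) \<inter> \<phi>.ker \<subseteq> {\<zero>\<^bsub>M\<^esub>})"
    then have ni: "n i > 0" and fc: "?FC n'" "?FC (suc0 n')" and ker0: "X M n' \<inter> \<phi>.ker \<subseteq> {\<zero>\<^bsub>M\<^esub>}"
      by (simp_all only: n'_def)
    have "n'(i := Suc (n' i)) = n" "(suc0 n')(i := Suc ((suc0 n') i)) = suc0 n"
      using ni by (auto simp: n'_def fun_eq_iff)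
    with fc have fc: "?aM \<inter> X M n = ?\<phi> ` X M n'" "?aM \<inter> X M (suc0 n) = ?\<phi> ` X M (suc0 n')"
      by (simp_all only:)
    note s = X_suc0[OF module_axioms]
    have aX: "submodule (?\<phi> ` X M n') R M" by (rule \<phi>.submodule_image[OF X])
    note XaX = submodule_set_add[OF X aX, of "suc0 n"]
    have aXn: "?\<phi> ` X M n' \<subseteq> X M n" using fc(1) by blast
    have "hilb M n = sub_len R M (X M (suc0 n)) (X M (suc0 n) <+>\<^bsub>M\<^esub> ?\<phi> ` X M n') +
        sub_len R M (X M (suc0 n) <+>\<^bsub>M\<^esub> ?\<phi> ` X M n') (X M n)"
      unfolding hilb_def
      by (rule sub_len_add[OF X XaX X set_add_upper1[OF X aX] set_add_least[OF X s aXn]])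
    also have "sub_len R M (X M (suc0 n) <+>\<^bsub>M\<^esub> ?\<phi> ` X M n') (X M n) =
        sub_len R M (X M (suc0 n) <+>\<^bsub>M\<^esub> ?aM) (X M n <+>\<^bsub>M\<^esub> ?aM)"
      using sub_len_quotient_le(1)[OF X X aM s, of n] unfolding fc(1) by (rule sym)
    also have "sub_len R M (X M (suc0 n)) (X M (suc0 n) <+>\<^bsub>M\<^esub> ?\<phi> ` X M n') =
        sub_len R M (?\<phi> ` X M n' \<inter> X M (suc0 n)) (?\<phi> ` X M n')"
      unfolding set_add_commute[OF X aX] by (rule sub_len_second_iso[OF aX X])
    also have "?\<phi> ` X M n' \<inter> X M (suc0 n) = ?\<phi> ` X M (suc0 n')"
      using fc s[of n] s[of n'] by blast
    also have "sub_len R M (?\<phi> ` X M (suc0 n')) (?\<phi> ` X M n') =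
        sub_len R M (X M (suc0 n') <+>\<^bsub>M\<^esub> (\<phi>.ker \<inter> X M n')) (X M n')"
      by (rule \<phi>.sub_len_image_Int[OF X X s])
    also have "X M (suc0 n') <+>\<^bsub>M\<^esub> (\<phi>.ker \<inter> X M n') = X M (suc0 n')"
      using ker0 submodule_zero[OF X, of "suc0 n'"]
      by (intro set_add_absorb X submodule_Int \<phi>.submodule_ker) blast
    finally have "hilb M n = sub_len R M (X M (suc0 n) <+>\<^bsub>M\<^esub> ?aM) (X M n <+>\<^bsub>M\<^esub> ?aM) + hilb M n'"
      unfolding hilb_def[of M n'] by (subst add.commute)
    with ni show "n i > 0 \<and> hilb M n = sub_len R M (X M (suc0 n) <+>\<^bsub>M\<^esub> ?aM) (X M n <+>\<^bsub>M\<^esub> ?aM) +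
        hilb M (n(i := n i - 1))"
      unfolding n'_def by (rule conjI)
  qed
qed

lemma weak_FC_hilbert_coeffs:
  assumes N: "noetherian_module R N" and H: "submodule H R N"
    and fc: "weak_FC_element R d I (quot_module N H) i a"
    and H': "H' = (\<lambda>m. a \<odot>\<^bsub>N\<^esub> m) ` carrier N <+>\<^bsub>N\<^esub> H"
  shows "hilbert_coeffs R d I (quot_module N H') = shift_coeff i (hilbert_coeffs R d I (quot_module N H))"
proof -
  interpret N: noetherian_module R N by (rule N)
  let ?M = "quot_module N H" and ?\<pi> = "\<lambda>x. H +>\<^bsub>N\<^esub> x" and ?aN = "(\<lambda>m. a \<odot>\<^bsub>N\<^esub> m) ` carrier N"
  have M: "noetherian_module R ?M" by (rule N.noetherian_module_quot[OF H])
  interpret \<pi>: linear_map R N ?M ?\<pi> by (rule N.quot_linear_map[OF H])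
  have i: "i \<le> d" and a: "a \<in> I i" using fc by (simp_all add: weak_FC_element_def)
  have aR: "a \<in> carrier R" using N.ideal_carrierD[OF ideals[rule_format, OF i] a] .
  note aN = N.submodule_smult_image[OF aR N.carrier_is_submodule]
  have H'_sub: "submodule H' R N" unfolding H' by (rule N.submodule_set_add[OF aN H])
  note X = submodule_X[OF N.module_axioms]
  have aM: "(\<lambda>m. a \<odot>\<^bsub>?M\<^esub> m) ` carrier ?M = ?\<pi> ` ?aN"
    unfolding N.quot_carrier image_image using aR by (intro image_cong) (simp_all add: \<pi>.map_smult)
  have img: "X ?M m <+>\<^bsub>?M\<^esub> (\<lambda>m. a \<odot>\<^bsub>?M\<^esub> m) ` carrier ?M = ?\<pi> ` (X N m <+>\<^bsub>N\<^esub> ?aN)" for m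
    unfolding aM X_quot[OF N.module_axioms H] \<pi>.image_set_add[OF X aN] ..
  have sub: "sub_len R ?M (X ?M (suc0 n) <+>\<^bsub>?M\<^esub> (\<lambda>m. a \<odot>\<^bsub>?M\<^esub> m) ` carrier ?M)
      (X ?M n <+>\<^bsub>?M\<^esub> (\<lambda>m. a \<odot>\<^bsub>?M\<^esub> m) ` carrier ?M) = hilb (quot_module N H') n" for n
    unfolding img hilb_quot[OF N.module_axioms H'_sub]
      sub_len_quot[OF N.module_axioms H N.submodule_set_add[OF X aN] N.submodule_set_add[OF X aN]
        N.set_add_mono[OF X_suc0[OF N.module_axioms] order_refl]]
      N.set_add_assoc[OF X aN H] H'[symmetric] ..
  define c where "c = hilbert_coeffs R d I ?M"
  have c: "coeff_fun d c" "large (\<lambda>n. \<exists>l. hilb ?M n = enat l \<and> int l = binom_eval d c n)"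
    using hilb_poly_hilbert_coeffs[OF M] by (simp_all add: c_def hilb_poly_def)
  have "large (\<lambda>n. (n i > 0 \<and> hilb ?M n = hilb (quot_module N H') n + hilb ?M (n(i := n i - 1))) \<and>
      ((\<exists>l. hilb ?M n = enat l \<and> int l = binom_eval d c n) \<and>
       (n i > 0 \<and> (\<exists>l. hilb ?M (n(i := n i - 1)) = enat l \<and> int l = binom_eval d c (n(i := n i - 1))))))"
    by (rule large_conj[OF weak_FC_hilb[OF M fc, unfolded sub] large_conj[OF c(2) large_pred[OF c(2) i]]])
  then have "large (\<lambda>n. \<exists>l. hilb (quot_module N H') n = enat l \<and> int l = binom_eval d (shift_coeff i c) n)"
  proof (rule large_mono, elim conjE exE)
    fix n k l
    assume n: "n i > 0" and eq: "hilb ?M n = hilb (quot_module N H') n + hilb ?M (n(i := n i - 1))"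
      and k: "hilb ?M n = enat k" "int k = binom_eval d c n"
      and l: "hilb ?M (n(i := n i - 1)) = enat l" "int l = binom_eval d c (n(i := n i - 1))"
    obtain m where m: "hilb (quot_module N H') n = enat m" "k = m + l"
      using eq unfolding k(1) l(1) by (cases "hilb (quot_module N H') n") auto
    have "int m = binom_eval d (shift_coeff i c) n"
      unfolding binom_eval_shift_coeff[of d c i n, OF c(1) i n] k(2)[symmetric] l(2)[symmetric] using m(2) by simp
    with m(1) show "\<exists>l. hilb (quot_module N H') n = enat l \<and> int l = binom_eval d (shift_coeff i c) n"
      by blast
  qed
  then show ?thesis
    unfolding c_def[symmetric] using coeff_fun_shift_coeff[OF c(1) i]
    by (intro hilbert_coeffs_eq N.noetherian_module_quot H'_sub) (simp add: hilb_poly_def)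
qed

text \<open>
  The coefficient indices move by one unit for every element of the sequence.
\<close>

lemma weak_FC_sequence_hilbert_coeffs:
  assumes N: "noetherian_module R N" and len: "length is = length xs"
    and fc: "\<And>j. j < length xs \<Longrightarrow>
      weak_FC_element R d I (quot_module N (seq_smult R N (take j xs))) (is ! j) (xs ! j)"
    and j: "j \<le> length xs"
  shows "submodule (seq_smult R N (take j xs)) R N \<and>
    hilbert_coeffs R d I (quot_module N (seq_smult R N (take j xs))) =
      (\<lambda>h. hilbert_coeffs R d I N (\<lambda>i. h i + count_list (take j is) i))"
  using j
proof (induction j)
  interpret N: noetherian_module R N by (rule N)
  case 0
  have "seq_smult R N [] \<subseteq> {\<zero>\<^bsub>N\<^esub>}"
    unfolding seq_smult_def using N.submoduleE(1)[OF N.carrier_is_submodule]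
    by (intro N.ideal_smult_Idl_subset N.zero_submodule) auto
  moreover have sm: "submodule (seq_smult R N []) R N"
    unfolding seq_smult_def
    by (intro N.submodule_ideal_smult genideal_ideal N.carrier_is_submodule) simp
  ultimately have zero: "seq_smult R N [] = {\<zero>\<^bsub>N\<^esub>}" using N.submodule_zero[OF sm] by blast
  note X = submodule_X[OF N.module_axioms]
  have "X N n <+>\<^bsub>N\<^esub> {\<zero>\<^bsub>N\<^esub>} = X N n" for n
    using N.submodule_zero[OF X] by (intro N.set_add_absorb X N.zero_submodule) simp
  then have "hilb (quot_module N {\<zero>\<^bsub>N\<^esub>}) n = hilb N n" for n
    unfolding hilb_quot[OF N.module_axioms N.zero_submodule] by (simp add: hilb_def)
  then have "hilbert_coeffs R d I (quot_module N {\<zero>\<^bsub>N\<^esub>}) = hilbert_coeffs R d I N"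
    by (intro hilbert_coeffs_cong N N.noetherian_module_quot N.zero_submodule) (simp add: large_def)
  with sm show ?case by (simp add: zero)
next
  interpret N: noetherian_module R N by (rule N)
  case (Suc j)
  then have j: "j < length xs" by simp
  let ?H = "seq_smult R N (take j xs)"
  have IH: "submodule ?H R N" "hilbert_coeffs R d I (quot_module N ?H) =
      (\<lambda>h. hilbert_coeffs R d I N (\<lambda>i. h i + count_list (take j is) i))"
    using Suc.IH j by auto
  have "x \<in> carrier R" if "x \<in> set xs" for x
  proof -
    obtain l where l: "l < length xs" "xs ! l = x" using \<open>x \<in> set xs\<close> by (auto simp: in_set_conv_nth)
    then have "is ! l \<le> d" "x \<in> I (is ! l)" using fc[OF l(1)] by (auto simp: weak_FC_element_def)
    then show ?thesis using N.ideal_carrierD ideals by blast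
  qed
  then have carr: "set (take j xs) \<subseteq> carrier R" "xs ! j \<in> carrier R"
    using j by (auto dest: in_set_takeD)
  have step: "seq_smult R N (take (Suc j) xs) = (\<lambda>m. xs ! j \<odot>\<^bsub>N\<^esub> m) ` carrier N <+>\<^bsub>N\<^esub> ?H"
    using N.Idl_smult_insert[OF carr] j unfolding seq_smult_def N.Idl_smult_def
    by (simp add: take_Suc_conv_app_nth)
  have "submodule (seq_smult R N (take (Suc j) xs)) R N"
    unfolding step
    by (intro N.submodule_set_add N.submodule_smult_image carr N.carrier_is_submodule IH(1))
  moreover have "take (Suc j) is = take j is @ [is ! j]"
    using j len by (simp add: take_Suc_conv_app_nth)
  then have "(\<lambda>i. h i + count_list (take (Suc j) is) i) =
      (\<lambda>i. (h(is ! j := Suc (h (is ! j)))) i + count_list (take j is) i)" for h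
    by (auto simp: fun_eq_iff)
  then have "hilbert_coeffs R d I (quot_module N (seq_smult R N (take (Suc j) xs))) =
      (\<lambda>h. hilbert_coeffs R d I N (\<lambda>i. h i + count_list (take (Suc j) is) i))"
    unfolding weak_FC_hilbert_coeffs[OF N IH(1) fc[OF j] step] IH(2) shift_coeff_def by simp
  ultimately show ?case by blast
qed

end


section \<open>Mixed multiplicities as Hilbert-Samuel multiplicities\<close>

theorem corollary3p10:
  fixes R :: "('a, 'r) ring_scheme"
    and \<nn> J :: "'a set"
    and N :: "('a, 'b, 'm) module_scheme"
    and d :: nat
    and I :: "nat \<Rightarrow> 'a set"
    and k :: "nat \<Rightarrow> nat"
    and xs :: "'a list"
  assumes "noetherian_ring R"
    and "local_ring R \<nn>"
    and "infinite (carrier (R Quot \<nn>))"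
    and "fin_gen_module R N"
    and "d \<ge> 1"
    and "primary_ideal J R" and "ideal_radical R J = \<nn>"
    and "I 0 = J"
    and "\<forall>i \<in> {1..d}. ideal (I i) R"
    and "k \<in> multi_index d"
    and "mixed_multiplicity_defined R d I N k"
    and "weak_FC_sequence_of_type R d I N k xs"
  shows "of_int (mixed_multiplicity R d I N k) =
           hs_multiplicity R J
             (quot_module N (colon_infinity R N (seq_smult R N xs) (ideals_product R d I))) \<and>
         (mixed_multiplicity R d I N k \<noteq> 0 \<longleftrightarrow>
           module_dim R
             (quot_module N (colon_infinity R N (seq_smult R N xs) (ideals_product R d I))) = 1)"
proof -
  have N: "noetherian_module R N" by (rule fin_gen_imp_noetherian_module[OF assms(1,4)])
  have ideals: "\<forall>i\<le>d. ideal (I i) R"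
  proof (intro allI impI)
    fix i assume "i \<le> d"
    then show "ideal (I i) R"
      using assms(6,8,9) by (cases "i = 0") (auto simp: primary_ideal_def)
  qed
  interpret ideal_tuple R \<nn> d I
    by (intro ideal_tuple.intro assms(1,2) ideals) (use assms(6,7,8) in simp_all)
  interpret N: noetherian_module R N by (rule N)
  obtain "is" where seq: "length is = length xs"
      "\<And>j. j < length xs \<Longrightarrow>
        weak_FC_element R d I (quot_module N (seq_smult R N (take j xs))) (is ! j) (xs ! j)"
      "\<forall>i\<le>d. count_list is i = k i"
    using assms(12) unfolding weak_FC_sequence_of_type_def by blast
  let ?H = "seq_smult R N xs"
  let ?L = "colon_infinity R N ?H \<I>"
  let ?Q = "quot_module N ?L"
  have H: "submodule ?H R N" and coeffs: "hilbert_coeffs R d I (quot_module N ?H) =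
      (\<lambda>h. hilbert_coeffs R d I N (\<lambda>i. h i + count_list is i))"
    using weak_FC_sequence_hilbert_coeffs[OF N seq(1,2), of "length xs"] seq(1) by simp_all
  have "count_list is i = 0" if "i > d" for i
  proof -
    have "x \<le> d" if "x \<in> set is" for x
    proof -
      obtain j where "j < length xs" "is ! j = x" using \<open>x \<in> set is\<close> seq(1) by (auto simp: in_set_conv_nth)
      with seq(2)[of j] show ?thesis by (simp add: weak_FC_element_def)
    qed
    with \<open>i > d\<close> have "i \<notin> set is" by force
    then show ?thesis by (simp add: count_list_0_iff)
  qed
  then have count: "count_list is i = k i" for i
    using seq(3) assms(10) by (cases "i \<le> d") (auto simp: multi_index_def)
  define c where "c = hilbert_coeffs R d I ?Q"
  have c: "c h = hilbert_coeffs R d I N (\<lambda>i. h i + k i)" for h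
    unfolding c_def hilbert_coeffs_quot_torsion[OF N H] coeffs count ..
  have L: "submodule ?L R N" by (rule colon_infinity_stable[OF N H])
  have Q: "noetherian_module R ?Q" by (rule N.noetherian_module_quot[OF L])
  have hp: "coeff_fun d c" "large (\<lambda>n. \<exists>l. hilb ?Q n = enat l \<and> int l = binom_eval d c n)"
    using hilb_poly_hilbert_coeffs[OF Q] by (simp_all add: c_def hilb_poly_def)
  have supp: "{h. c h \<noteq> 0} \<subseteq> {\<lambda>_. 0}"
  proof
    fix h assume h: "h \<in> {h. c h \<noteq> 0}"
    then have "h \<in> multi_index d" using hp(1) by (auto simp: coeff_fun_def)
    then have "(\<lambda>i. h i + k i) \<in> multi_index d" using assms(10) by (simp add: multi_index_def)
    then have "(\<lambda>i. h i + k i) = k"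
      using assms(11) h unfolding c mixed_multiplicity_defined_def by auto
    then have "h i = 0" for i by (metis add_cancel_left_left)
    then show "h \<in> {\<lambda>_. 0}" by auto
  qed
  have val: "binom_eval d c n = c (\<lambda>_. 0)" for n
    using supp by (subst binom_eval_superset[of "{\<lambda>_. 0}"]) auto
  define e where "e = nat (c (\<lambda>_. 0))"
  obtain n\<^sub>0 where n0: "\<And>n. n \<in> multi_index d \<Longrightarrow> \<forall>i\<le>d. n\<^sub>0 \<le> n i \<Longrightarrow>
      \<exists>l. hilb ?Q n = enat l \<and> int l = c (\<lambda>_. 0)"
    using hp(2) unfolding large_def val by blast
  have const: "hilb ?Q n = enat e" if "n \<in> multi_index d" "\<forall>i\<le>d. n\<^sub>0 \<le> n i" for n
    using n0[OF that] by (auto simp: e_def)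
  have mm: "mixed_multiplicity R d I N k = int e"
  proof -
    let ?n = "\<lambda>i. if i \<le> d then n\<^sub>0 else 0"
    have "c (\<lambda>_. 0) \<ge> 0" using n0[of ?n] by (auto simp: multi_index_def)
    then show ?thesis by (simp add: mixed_multiplicity_def e_def c)
  qed
  interpret Q: module R ?Q by (rule N.module_quot[OF L])
  show ?thesis
  proof (cases "carrier ?Q = {\<zero>\<^bsub>?Q\<^esub>}")
    case True
    let ?n = "\<lambda>i. if i \<le> d then n\<^sub>0 else 0"
    note X = submodule_X[OF Q.module_axioms]
    have X0: "X ?Q n = {\<zero>\<^bsub>?Q\<^esub>}" for n
      using Q.submoduleE(1)[OF X, of n] Q.submodule_zero[OF X, of n] True by blast
    have "hilb ?Q ?n = 0"
      unfolding hilb_def X0 using sub_len_eq_0_iff[OF Q.zero_submodule Q.zero_submodule] by simp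
    moreover have "hilb ?Q ?n = enat e" by (rule const) (auto simp: multi_index_def)
    ultimately have "e = 0" by (simp add: zero_enat_def)
    have ann: "module_annihilator R ?Q = carrier R"
      using True by (auto simp: module_annihilator_def)
    have "\<not> primeideal P R" if "carrier R \<subseteq> P" for P
      using that primeideal.I_notcarr[of P R] additive_subgroup.a_subset[of P R]
      by (auto simp: primeideal_def ideal_def)
    then have no: "\<not> (\<forall>i\<le>n. primeideal (P i) R \<and> module_annihilator R ?Q \<subseteq> P i)" for n :: nat and P
      unfolding ann by blast
    have "module_dim R ?Q = Sup {}"
      unfolding module_dim_def using no by (intro arg_cong[of _ _ Sup]) blast
    then have "module_dim R ?Q \<noteq> 1" by (simp add: bot_ereal_def)
    with \<open>e = 0\<close> True show ?thesis by (simp add: mm hs_multiplicity_def)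
  next
    case False
    interpret Q: torsion_free_constant R ?Q \<nn> d I n\<^sub>0 e
    proof (intro torsion_free_constant.intro local_noetherian[OF Q] torsion_free_constant_axioms.intro
        ideals J_le False)
      show "P = \<nn>" if "primeideal P R" "I 0 \<subseteq> P" for P using that by (rule prime_over_J)
      show "m = \<zero>\<^bsub>?Q\<^esub>"
        if "m \<in> carrier ?Q" "\<forall>a\<in>ideal_power R \<I> s. a \<odot>\<^bsub>?Q\<^esub> m = \<zero>\<^bsub>?Q\<^esub>" for s m
        using that by (rule quot_torsion_free[OF N H])
      show "sub_len R ?Q (ideal_smult ?Q (multi_power R d I (n(0 := Suc (n 0)))) (carrier ?Q))
          (ideal_smult ?Q (multi_power R d I n) (carrier ?Q)) = enat e"
        if "n \<in> multi_index d" "\<forall>i\<le>d. n\<^sub>0 \<le> n i" for n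
        using const[OF that] by (simp add: hilb_def X_def)
    qed
    show ?thesis
      using Q.hs_multiplicity_eq Q.dim_eq_1 Q.e_nonzero by (simp add: mm assms(8))
  qed
qed

end
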